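(* Let $\Gamma$ be a finite connected simplicial graph. Then every subgroup of the Bestvina-Brady group $B_\Gamma$ is a RAAG if and only if $\Gamma$ is chordal and no induced subgraph of $\Gamma$ is isomorphic to the gem graph $\nabla$ or to the overlapping-gems graph $\bar H$.
   Context: A simplicial graph $\Gamma=(V,E)$ consists of a set $V$ of vertices and a set $E$ of $2$-element subsets of $V$. The right-angled Artin group of $\Gamma$ is $G_\Gamma=\langle v\in V\mid vw=wv \text{ for } \{v,w\}\in E\rangle$. A group is a RAAG if it is isomorphic to $G_\Lambda$ for some simplicial graph $\Lambda$ (possibly infinite). The Bestvina-Brady group $B_\Gamma$ is the kernel of the homomorphism $\chi_\Gamma:G_\Gamma\to\mathbb Z$ with $\chi_\Gamma(v)=1$ for all $v\in V$. A graph is chordal if it contains no induced cycle of length $\geq 4$. The gem graph $\nabla$ has vertices $a_1,a_2,a_3,a_4,c$ and edges $\{a_1,a_2\},\{a_2,a_3\},\{a_3,a_4\}$ and $\{c,a_i\}$ for $i=1,\dots,4$ (the cone over the path with $4$ vertices). The overlapping-gems graph $\bar H$ has six vertices $a,b,c,d,e,f$, where $\{b,c,e,f\}$ spans a complete graph $K_4$, $a$ is adjacent exactly to $b$ and $f$, and $d$ is adjacent exactly to $c$ and $e$. *)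

theory Defs
  imports "HOL-Algebra.Elementary_Groups"
begin

section \<open>Simplicial graphs\<close>

record 'a sgraph =
  verts :: "'a set"
  edges :: "'a set set"

definition simplicial_graph :: "'a sgraph \<Rightarrow> bool" where
  "simplicial_graph \<Gamma> \<longleftrightarrow> (\<forall>e\<in>edges \<Gamma>. e \<subseteq> verts \<Gamma> \<and> card e = 2)"

definition graph_iso :: "('a \<Rightarrow> 'b) \<Rightarrow> 'a sgraph \<Rightarrow> 'b sgraph \<Rightarrow> bool" where
  "graph_iso f \<Gamma> \<Lambda> \<longleftrightarrow> bij_betw f (verts \<Gamma>) (verts \<Lambda>) \<and> bij_betw ((`) f) (edges \<Gamma>) (edges \<Lambda>)"

definition isomorphic_graphs :: "'a sgraph \<Rightarrow> 'b sgraph \<Rightarrow> bool" where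
  "isomorphic_graphs \<Gamma> \<Lambda> \<longleftrightarrow> (\<exists>f. graph_iso f \<Gamma> \<Lambda>)"

definition induced_subgraph :: "'a sgraph \<Rightarrow> 'a set \<Rightarrow> 'a sgraph" where
  "induced_subgraph \<Gamma> W = \<lparr>verts = W, edges = {e \<in> edges \<Gamma>. e \<subseteq> W}\<rparr>"

definition has_induced :: "'a sgraph \<Rightarrow> 'b sgraph \<Rightarrow> bool" where
  "has_induced \<Gamma> \<Lambda> \<longleftrightarrow> (\<exists>W\<subseteq>verts \<Gamma>. isomorphic_graphs (induced_subgraph \<Gamma> W) \<Lambda>)"

text \<open>The empty graph counts as connected here.\<close>

definition connected_graph :: "'a sgraph \<Rightarrow> bool" where
  "connected_graph \<Gamma> \<longleftrightarrow> (\<forall>u\<in>verts \<Gamma>. \<forall>v\<in>verts \<Gamma>. (u, v) \<in> {(x, y). {x, y} \<in> edges \<Gamma>}\<^sup>*)"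

text \<open>The following is a cycle for \<open>n \<ge> 3\<close> only.\<close>

definition cycle_graph :: "nat \<Rightarrow> nat sgraph" where
  "cycle_graph n = \<lparr>verts = {0..<n}, edges = {{i, (i + 1) mod n} |i. i < n}\<rparr>"

definition chordal :: "'a sgraph \<Rightarrow> bool" where
  "chordal \<Gamma> \<longleftrightarrow> (\<forall>n\<ge>4. \<not> has_induced \<Gamma> (cycle_graph n))"

datatype gem_vertex = Gem_a1 | Gem_a2 | Gem_a3 | Gem_a4 | Gem_c

definition gem_graph :: "gem_vertex sgraph" where
  "gem_graph = \<lparr>verts = {Gem_a1, Gem_a2, Gem_a3, Gem_a4, Gem_c},
     edges = {{Gem_a1, Gem_a2}, {Gem_a2, Gem_a3}, {Gem_a3, Gem_a4},
              {Gem_c, Gem_a1}, {Gem_c, Gem_a2}, {Gem_c, Gem_a3}, {Gem_c, Gem_a4}}\<rparr>"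

datatype og_vertex = OG_a | OG_b | OG_c | OG_d | OG_e | OG_f

definition overlapping_gems_graph :: "og_vertex sgraph" where
  "overlapping_gems_graph = \<lparr>verts = {OG_a, OG_b, OG_c, OG_d, OG_e, OG_f},
     edges = {{OG_b, OG_c}, {OG_b, OG_e}, {OG_b, OG_f}, {OG_c, OG_e}, {OG_c, OG_f}, {OG_e, OG_f},
              {OG_a, OG_b}, {OG_a, OG_f}, {OG_d, OG_c}, {OG_d, OG_e}}\<rparr>"


section \<open>Group presentations\<close>

text \<open>The letter \<open>(x, True)\<close> stands for the generator \<open>x\<close>, and \<open>(x, False)\<close> for its inverse.
  A pair \<open>(u, v)\<close> of words in the set of relations imposes \<open>u = v\<close>.\<close>

type_synonym 'a word = "('a \<times> bool) list"

definition words :: "'a set \<Rightarrow> 'a word set" where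
  "words S = lists (S \<times> UNIV)"

inductive_set pres_rel :: "'a set \<Rightarrow> ('a word \<times> 'a word) set \<Rightarrow> ('a word \<times> 'a word) set"
  for S :: "'a set" and R :: "('a word \<times> 'a word) set" where
  refl: "w \<in> words S \<Longrightarrow> (w, w) \<in> pres_rel S R"
| sym: "(u, v) \<in> pres_rel S R \<Longrightarrow> (v, u) \<in> pres_rel S R"
| trans: "(u, v) \<in> pres_rel S R \<Longrightarrow> (v, w) \<in> pres_rel S R \<Longrightarrow> (u, w) \<in> pres_rel S R"
| append: "(u, u') \<in> pres_rel S R \<Longrightarrow> (v, v') \<in> pres_rel S R \<Longrightarrow> (u @ v, u' @ v') \<in> pres_rel S R"
| cancel: "x \<in> S \<Longrightarrow> ([(x, b), (x, \<not> b)], []) \<in> pres_rel S R"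
| relator: "(u, v) \<in> R \<Longrightarrow> u \<in> words S \<Longrightarrow> v \<in> words S \<Longrightarrow> (u, v) \<in> pres_rel S R"

definition presented_group :: "'a set \<Rightarrow> ('a word \<times> 'a word) set \<Rightarrow> 'a word set monoid" where
  "presented_group S R =
     \<lparr>carrier = words S // pres_rel S R,
      mult = (\<lambda>X Y. \<Union>u\<in>X. \<Union>v\<in>Y. pres_rel S R `` {u @ v}),
      one = pres_rel S R `` {[]}\<rparr>"

lemma words_simps [simp]:
  "[] \<in> words S"
  "l # w \<in> words S \<longleftrightarrow> fst l \<in> S \<and> w \<in> words S"
  "u @ v \<in> words S \<longleftrightarrow> u \<in> words S \<and> v \<in> words S"
  by (auto simp: words_def mem_Times_iff)

lemma words_inverse [simp]: "w \<in> words S \<Longrightarrow> map (apsnd Not) (rev w) \<in> words S"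
  by (induction w) auto

lemma words_map: "w \<in> words S \<Longrightarrow> f ` S \<subseteq> T \<Longrightarrow> map (apfst f) w \<in> words T"
  by (induction w) auto

lemma pres_rel_words: "(u, v) \<in> pres_rel S R \<Longrightarrow> u \<in> words S \<and> v \<in> words S"
  by (induction rule: pres_rel.induct) auto

lemma equiv_pres_rel: "equiv (words S) (pres_rel S R)"
  by (rule equivI)
    (auto simp: refl_on_def sym_def trans_def dest: pres_rel_words
          intro: pres_rel.refl pres_rel.sym pres_rel.trans)

lemma mult_class:
  assumes "u \<in> words S" "v \<in> words S"
  shows "(pres_rel S R `` {u}) \<otimes>\<^bsub>presented_group S R\<^esub> (pres_rel S R `` {v}) = pres_rel S R `` {u @ v}"
proof -
  have "(\<Union>x\<in>pres_rel S R `` {u}. \<Union>y\<in>pres_rel S R `` {v}. pres_rel S R `` {x @ y})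
      = pres_rel S R `` {u @ v}"
    by (rule UN_equiv_class2[OF equiv_pres_rel equiv_pres_rel _ assms])
      (auto intro!: congruent2I' equiv_class_eq[OF equiv_pres_rel] pres_rel.append)
  then show ?thesis by (simp add: presented_group_def)
qed

lemma pres_rel_inverse:
  assumes "w \<in> words S"
  shows "(map (apsnd Not) (rev w) @ w, []) \<in> pres_rel S R"
  using assms
proof (induction w)
  case Nil
  then show ?case by (auto intro: pres_rel.refl)
next
  case (Cons l w)
  obtain x b where l: "l = (x, b)" by fastforce
  have inv: "map (apsnd Not) (rev w) \<in> words S" using Cons by auto
  have "([(x, \<not> b), (x, b)], []) \<in> pres_rel S R"
    using Cons l pres_rel.cancel[of x S "\<not> b" R] by simp
  from pres_rel.append[OF pres_rel.refl[OF inv] pres_rel.append[OF this pres_rel.refl]]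
  have "(map (apsnd Not) (rev w) @ [(x, \<not> b), (x, b)] @ w, map (apsnd Not) (rev w) @ [] @ w)
      \<in> pres_rel S R"
    using Cons by auto
  then show ?case using Cons l by (auto intro: pres_rel.trans)
qed

lemma group_presented_group: "group (presented_group S R)"
proof (rule groupI)
  let ?r = "pres_rel S R"
  have carrierE: "\<exists>u\<in>words S. X = ?r `` {u}" if "X \<in> carrier (presented_group S R)" for X
    using that by (auto simp: presented_group_def elim!: quotientE)
  have carrierI: "?r `` {u} \<in> carrier (presented_group S R)" if "u \<in> words S" for u
    using that by (simp add: presented_group_def quotientI)
  have one: "\<one>\<^bsub>presented_group S R\<^esub> = ?r `` {[]}" by (simp add: presented_group_def)
  note [simp] = one mult_class
  fix X Y Z
  show "\<one>\<^bsub>presented_group S R\<^esub> \<in> carrier (presented_group S R)" by (simp add: carrierI)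
  assume X: "X \<in> carrier (presented_group S R)"
  then obtain u where u: "u \<in> words S" "X = ?r `` {u}" using carrierE by blast
  show "\<one>\<^bsub>presented_group S R\<^esub> \<otimes>\<^bsub>presented_group S R\<^esub> X = X" using u by simp
  have "?r `` {map (apsnd Not) (rev u) @ u} = ?r `` {[]}"
    by (rule equiv_class_eq[OF equiv_pres_rel pres_rel_inverse[OF u(1)]])
  moreover have inv: "map (apsnd Not) (rev u) \<in> words S" using u by auto
  ultimately show "\<exists>Y\<in>carrier (presented_group S R). Y \<otimes>\<^bsub>presented_group S R\<^esub> X = \<one>\<^bsub>presented_group S R\<^esub>"
    using u by (intro bexI[OF _ carrierI[OF inv]]) simp
  assume Y: "Y \<in> carrier (presented_group S R)"
  then obtain v where v: "v \<in> words S" "Y = ?r `` {v}" using carrierE by blast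
  show "X \<otimes>\<^bsub>presented_group S R\<^esub> Y \<in> carrier (presented_group S R)"
    using u v by (simp add: carrierI)
  assume Z: "Z \<in> carrier (presented_group S R)"
  then obtain w where w: "w \<in> words S" "Z = ?r `` {w}" using carrierE by blast
  show "X \<otimes>\<^bsub>presented_group S R\<^esub> Y \<otimes>\<^bsub>presented_group S R\<^esub> Z =
        X \<otimes>\<^bsub>presented_group S R\<^esub> (Y \<otimes>\<^bsub>presented_group S R\<^esub> Z)"
    using u v w by simp
qed


section \<open>Right-angled Artin groups\<close>

definition raag_relations :: "'a sgraph \<Rightarrow> ('a word \<times> 'a word) set" where
  "raag_relations \<Gamma> = {([(v, True), (w, True)], [(w, True), (v, True)]) |v w. {v, w} \<in> edges \<Gamma>}"

definition raag :: "'a sgraph \<Rightarrow> 'a word set monoid" where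
  "raag \<Gamma> = presented_group (verts \<Gamma>) (raag_relations \<Gamma>)"

definition raag_class :: "'a sgraph \<Rightarrow> 'a word \<Rightarrow> 'a word set" where
  "raag_class \<Gamma> w = pres_rel (verts \<Gamma>) (raag_relations \<Gamma>) `` {w}"

definition raag_gen :: "'a sgraph \<Rightarrow> 'a \<Rightarrow> 'a word set" where
  "raag_gen \<Gamma> v = raag_class \<Gamma> [(v, True)]"

text \<open>Defining graphs may be infinite. HOL cannot quantify over the type of their vertices, so we
  take vertices in the type of the elements of \<open>G\<close>; lemma \<open>is_raagI\<close> below shows that a group
  isomorphic to \<open>raag \<Lambda>\<close>, for \<open>\<Lambda>\<close> with vertices of any type, satisfies \<open>is_raag\<close>.\<close>

definition is_raag :: "'g monoid \<Rightarrow> bool" where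
  "is_raag G \<longleftrightarrow> group G \<and> (\<exists>\<Lambda> :: 'g sgraph. simplicial_graph \<Lambda> \<and> G \<cong> raag \<Lambda>)"

lemma group_raag: "group (raag \<Gamma>)"
  by (simp add: raag_def group_presented_group)

definition weight :: "('a \<Rightarrow> int) \<Rightarrow> 'a word \<Rightarrow> int" where
  "weight g w = (\<Sum>(x, b)\<leftarrow>w. if b then g x else - g x)"

lemma weight_pres_rel:
  assumes "(u, v) \<in> pres_rel (verts \<Gamma>) (raag_relations \<Gamma>)"
  shows "weight g u = weight g v"
  using assms by (induction rule: pres_rel.induct) (auto simp: weight_def raag_relations_def)

lemma carrier_raag: "carrier (raag \<Gamma>) = raag_class \<Gamma> ` words (verts \<Gamma>)"
  by (auto simp: raag_def presented_group_def raag_class_def quotient_def)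

lemma raag_class_eq_iff:
  assumes "u \<in> words (verts \<Gamma>)" "v \<in> words (verts \<Gamma>)"
  shows "raag_class \<Gamma> u = raag_class \<Gamma> v \<longleftrightarrow> (u, v) \<in> pres_rel (verts \<Gamma>) (raag_relations \<Gamma>)"
  unfolding raag_class_def by (rule eq_equiv_class_iff[OF equiv_pres_rel assms])

lemma mult_raag_class:
  "u \<in> words (verts \<Gamma>) \<Longrightarrow> v \<in> words (verts \<Gamma>) \<Longrightarrow>
   raag_class \<Gamma> u \<otimes>\<^bsub>raag \<Gamma>\<^esub> raag_class \<Gamma> v = raag_class \<Gamma> (u @ v)"
  by (simp add: raag_def raag_class_def mult_class)

lemma inj_on_raag_gen: "inj_on (raag_gen \<Gamma>) (verts \<Gamma>)"
proof (rule inj_onI)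
  fix x y assume xy: "x \<in> verts \<Gamma>" "y \<in> verts \<Gamma>" "raag_gen \<Gamma> x = raag_gen \<Gamma> y"
  then have "([(x, True)], [(y, True)]) \<in> pres_rel (verts \<Gamma>) (raag_relations \<Gamma>)"
    by (simp add: raag_gen_def raag_class_eq_iff)
  from weight_pres_rel[OF this, of "\<lambda>z. of_bool (z = x)"] show "x = y"
    by (auto simp: weight_def of_bool_def split: if_splits)
qed

definition image_graph :: "('a \<Rightarrow> 'b) \<Rightarrow> 'a sgraph \<Rightarrow> 'b sgraph" where
  "image_graph f \<Gamma> = \<lparr>verts = f ` verts \<Gamma>, edges = (`) f ` edges \<Gamma>\<rparr>"

lemma pres_rel_map:
  assumes "(u, v) \<in> pres_rel (verts \<Gamma>) (raag_relations \<Gamma>)"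
  shows "(map (apfst f) u, map (apfst f) v)
    \<in> pres_rel (verts (image_graph f \<Gamma>)) (raag_relations (image_graph f \<Gamma>))"
  using assms
proof (induction rule: pres_rel.induct)
  case (relator u v)
  then obtain x y where xy: "u = [(x, True), (y, True)]" "v = [(y, True), (x, True)]" "{x, y} \<in> edges \<Gamma>"
    by (auto simp: raag_relations_def)
  then have "f ` {x, y} \<in> edges (image_graph f \<Gamma>)"
    unfolding image_graph_def by (simp del: image_insert)
  then have "(map (apfst f) u, map (apfst f) v) \<in> raag_relations (image_graph f \<Gamma>)"
    using xy by (auto simp: raag_relations_def)
  then show ?case
    using relator xy by (intro pres_rel.relator) (auto simp: image_graph_def)
qed (auto simp: image_graph_def intro: pres_rel.intros words_map)

lemma image_graph_inverse:
  assumes "simplicial_graph \<Gamma>" "\<And>x. x \<in> verts \<Gamma> \<Longrightarrow> g (f x) = x"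
  shows "image_graph g (image_graph f \<Gamma>) = \<Gamma>"
proof -
  have "(\<lambda>x. g (f x)) ` A = A" if "A \<subseteq> verts \<Gamma>" for A
    using that assms(2) by force
  then show ?thesis
    using assms(1) unfolding simplicial_graph_def image_graph_def by (auto simp: image_image)
qed

lemma raag_image_graph:
  fixes f :: "'a \<Rightarrow> 'b"
  assumes \<Gamma>: "simplicial_graph \<Gamma>" and inj: "inj_on f (verts \<Gamma>)"
  shows "raag \<Gamma> \<cong> raag (image_graph f \<Gamma>)"
proof -
  let ?\<Lambda> = "image_graph f \<Gamma>"
  let ?F = "map (apfst f) :: 'a word \<Rightarrow> 'b word"
  define g where "g = inv_into (verts \<Gamma>) f"
  have gf: "g (f x) = x" if "x \<in> verts \<Gamma>" for x
    using that inj by (simp add: g_def)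
  have GF: "map (apfst g) (?F w) = w" if "w \<in> words (verts \<Gamma>)" for w
    using that gf by (induction w) auto
  have F: "?F w \<in> words (verts ?\<Lambda>)" if "w \<in> words (verts \<Gamma>)" for w
    using that by (auto simp: image_graph_def intro: words_map)
  have F_surj: "\<exists>u\<in>words (verts \<Gamma>). w = ?F u" if "w \<in> words (verts ?\<Lambda>)" for w
  proof (rule bexI)
    have "f (g y) = y" if "y \<in> verts ?\<Lambda>" for y
      using that gf by (auto simp: image_graph_def)
    then show "w = ?F (map (apfst g) w)"
      using that by (induction w) auto
    show "map (apfst g) w \<in> words (verts \<Gamma>)"
      using that gf by (auto simp: image_graph_def intro: words_map)
  qed
  have eq: "raag_class \<Gamma> u = raag_class \<Gamma> v \<longleftrightarrow> raag_class ?\<Lambda> (?F u) = raag_class ?\<Lambda> (?F v)"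
    if "u \<in> words (verts \<Gamma>)" "v \<in> words (verts \<Gamma>)" for u v
  proof -
    have "(u, v) \<in> pres_rel (verts \<Gamma>) (raag_relations \<Gamma>)"
      if "(?F u, ?F v) \<in> pres_rel (verts ?\<Lambda>) (raag_relations ?\<Lambda>)"
      using pres_rel_map[OF that, of g] GF \<open>u \<in> _\<close> \<open>v \<in> _\<close>
      by (simp add: image_graph_inverse[where f = f and g = g, OF \<Gamma> gf] del: map_map)
    then show ?thesis
      using that F[OF that(1)] F[OF that(2)] pres_rel_map[of u v \<Gamma> f]
      by (auto simp: raag_class_eq_iff)
  qed
  define h where "h X = raag_class ?\<Lambda> (?F (SOME w. w \<in> words (verts \<Gamma>) \<and> X = raag_class \<Gamma> w))" for X
  have h: "h (raag_class \<Gamma> w) = raag_class ?\<Lambda> (?F w)" if "w \<in> words (verts \<Gamma>)" for w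
  proof -
    let ?P = "\<lambda>u. u \<in> words (verts \<Gamma>) \<and> raag_class \<Gamma> w = raag_class \<Gamma> u"
    have "?P (SOME u. ?P u)" by (rule someI[of ?P w]) (use that in simp)
    then show ?thesis using eq[OF that, of "SOME u. ?P u"] unfolding h_def by metis
  qed
  have "h \<in> iso (raag \<Gamma>) (raag ?\<Lambda>)"
  proof (rule isoI)
    show "h \<in> hom (raag \<Gamma>) (raag ?\<Lambda>)"
      by (rule homI) (auto simp: carrier_raag h mult_raag_class F)
    show "bij_betw h (carrier (raag \<Gamma>)) (carrier (raag ?\<Lambda>))"
      unfolding bij_betw_def
    proof
      show "inj_on h (carrier (raag \<Gamma>))"
      proof (rule inj_onI)
        fix X Y assume XY: "X \<in> carrier (raag \<Gamma>)" "Y \<in> carrier (raag \<Gamma>)" "h X = h Y"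
        then obtain u v where "u \<in> words (verts \<Gamma>)" "X = raag_class \<Gamma> u"
          "v \<in> words (verts \<Gamma>)" "Y = raag_class \<Gamma> v"
          unfolding carrier_raag by blast
        then show "X = Y" using XY(3) eq by (simp add: h)
      qed
      have "h ` carrier (raag \<Gamma>) = (\<lambda>w. raag_class ?\<Lambda> (?F w)) ` words (verts \<Gamma>)"
        unfolding carrier_raag image_image using h by (intro image_cong) auto
      also have "\<dots> = raag_class ?\<Lambda> ` ?F ` words (verts \<Gamma>)"
        by (simp add: image_image)
      also have "?F ` words (verts \<Gamma>) = words (verts ?\<Lambda>)"
        using F F_surj by blast
      finally show "h ` carrier (raag \<Gamma>) = carrier (raag ?\<Lambda>)"
        by (simp only: carrier_raag)
    qed
  qed
  then show ?thesis by (auto simp: is_iso_def)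
qed

lemma is_raagI:
  fixes \<Lambda> :: "'b sgraph" and G :: "'g monoid"
  assumes "group G" "simplicial_graph \<Lambda>" "G \<cong> raag \<Lambda>"
  shows "is_raag G"
proof -
  obtain k where k: "k \<in> iso (raag \<Lambda>) G"
    using group.iso_sym[OF assms(1,3)] by (auto simp: is_iso_def)
  have gen: "raag_gen \<Lambda> ` verts \<Lambda> \<subseteq> carrier (raag \<Lambda>)"
    by (auto simp: carrier_raag raag_gen_def)
  have "inj_on k (carrier (raag \<Lambda>))"
    using k by (auto simp: iso_def bij_betw_def)
  then have inj: "inj_on (k \<circ> raag_gen \<Lambda>) (verts \<Lambda>)"
    using gen by (intro comp_inj_on inj_on_raag_gen) (rule inj_on_subset)
  have "simplicial_graph (image_graph (k \<circ> raag_gen \<Lambda>) \<Lambda>)"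
    using assms(2) inj unfolding simplicial_graph_def image_graph_def
    by (auto simp: card_image[OF inj_on_subset[OF inj]] simp del: image_comp comp_apply)
  moreover have "G \<cong> raag (image_graph (k \<circ> raag_gen \<Lambda>) \<Lambda>)"
    using assms(3) raag_image_graph[OF assms(2) inj] by (rule iso_trans)
  ultimately show ?thesis
    using assms(1) unfolding is_raag_def by blast
qed


section \<open>Bestvina--Brady groups\<close>

text \<open>The exponent sum is constant on each element of \<open>carrier (raag \<Gamma>)\<close>, so \<open>the_elem\<close> is applied
  to a singleton there. The lemmas below show that \<open>bb_char \<Gamma>\<close> is the homomorphism to the integers
  that maps every generator to 1.\<close>

definition bb_char :: "'a sgraph \<Rightarrow> 'a word set \<Rightarrow> int" where
  "bb_char \<Gamma> X = the_elem ((\<lambda>w. \<Sum>(x, b)\<leftarrow>w. if b then 1 else - 1) ` X)"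

definition bestvina_brady :: "'a sgraph \<Rightarrow> 'a word set monoid" where
  "bestvina_brady \<Gamma> = (raag \<Gamma>)\<lparr>carrier := kernel (raag \<Gamma>) integer_group (bb_char \<Gamma>)\<rparr>"

lemma bb_char_class:
  assumes "w \<in> words (verts \<Gamma>)"
  shows "bb_char \<Gamma> (raag_class \<Gamma> w) = (\<Sum>(x, b)\<leftarrow>w. if b then 1 else - 1)"
proof -
  have "w \<in> raag_class \<Gamma> w"
    using assms by (simp add: raag_class_def pres_rel.refl)
  then have "weight (\<lambda>_. 1) ` raag_class \<Gamma> w = {weight (\<lambda>_. 1) w}"
    by (auto simp: raag_class_def dest: weight_pres_rel[where g = "\<lambda>_. 1"])
  then show ?thesis
    by (simp add: bb_char_def weight_def)
qed

lemma bb_char_hom: "bb_char \<Gamma> \<in> hom (raag \<Gamma>) integer_group"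
  by (rule homI) (auto simp: carrier_raag mult_raag_class bb_char_class)

lemma group_bestvina_brady: "group (bestvina_brady \<Gamma>)"
proof -
  have "group_hom (raag \<Gamma>) integer_group (bb_char \<Gamma>)"
    by (simp add: group_hom_def group_hom_axioms_def group_raag bb_char_hom)
  then show ?thesis
    unfolding bestvina_brady_def
    by (intro group.subgroup_imp_group[OF group_raag] group_hom.subgroup_kernel)
qed

lemma bb_char_gen: "v \<in> verts \<Gamma> \<Longrightarrow> bb_char \<Gamma> (raag_gen \<Gamma> v) = 1"
  by (simp add: raag_gen_def bb_char_class)

lemma bb_char_unique:
  assumes hom: "\<chi> \<in> hom (raag \<Gamma>) integer_group"
    and gen: "\<And>v. v \<in> verts \<Gamma> \<Longrightarrow> \<chi> (raag_gen \<Gamma> v) = 1"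
    and X: "X \<in> carrier (raag \<Gamma>)"
  shows "\<chi> X = bb_char \<Gamma> X"
proof -
  have mult: "\<chi> (raag_class \<Gamma> (u @ v)) = \<chi> (raag_class \<Gamma> u) + \<chi> (raag_class \<Gamma> v)"
    if "u \<in> words (verts \<Gamma>)" "v \<in> words (verts \<Gamma>)" for u v
    using that hom_mult[OF hom, of "raag_class \<Gamma> u" "raag_class \<Gamma> v"]
    by (simp add: mult_raag_class carrier_raag)
  have Nil: "\<chi> (raag_class \<Gamma> []) = 0"
    using mult[of "[]" "[]"] by simp
  have letter: "\<chi> (raag_class \<Gamma> [(x, b)]) = (if b then 1 else - 1)" if x: "x \<in> verts \<Gamma>" for x b
  proof -
    have "raag_class \<Gamma> ([(x, True)] @ [(x, False)]) = raag_class \<Gamma> []"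
      using x pres_rel.cancel[of x "verts \<Gamma>" True] by (simp add: raag_class_eq_iff)
    then show ?thesis
      using mult[of "[(x, True)]" "[(x, False)]"] gen[OF x] x Nil
      by (cases b) (auto simp: raag_gen_def)
  qed
  have "\<chi> (raag_class \<Gamma> w) = (\<Sum>(x, b)\<leftarrow>w. if b then 1 else - 1)" if "w \<in> words (verts \<Gamma>)" for w
    using that
  proof (induction w)
    case (Cons l w)
    then show ?case using mult[of "[l]" w] letter[of "fst l" "snd l"] by (cases l) auto
  qed (simp add: Nil)
  then show ?thesis
    using X by (auto simp: carrier_raag bb_char_class)
qed

end

theory Submission
  imports Defs
begin

text \<open>
  Every subgroup is a right-angled Artin group as soon as the graph decomposes: by induction on the
  vertex set, a connected chordal graph without gems and overlapping gems has a cut vertex or two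
  dominating vertices (delete a simplicial vertex). Over a cut vertex the Bestvina--Brady group is a
  free product, and the Kurosh subgroup theorem applies; its proof here constructs homomorphisms out
  of a subgroup as cocycles on its coset space, that is, as homomorphisms of the whole group to
  a wreath product. Two dominating vertices \<open>u\<close> and \<open>v\<close> split off the central infinite cyclic factor
  generated by \<open>v u\<^sup>-\<^sup>1\<close>, and a central extension of a right-angled Artin group inside such a product
  splits because commuting elements have commuting lifts.

  Conversely, the abelianization of a right-angled Artin group is torsion-free. The gem and the
  overlapping gems give four elements of the Bestvina--Brady group that commute along a path, a long
  induced cycle gives the Dicks--Leary relations, and in each case the stabilizer of a point, up to
  sign, in a suitable action by signed permutations has an element of order two in its abelianization,
  detected by the sign.
\<close>

section \<open>Homomorphisms out of generated groups\<close>

text \<open>No normal form for words in a right-angled Artin group is used. A subgroup is recognised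
  by generators that satisfy the relations, together with a homomorphism back to
  \<open>raag \<Lambda>\<close> that has the right values on them. The difficulty thus moves to
  defining a homomorphism on a subgroup whose presentation is unknown. A presentation, or a
  universal property, is known only for the surrounding group; so a homomorphism to a wreath product
  is defined there, and on the stabilizer of a point its second component becomes an ordinary
  homomorphism. The same device serves three times: for the Kurosh theorem, for gluing over a cut
  vertex, and for the sign that detects torsion. The action on four points in the last case is
  modelled on the right-angled Artin group of the path with four vertices, which has subgroups that
  are not of this kind (Droms). Only images in a finite group are computed there, so it never has to
  be shown that the four elements generate a copy of that group.\<close>

lemma hom_eq_on_generate:
  assumes "group G" "group K" "f \<in> hom G K" "f' \<in> hom G K" "S \<subseteq> carrier G"
    and "\<And>s. s \<in> S \<Longrightarrow> f s = f' s" "g \<in> generate G S"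
  shows "f g = f' g"
proof -
  interpret f: group_hom G K f using assms by (simp add: group_hom_def group_hom_axioms_def)
  interpret f': group_hom G K f' using assms by (simp add: group_hom_def group_hom_axioms_def)
  note car = f.G.generate_in_carrier[OF assms(5)]
  show ?thesis
    using assms(7)
  proof (induction rule: generate.induct)
    case (inv h)
    then show ?case using assms(5,6) by (auto simp: subset_iff)
  next
    case (eng h1 h2)
    then show ?case using car by simp
  qed (use assms in auto)
qed

lemma hom_subgroup:
  assumes "f \<in> hom G K" "H \<subseteq> carrier G"
  shows "f \<in> hom (G\<lparr>carrier := H\<rparr>) K"
  using assms by (auto simp: hom_def)

text \<open>Conjugation by \<open>y\<close> is an endomorphism that fixes \<open>x\<close>, hence it
  fixes every integer power of \<open>x\<close>.\<close>

lemma (in group) int_pow_commute: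
  assumes "x \<in> carrier G" "y \<in> carrier G" "x \<otimes> y = y \<otimes> x"
  shows "x [^] (n::int) \<otimes> y = y \<otimes> x [^] n"
proof -
  have "y \<otimes> x [^] n \<otimes> inv y = (y \<otimes> x \<otimes> inv y) [^] n"
  proof -
    have "inv y \<otimes> (y \<otimes> z) = z" if "z \<in> carrier G" for z
      using assms(2) that by (simp flip: m_assoc)
    then have "(\<lambda>x. y \<otimes> x \<otimes> inv y) \<in> hom G G"
      using assms(2) by (intro homI) (simp_all add: m_assoc)
    then show ?thesis
      using assms group_hom.hom_int_pow[of G G "\<lambda>x. y \<otimes> x \<otimes> inv y" x n]
      by (simp add: group_hom_def group_hom_axioms_def is_group)
  qed
  also have "y \<otimes> x \<otimes> inv y = x"
    using assms by (metis inv_solve_right' m_closed)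
  finally show ?thesis
    using assms by (metis inv_solve_right' m_closed int_pow_closed)
qed


section \<open>Bases of right-angled Artin groups\<close>

definition word_eval :: "('k, 'z) monoid_scheme \<Rightarrow> ('a \<Rightarrow> 'k) \<Rightarrow> 'a word \<Rightarrow> 'k" where
  "word_eval K u w = foldr (\<lambda>(x, b) y. (if b then u x else inv\<^bsub>K\<^esub> (u x)) \<otimes>\<^bsub>K\<^esub> y) w \<one>\<^bsub>K\<^esub>"

lemma word_eval_simps [simp]:
  "word_eval K u [] = \<one>\<^bsub>K\<^esub>"
  "word_eval K u ((x, b) # w) = (if b then u x else inv\<^bsub>K\<^esub> (u x)) \<otimes>\<^bsub>K\<^esub> word_eval K u w"
  by (simp_all add: word_eval_def)

text \<open>Evaluation of words respects every clause that generates \<open>pres_rel\<close>, so it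
  descends to classes. This universal property replaces any solution of the word problem.\<close>

lemma raag_hom_ext:
  fixes \<Gamma> :: "'a sgraph" and K :: "('k, 'z) monoid_scheme"
  assumes \<Gamma>: "simplicial_graph \<Gamma>" and K: "group K"
    and u: "\<And>v. v \<in> verts \<Gamma> \<Longrightarrow> u v \<in> carrier K"
    and comm: "\<And>v w. {v, w} \<in> edges \<Gamma> \<Longrightarrow> u v \<otimes>\<^bsub>K\<^esub> u w = u w \<otimes>\<^bsub>K\<^esub> u v"
  obtains f where "f \<in> hom (raag \<Gamma>) K" "\<And>v. v \<in> verts \<Gamma> \<Longrightarrow> f (raag_gen \<Gamma> v) = u v"
proof -
  interpret K: group K by fact
  let ?ev = "word_eval K u"
  have closed: "?ev w \<in> carrier K" if "w \<in> words (verts \<Gamma>)" for w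
    using that by (induction w) (auto simp: u)
  have app: "?ev (w @ w') = ?ev w \<otimes>\<^bsub>K\<^esub> ?ev w'" if "w \<in> words (verts \<Gamma>)" "w' \<in> words (verts \<Gamma>)" for w w'
    using that by (induction w) (auto simp: u closed K.m_assoc)
  have inv: "?ev w = ?ev w'" if "(w, w') \<in> pres_rel (verts \<Gamma>) (raag_relations \<Gamma>)" for w w'
    using that
  proof (induction rule: pres_rel.induct)
    case (append u u' v v')
    then show ?case using app pres_rel_words by metis
  next
    case (cancel x b)
    then show ?case using u by (cases b) auto
  next
    case (relator w w')
    then show ?case using u comm by (auto simp: raag_relations_def)
  qed auto
  define f where "f X = ?ev (SOME w. w \<in> words (verts \<Gamma>) \<and> X = raag_class \<Gamma> w)" for X
  have f: "f (raag_class \<Gamma> w) = ?ev w" if "w \<in> words (verts \<Gamma>)" for w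
  proof -
    let ?P = "\<lambda>u. u \<in> words (verts \<Gamma>) \<and> raag_class \<Gamma> w = raag_class \<Gamma> u"
    have "?P (SOME u. ?P u)" by (rule someI[of ?P w]) (use that in simp)
    then show ?thesis using inv raag_class_eq_iff that unfolding f_def by metis
  qed
  have "f \<in> hom (raag \<Gamma>) K"
    by (rule homI) (auto simp: carrier_raag f closed app mult_raag_class)
  moreover have "f (raag_gen \<Gamma> v) = u v" if "v \<in> verts \<Gamma>" for v
    using that u by (simp add: raag_gen_def f)
  ultimately show ?thesis using that by blast
qed

lemma raag_gen_closed: "v \<in> verts \<Gamma> \<Longrightarrow> raag_gen \<Gamma> v \<in> carrier (raag \<Gamma>)"
  by (auto simp: carrier_raag raag_gen_def)

lemma raag_gen_commute:
  assumes "simplicial_graph \<Gamma>" "{v, w} \<in> edges \<Gamma>"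
  shows "raag_gen \<Gamma> v \<otimes>\<^bsub>raag \<Gamma>\<^esub> raag_gen \<Gamma> w = raag_gen \<Gamma> w \<otimes>\<^bsub>raag \<Gamma>\<^esub> raag_gen \<Gamma> v"
proof -
  have vw: "v \<in> verts \<Gamma>" "w \<in> verts \<Gamma>" using assms by (auto simp: simplicial_graph_def)
  then have "([(v, True), (w, True)], [(w, True), (v, True)]) \<in> pres_rel (verts \<Gamma>) (raag_relations \<Gamma>)"
    using assms by (intro pres_rel.relator) (auto simp: raag_relations_def)
  then show ?thesis using vw by (simp add: raag_gen_def mult_raag_class raag_class_eq_iff)
qed

lemma raag_one: "\<one>\<^bsub>raag \<Gamma>\<^esub> = raag_class \<Gamma> []"
  by (simp add: raag_def presented_group_def raag_class_def)

lemma raag_class_inverse_letter: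
  assumes "v \<in> verts \<Gamma>"
  shows "raag_class \<Gamma> [(v, False)] = inv\<^bsub>raag \<Gamma>\<^esub> (raag_gen \<Gamma> v)"
proof -
  interpret group "raag \<Gamma>" by (rule group_raag)
  have "raag_class \<Gamma> [(v, False)] \<otimes>\<^bsub>raag \<Gamma>\<^esub> raag_gen \<Gamma> v = \<one>\<^bsub>raag \<Gamma>\<^esub>"
    using assms pres_rel.cancel[of v "verts \<Gamma>" False]
    by (simp add: raag_gen_def mult_raag_class raag_one raag_class_eq_iff)
  moreover have "raag_class \<Gamma> [(v, False)] \<in> carrier (raag \<Gamma>)"
    using assms by (auto simp: carrier_raag)
  ultimately show ?thesis using assms by (metis inv_equality raag_gen_closed)
qed

lemma carrier_raag_generate: "carrier (raag \<Gamma>) = generate (raag \<Gamma>) (raag_gen \<Gamma> ` verts \<Gamma>)"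
proof
  interpret group "raag \<Gamma>" by (rule group_raag)
  show "generate (raag \<Gamma>) (raag_gen \<Gamma> ` verts \<Gamma>) \<subseteq> carrier (raag \<Gamma>)"
    by (rule generate_incl) (auto simp: raag_gen_closed)
  have "raag_class \<Gamma> w \<in> generate (raag \<Gamma>) (raag_gen \<Gamma> ` verts \<Gamma>)" if "w \<in> words (verts \<Gamma>)" for w
    using that
  proof (induction w)
    case Nil
    then show ?case using generate.one by (metis raag_one)
  next
    case (Cons l w)
    obtain x b where l: "l = (x, b)" by fastforce
    have "raag_class \<Gamma> [(x, b)] \<in> generate (raag \<Gamma>) (raag_gen \<Gamma> ` verts \<Gamma>)"
      using Cons l
      by (cases b) (auto simp: raag_class_inverse_letter raag_gen_def[symmetric]
                         intro: generate.incl generate.inv)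
    then have "raag_class \<Gamma> [(x, b)] \<otimes>\<^bsub>raag \<Gamma>\<^esub> raag_class \<Gamma> w
        \<in> generate (raag \<Gamma>) (raag_gen \<Gamma> ` verts \<Gamma>)"
      using Cons by (auto intro: generate.eng)
    then show ?case using Cons l by (simp add: mult_raag_class)
  qed
  then show "carrier (raag \<Gamma>) \<subseteq> generate (raag \<Gamma>) (raag_gen \<Gamma> ` verts \<Gamma>)"
    by (auto simp: carrier_raag)
qed

text \<open>The map \<open>\<theta>\<close> is automatically an isomorphism; asking only for a homomorphism makes bases
  easy to recognise.\<close>

definition raag_basis :: "('g, 'z) monoid_scheme \<Rightarrow> 'b sgraph \<Rightarrow> ('b \<Rightarrow> 'g) \<Rightarrow> ('g \<Rightarrow> 'b word set) \<Rightarrow> bool" where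
  "raag_basis G \<Lambda> e \<theta> \<longleftrightarrow> simplicial_graph \<Lambda> \<and> e ` verts \<Lambda> \<subseteq> carrier G \<and>
     (\<forall>v w. {v, w} \<in> edges \<Lambda> \<longrightarrow> e v \<otimes>\<^bsub>G\<^esub> e w = e w \<otimes>\<^bsub>G\<^esub> e v) \<and>
     carrier G = generate G (e ` verts \<Lambda>) \<and>
     \<theta> \<in> hom G (raag \<Lambda>) \<and> (\<forall>v\<in>verts \<Lambda>. \<theta> (e v) = raag_gen \<Lambda> v)"

text \<open>The universal property yields a map from \<open>raag \<Lambda>\<close> back to
  \<open>G\<close>; both composites fix the generators and are therefore identities.\<close>

lemma is_raag_if_basis:
  fixes G :: "'g monoid"
  assumes G: "group G" and basis: "raag_basis G \<Lambda> e \<theta>"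
  shows "is_raag G"
proof -
  have \<Lambda>: "simplicial_graph \<Lambda>" and e: "e ` verts \<Lambda> \<subseteq> carrier G"
    and comm: "\<And>v w. {v, w} \<in> edges \<Lambda> \<Longrightarrow> e v \<otimes>\<^bsub>G\<^esub> e w = e w \<otimes>\<^bsub>G\<^esub> e v"
    and gen: "carrier G = generate G (e ` verts \<Lambda>)"
    and \<theta>: "\<theta> \<in> hom G (raag \<Lambda>)" "\<And>v. v \<in> verts \<Lambda> \<Longrightarrow> \<theta> (e v) = raag_gen \<Lambda> v"
    using basis by (auto simp: raag_basis_def)
  obtain f where f: "f \<in> hom (raag \<Lambda>) G" "\<And>v. v \<in> verts \<Lambda> \<Longrightarrow> f (raag_gen \<Lambda> v) = e v"
    using raag_hom_ext[OF \<Lambda> G, of e] e comm by blast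
  have "(f \<circ> \<theta>) g = id g" if "g \<in> carrier G" for g
  proof (rule hom_eq_on_generate[where f = "f \<circ> \<theta>" and f' = id, OF G G _ _ e])
    show "f \<circ> \<theta> \<in> hom G G" using \<theta> f by (metis hom_compose)
    show "id \<in> hom G G" by (simp add: hom_def)
  qed (use that gen \<theta> f in auto)
  moreover have "(\<theta> \<circ> f) x = id x" if "x \<in> carrier (raag \<Lambda>)" for x
  proof (rule hom_eq_on_generate[OF group_raag group_raag, where f = "\<theta> \<circ> f" and f' = id and S = "raag_gen \<Lambda> ` verts \<Lambda>"])
    show "\<theta> \<circ> f \<in> hom (raag \<Lambda>) (raag \<Lambda>)" using \<theta> f by (metis hom_compose)
    show "id \<in> hom (raag \<Lambda>) (raag \<Lambda>)" by (simp add: hom_def)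
    show "x \<in> generate (raag \<Lambda>) (raag_gen \<Lambda> ` verts \<Lambda>)" using that carrier_raag_generate by blast
  qed (use \<theta> f raag_gen_closed in auto)
  moreover have "\<theta> ` carrier G \<subseteq> carrier (raag \<Lambda>)" "f ` carrier (raag \<Lambda>) \<subseteq> carrier G"
    using \<theta> f by (auto simp: hom_def)
  ultimately have "bij_betw \<theta> (carrier G) (carrier (raag \<Lambda>))"
    by (intro bij_betw_byWitness[where f' = f]) auto
  then have "\<theta> \<in> iso G (raag \<Lambda>)" using \<theta> by (simp add: iso_def)
  then show ?thesis using is_raagI[OF G \<Lambda>] by (auto simp: is_iso_def)
qed

lemma is_raag_basisE:
  fixes G :: "'g monoid"
  assumes "is_raag G"
  obtains \<Lambda> :: "'g sgraph" and e \<theta> where "raag_basis G \<Lambda> e \<theta>"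
proof -
  obtain \<Lambda> :: "'g sgraph" and \<theta> where G: "group G" and \<Lambda>: "simplicial_graph \<Lambda>" and \<theta>: "\<theta> \<in> iso G (raag \<Lambda>)"
    using assms by (auto simp: is_raag_def is_iso_def)
  interpret G: group G by fact
  define f where "f = inv_into (carrier G) \<theta>"
  have f: "f \<in> iso (raag \<Lambda>) G" using G.iso_set_sym[OF \<theta>] by (simp add: f_def)
  interpret f: group_hom "raag \<Lambda>" G f
    using f by (simp add: group_hom_def group_hom_axioms_def G group_raag iso_def)
  have img: "f ` carrier (raag \<Lambda>) = carrier G" using f by (simp add: iso_def bij_betw_def)
  have "\<theta> (f x) = x" if "x \<in> carrier (raag \<Lambda>)" for x
    using that \<theta> unfolding f_def by (intro f_inv_into_f) (auto simp: iso_def bij_betw_def)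
  moreover have "carrier G = generate G ((f \<circ> raag_gen \<Lambda>) ` verts \<Lambda>)"
  proof -
    have "carrier G = f ` generate (raag \<Lambda>) (raag_gen \<Lambda> ` verts \<Lambda>)"
      using img carrier_raag_generate by metis
    also have "\<dots> = generate G (f ` raag_gen \<Lambda> ` verts \<Lambda>)"
      by (rule f.generate_img[symmetric]) (auto simp: raag_gen_closed)
    finally show ?thesis by (simp add: image_comp)
  qed
  moreover have "f (raag_gen \<Lambda> v) \<otimes>\<^bsub>G\<^esub> f (raag_gen \<Lambda> w) = f (raag_gen \<Lambda> w) \<otimes>\<^bsub>G\<^esub> f (raag_gen \<Lambda> v)"
    if "{v, w} \<in> edges \<Lambda>" for v w
  proof -
    have "v \<in> verts \<Lambda>" "w \<in> verts \<Lambda>" using \<Lambda> that by (auto simp: simplicial_graph_def)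
    then show ?thesis using raag_gen_commute[OF \<Lambda> that] by (metis f.hom_mult raag_gen_closed)
  qed
  ultimately have "raag_basis G \<Lambda> (f \<circ> raag_gen \<Lambda>) \<theta>"
    using \<Lambda> \<theta> by (auto simp: raag_basis_def iso_def raag_gen_closed)
  then show ?thesis using that by blast
qed

lemma raag_basis_hom_ext:
  assumes "raag_basis G \<Lambda> e \<theta>" "group K"
    and "\<And>v. v \<in> verts \<Lambda> \<Longrightarrow> u v \<in> carrier K"
    and "\<And>v w. {v, w} \<in> edges \<Lambda> \<Longrightarrow> u v \<otimes>\<^bsub>K\<^esub> u w = u w \<otimes>\<^bsub>K\<^esub> u v"
  obtains f where "f \<in> hom G K" "\<And>v. v \<in> verts \<Lambda> \<Longrightarrow> f (e v) = u v"
proof -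
  obtain f where f: "f \<in> hom (raag \<Lambda>) K" "\<And>v. v \<in> verts \<Lambda> \<Longrightarrow> f (raag_gen \<Lambda> v) = u v"
    using raag_hom_ext[of \<Lambda> K u] assms by (auto simp: raag_basis_def)
  have "f \<circ> \<theta> \<in> hom G K" using assms(1) f by (metis hom_compose raag_basis_def)
  moreover have "(f \<circ> \<theta>) (e v) = u v" if "v \<in> verts \<Lambda>" for v
    using that f assms(1) by (auto simp: raag_basis_def)
  ultimately show ?thesis using that by blast
qed

section \<open>Homomorphisms to the group of signs\<close>

definition sign_group :: "int monoid" where
  "sign_group = \<lparr>carrier = {1, - 1}, mult = (*), one = 1\<rparr>"

lemma sign_group_simps [simp]:
  "carrier sign_group = {1, - 1}" "x \<otimes>\<^bsub>sign_group\<^esub> y = x * y" "\<one>\<^bsub>sign_group\<^esub> = 1"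
  by (simp_all add: sign_group_def)

lemma group_sign_group: "group sign_group"
  by (rule groupI) auto

text \<open>A homomorphism to the signs lifts to the integers, since one can lift the images of the basis.\<close>

lemma raag_sign_trivial:
  assumes "is_raag G" "g \<in> carrier G" and \<phi>: "\<phi> \<in> hom G sign_group"
    and "\<And>\<psi>. \<psi> \<in> hom G integer_group \<Longrightarrow> \<psi> g = 0"
  shows "\<phi> g = 1"
proof -
  have G: "group G" using assms(1) by (simp add: is_raag_def)
  obtain \<Lambda> e \<theta> where basis: "raag_basis G (\<Lambda> :: 'a sgraph) e \<theta>" using assms(1) is_raag_basisE by blast
  obtain \<psi> where \<psi>: "\<psi> \<in> hom G integer_group"
      "\<And>v. v \<in> verts \<Lambda> \<Longrightarrow> \<psi> (e v) = (if \<phi> (e v) = 1 then 0 else 1)"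
    using raag_basis_hom_ext[OF basis group_integer_group, of "\<lambda>v. if \<phi> (e v) = 1 then 0 else 1"]
    by (auto simp: add.commute)
  have sgn: "(\<lambda>n::int. if even n then 1 else - 1) \<in> hom integer_group sign_group"
    by (rule homI) auto
  have e: "e ` verts \<Lambda> \<subseteq> carrier G" and gen: "carrier G = generate G (e ` verts \<Lambda>)"
    using basis by (auto simp: raag_basis_def)
  have "\<phi> g = ((\<lambda>n::int. if even n then 1 else - 1) \<circ> \<psi>) g"
  proof (rule hom_eq_on_generate[OF G group_sign_group \<phi> _ e])
    show "(\<lambda>n::int. if even n then 1 else - 1) \<circ> \<psi> \<in> hom G sign_group"
      using \<psi>(1) sgn by (rule hom_compose)
    fix s assume "s \<in> e ` verts \<Lambda>"
    moreover have "\<phi> s \<in> {1, - 1}" if "s \<in> carrier G" for s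
      using \<phi> that by (auto simp: hom_def)
    ultimately show "\<phi> s = ((\<lambda>n::int. if even n then 1 else - 1) \<circ> \<psi>) s"
      using e \<psi>(2) by fastforce
  qed (use assms(2) gen in auto)
  then show ?thesis using assms(4)[OF \<psi>(1)] by simp
qed

section \<open>Permutational wreath products\<close>

text \<open>The pair \<open>(\<pi>, c)\<close> is the permutation \<open>(x, k) \<mapsto> (\<pi> x, c x \<otimes> k)\<close>.\<close>

definition wreath :: "('k, 'z) monoid_scheme \<Rightarrow> (('x \<Rightarrow> 'x) \<times> ('x \<Rightarrow> 'k)) monoid" where
  "wreath K = \<lparr>carrier = {(\<pi>, c). bij \<pi> \<and> range c \<subseteq> carrier K},
     mult = (\<lambda>(\<pi>, c) (\<pi>', c'). (\<pi> \<circ> \<pi>', \<lambda>x. c (\<pi>' x) \<otimes>\<^bsub>K\<^esub> c' x)),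
     one = (id, \<lambda>_. \<one>\<^bsub>K\<^esub>)\<rparr>"

lemma wreath_simps:
  "g \<in> carrier (wreath K) \<longleftrightarrow> bij (fst g) \<and> (\<forall>x. snd g x \<in> carrier K)"
  "fst (g \<otimes>\<^bsub>wreath K\<^esub> h) = fst g \<circ> fst h"
  "snd (g \<otimes>\<^bsub>wreath K\<^esub> h) x = snd g (fst h x) \<otimes>\<^bsub>K\<^esub> snd h x"
  "fst \<one>\<^bsub>wreath K\<^esub> = id" "snd \<one>\<^bsub>wreath K\<^esub> x = \<one>\<^bsub>K\<^esub>"
  by (auto simp: wreath_def case_prod_unfold)

lemma wreath_eqI: "fst g = fst h \<Longrightarrow> (\<And>x. snd g x = snd h x) \<Longrightarrow> g = h"
  for g h :: "('x \<Rightarrow> 'x) \<times> ('x \<Rightarrow> 'k)"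
  by (auto simp: prod_eq_iff)

lemma group_wreath:
  fixes K :: "('k, 'z) monoid_scheme"
  assumes "group K"
  shows "group (wreath K :: (('x \<Rightarrow> 'x) \<times> ('x \<Rightarrow> 'k)) monoid)"
proof (rule groupI)
  interpret K: group K by fact
  fix g h l :: "('x \<Rightarrow> 'x) \<times> ('x \<Rightarrow> 'k)"
  show "\<one>\<^bsub>wreath K\<^esub> \<in> carrier (wreath K :: (('x \<Rightarrow> 'x) \<times> ('x \<Rightarrow> 'k)) monoid)"
    by (auto simp: wreath_simps)
  assume g: "g \<in> carrier (wreath K)"
  show "\<one>\<^bsub>wreath K\<^esub> \<otimes>\<^bsub>wreath K\<^esub> g = g"
    using g by (intro wreath_eqI) (auto simp: wreath_simps)
  show "\<exists>y\<in>carrier (wreath K). y \<otimes>\<^bsub>wreath K\<^esub> g = \<one>\<^bsub>wreath K\<^esub>"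
  proof
    let ?i = "(inv_into UNIV (fst g), \<lambda>x. inv\<^bsub>K\<^esub> (snd g (inv_into UNIV (fst g) x)))"
    show "?i \<in> carrier (wreath K)" using g by (auto simp: wreath_simps bij_imp_bij_inv)
    show "?i \<otimes>\<^bsub>wreath K\<^esub> g = \<one>\<^bsub>wreath K\<^esub>"
      using g by (intro wreath_eqI) (auto simp: wreath_simps bij_is_inj)
  qed
  assume h: "h \<in> carrier (wreath K)"
  show "g \<otimes>\<^bsub>wreath K\<^esub> h \<in> carrier (wreath K)"
    using g h by (auto simp: wreath_simps intro: bij_comp)
  assume l: "l \<in> carrier (wreath K)"
  show "g \<otimes>\<^bsub>wreath K\<^esub> h \<otimes>\<^bsub>wreath K\<^esub> l = g \<otimes>\<^bsub>wreath K\<^esub> (h \<otimes>\<^bsub>wreath K\<^esub> l)"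
    using g h l by (intro wreath_eqI) (auto simp: wreath_simps K.m_assoc)
qed

text \<open>The second component satisfies the cocycle rule
  \<open>c (g h) x = c g (h x) \<otimes> c h x\<close>, whose twist disappears as soon as
  \<open>h\<close> fixes \<open>x\<close>. This produces homomorphisms on subgroups without a
  presentation.\<close>

lemma wreath_stabilizer:
  fixes x :: 'x
  assumes G: "group G" and K: "group K" and \<Theta>: "\<Theta> \<in> hom G (wreath K)"
  defines "H \<equiv> {g \<in> carrier G. fst (\<Theta> g) x = x}"
  shows "subgroup H G" "(\<lambda>g. snd (\<Theta> g) x) \<in> hom (G\<lparr>carrier := H\<rparr>) K"
proof -
  interpret \<Theta>: group_hom G "wreath K" \<Theta>
    using assms group_wreath by (auto simp: group_hom_def group_hom_axioms_def)
  show "subgroup H G"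
  proof
    fix g assume g: "g \<in> H"
    then have gc: "g \<in> carrier G" by (simp add: H_def)
    have "\<Theta> (inv\<^bsub>G\<^esub> g) \<otimes>\<^bsub>wreath K\<^esub> \<Theta> g = \<one>\<^bsub>wreath K\<^esub>"
      using gc by simp
    then have "fst (\<Theta> (inv\<^bsub>G\<^esub> g)) (fst (\<Theta> g) x) = x"
      by (metis comp_apply id_apply wreath_simps(2,4))
    then show "inv\<^bsub>G\<^esub> g \<in> H" using g by (simp add: H_def del: \<Theta>.hom_inv)
  qed (auto simp: H_def wreath_simps)
  show "(\<lambda>g. snd (\<Theta> g) x) \<in> hom (G\<lparr>carrier := H\<rparr>) K"
  proof (rule homI)
    fix g assume "g \<in> carrier (G\<lparr>carrier := H\<rparr>)"
    then have "\<Theta> g \<in> carrier (wreath K)" by (simp add: H_def)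
    then show "snd (\<Theta> g) x \<in> carrier K" by (simp add: wreath_simps)
  qed (auto simp: H_def wreath_simps)
qed

lemma (in group) cancel_left:
  "x \<in> carrier G \<Longrightarrow> y \<in> carrier G \<Longrightarrow> x \<otimes> (inv x \<otimes> y) = y"
  "x \<in> carrier G \<Longrightarrow> y \<in> carrier G \<Longrightarrow> inv x \<otimes> (x \<otimes> y) = y"
  by (simp_all flip: m_assoc)

section \<open>The Kurosh subgroup theorem\<close>

text \<open>The assumption \<open>ext\<close> is the universal property of the free product of the subgroups \<open>A i\<close>,
  for the one target that the proof needs. The group acts on a set with base point \<open>x0\<close>, whose
  stabilizer is the subgroup under investigation. Each orbit of \<open>A i\<close> on the orbit of \<open>x0\<close> is
  thought of as a star whose centre is a new vertex; together these stars form a connected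
  graph, in which \<open>tree\<close> describes the edges of a spanning tree.\<close>

locale kurosh = group G for G :: "'g monoid" (structure) +
  fixes A :: "'i \<Rightarrow> 'g set" and act :: "'g \<Rightarrow> 'x \<Rightarrow> 'x" and x0 :: 'x
  assumes A_subgroup: "subgroup (A i) G"
    and gen: "carrier G = generate G (\<Union>i. A i)"
    and act_mult: "g \<in> carrier G \<Longrightarrow> h \<in> carrier G \<Longrightarrow> act (g \<otimes> h) x = act g (act h x)"
    and act_one: "act \<one> x = x"
    and hereditary: "subgroup S G \<Longrightarrow> S \<subseteq> A i \<Longrightarrow> is_raag (G\<lparr>carrier := S\<rparr>)"
    and ext: "\<And>(\<Lambda> :: ('i \<times> 'x \<times> 'g + 'i \<times> 'x) sgraph) f.
      (\<And>i. f i \<in> hom (G\<lparr>carrier := A i\<rparr>) (wreath (raag \<Lambda>))) \<Longrightarrow>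
      \<exists>F \<in> hom G (wreath (raag \<Lambda>) :: (('x \<Rightarrow> 'x) \<times> _) monoid). \<forall>i. \<forall>a \<in> A i. F a = f i a"
begin

lemma A_closed: "a \<in> A i \<Longrightarrow> a \<in> carrier G"
  using A_subgroup[of i] by (auto dest: subgroup.mem_carrier)

lemmas A_mult = subgroup.m_closed[OF A_subgroup]
  and A_inv = subgroup.m_inv_closed[OF A_subgroup]
  and A_one = subgroup.one_closed[OF A_subgroup]

lemma gen_induct [consumes 1, case_names one base mult]:
  assumes "g \<in> carrier G" "P \<one>" "\<And>i a. a \<in> A i \<Longrightarrow> P a"
    "\<And>g h. g \<in> carrier G \<Longrightarrow> h \<in> carrier G \<Longrightarrow> P g \<Longrightarrow> P h \<Longrightarrow> P (g \<otimes> h)"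
  shows "P g"
proof -
  have "g \<in> generate G (\<Union>i. A i)" using assms(1) gen by simp
  then show ?thesis
  proof (induction rule: generate.induct)
    case (inv h)
    then show ?case using assms(3) A_inv by blast
  qed (use assms gen in auto)
qed

lemma act_inv: "g \<in> carrier G \<Longrightarrow> act (inv g) (act g x) = x" "g \<in> carrier G \<Longrightarrow> act g (act (inv g) x) = x"
  using act_mult[of "inv g" g] act_mult[of g "inv g"] by (simp_all add: act_one)

lemma bij_act: "g \<in> carrier G \<Longrightarrow> bij (act g)"
  by (rule o_bij[of "act (inv g)"]) (auto simp: act_inv)

section \<open>Distance from the base point, orbit roots and tree representatives\<close>

primrec layer :: "nat \<Rightarrow> 'x set" where
  "layer 0 = {x0}"
| "layer (Suc n) = (\<Union>i. \<Union>y\<in>layer n. (\<lambda>a. act a y) ` A i)"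

definition X where "X = (\<Union>n. layer n)"

definition depth where "depth x = (LEAST n. x \<in> layer n)"

definition orbit where "orbit i x = (\<lambda>a. act a x) ` A i"

text \<open>The point at which an orbit is entered from \<open>x0\<close>. The choice depends on the
  orbit alone, so all its points share one root.\<close>

definition root where "root i x = (ARG_MIN depth y. y \<in> orbit i x)"

text \<open>The identity is prescribed at the root because an arbitrary choice there could be a
  nontrivial element of the stabilizer, which would destroy \<open>tr_root\<close>.\<close>

definition tr where "tr i x = (if x = root i x then \<one> else SOME a. a \<in> A i \<and> act a (root i x) = x)"

definition par where "par x = (SOME i. depth (root i x) < depth x)"

text \<open>The first argument bounds the number of steps: passing from a point to the root of its
  parent orbit is known to decrease the depth only on \<open>X\<close>. There \<open>depth x\<close>
  steps reach \<open>x0\<close>.\<close>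

primrec rep_upto :: "nat \<Rightarrow> 'x \<Rightarrow> 'g" where
  "rep_upto 0 x = \<one>"
| "rep_upto (Suc n) x = (if x = x0 then \<one> else tr (par x) x \<otimes> rep_upto n (root (par x) x))"

definition rep where "rep x = rep_upto (depth x) x"

lemma orbit_eq:
  assumes "y \<in> orbit i x"
  shows "orbit i y = orbit i x"
proof -
  obtain a where a: "a \<in> A i" "y = act a x" using assms by (auto simp: orbit_def)
  have "act b y \<in> orbit i x" if "b \<in> A i" for b
    using a that A_mult[of b i a] by (auto simp: orbit_def act_mult[symmetric] A_closed)
  moreover have "act b x \<in> orbit i y" if "b \<in> A i" for b
  proof -
    have "act b x = act (b \<otimes> inv a) y" using a that by (simp add: act_mult A_closed act_inv)
    then show ?thesis using a that A_mult A_inv by (auto simp: orbit_def)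
  qed
  ultimately show ?thesis unfolding orbit_def by blast
qed

lemma orbit_self: "x \<in> orbit i x"
  using A_one[of i] act_one[of x] by (auto simp: orbit_def image_iff intro!: bexI[of _ \<one>])

lemma root_orbit: "root i x \<in> orbit i x" and depth_root: "y \<in> orbit i x \<Longrightarrow> depth (root i x) \<le> depth y"
  unfolding root_def using orbit_self
  by (auto intro: arg_min_natI[where P = "\<lambda>y. y \<in> orbit i x"] arg_min_nat_le[where P = "\<lambda>y. y \<in> orbit i x"])

lemma root_act: "a \<in> A i \<Longrightarrow> root i (act a x) = root i x"
  using orbit_eq[of "act a x" i x] by (simp add: root_def orbit_def)

lemma root_root: "root i (root i x) = root i x"
  using orbit_eq[OF root_orbit] by (simp add: root_def)

lemma tr: "tr i x \<in> A i" "act (tr i x) (root i x) = x"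
proof -
  have "x \<in> orbit i (root i x)" using orbit_self orbit_eq[OF root_orbit] by blast
  then have "\<exists>a. a \<in> A i \<and> act a (root i x) = x" by (auto simp: orbit_def)
  from someI_ex[OF this] show "tr i x \<in> A i" "act (tr i x) (root i x) = x"
    using A_one act_one by (auto simp: tr_def)
qed

lemma tr_root: "root i x = x \<Longrightarrow> tr i x = \<one>"
  by (simp add: tr_def)

lemma x0_X: "x0 \<in> X"
  unfolding X_def using layer.simps(1) by (metis UN_I UNIV_I insertI1)

lemma act_A_X: "x \<in> X \<Longrightarrow> a \<in> A i \<Longrightarrow> act a x \<in> X"
proof -
  assume "x \<in> X" "a \<in> A i"
  then obtain n where "x \<in> layer n" by (auto simp: X_def)
  with \<open>a \<in> A i\<close> have "act a x \<in> layer (Suc n)" by auto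
  then show ?thesis unfolding X_def by blast
qed

lemma act_X: "g \<in> carrier G \<Longrightarrow> x \<in> X \<Longrightarrow> act g x \<in> X"
  by (induction arbitrary: x rule: gen_induct) (auto simp: act_one act_mult act_A_X)

lemma root_X: "x \<in> X \<Longrightarrow> root i x \<in> X"
  using root_orbit[of i x] act_A_X by (auto simp: orbit_def)

text \<open>The last factor on a shortest route from \<open>x0\<close> to \<open>x\<close> joins
  \<open>x\<close> to a point one layer earlier in the same orbit, and the root of that orbit is no
  deeper than this point.\<close>

lemma depth_par:
  assumes "x \<in> X" "x \<noteq> x0"
  shows "depth (root (par x) x) < depth x"
proof -
  have x: "x \<in> layer (depth x)" using assms(1) unfolding X_def depth_def by (auto intro: LeastI)
  then obtain n where n: "depth x = Suc n" using assms(2) by (cases "depth x") auto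
  with x obtain i y a where y: "y \<in> layer n" "a \<in> A i" "x = act a y" by auto
  have "depth y \<le> n" using y by (auto simp: depth_def intro: Least_le)
  moreover have "y \<in> orbit i x"
    using y A_inv[of a i] by (auto simp: orbit_def A_closed act_inv image_iff intro!: bexI[of _ "inv a"])
  then have "depth (root i x) \<le> depth y" by (rule depth_root)
  ultimately have "\<exists>i. depth (root i x) < depth x" using n by (intro exI[of _ i]) simp
  then show ?thesis unfolding par_def by (rule someI_ex)
qed

lemma rep_upto_rep: "x \<in> X \<Longrightarrow> depth x \<le> n \<Longrightarrow> rep_upto n x = rep x"
proof (induction "depth x" arbitrary: x n rule: less_induct)
  case less
  show ?case
  proof (cases "x = x0")
    case True
    have "rep_upto m x0 = \<one>" for m by (cases m) auto
    then show ?thesis using True by (simp add: rep_def)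
  next
    case False
    let ?r = "root (par x) x"
    have lt: "depth ?r < depth x" using depth_par less False by blast
    then obtain k m where k: "depth x = Suc k" and m: "n = Suc m"
      using less.prems by (metis Suc_le_D less_nat_zero_code not0_implies_Suc)
    have "rep_upto m ?r = rep ?r" "rep_upto k ?r = rep ?r"
      using less lt k m root_X by auto
    then show ?thesis using False by (simp add: rep_def[of x] k m)
  qed
qed

lemma rep_x0: "rep x0 = \<one>"
  by (cases "depth x0") (auto simp: rep_def)

lemma rep_par:
  assumes "x \<in> X" "x \<noteq> x0"
  shows "rep x = tr (par x) x \<otimes> rep (root (par x) x)"
proof -
  have lt: "depth (root (par x) x) < depth x" using depth_par assms by blast
  then obtain k where k: "depth x = Suc k" by (cases "depth x") auto
  then show ?thesis using lt assms rep_upto_rep[of "root (par x) x" k] root_X by (simp add: rep_def[of x])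
qed

lemma rep: "x \<in> X \<Longrightarrow> rep x \<in> carrier G \<and> act (rep x) x0 = x"
proof (induction "depth x" arbitrary: x rule: less_induct)
  case less
  show ?case
  proof (cases "x = x0")
    case True
    then show ?thesis by (simp add: rep_x0 act_one)
  next
    case False
    then have "rep (root (par x) x) \<in> carrier G" "act (rep (root (par x) x)) x0 = root (par x) x"
      using less depth_par root_X by auto
    then show ?thesis using tr[of "par x" x] less.prems False by (simp add: rep_par A_closed act_mult)
  qed
qed

lemmas rep_closed = rep[THEN conjunct1] and act_rep = rep[THEN conjunct2]

text \<open>The pair \<open>(i, x)\<close> stands for the edge between \<open>x\<close> and the
  centre of its \<open>A i\<close>-orbit. In the tree each centre hangs from its root, and each
  point other than \<open>x0\<close> hangs from the centre of its parent orbit.\<close>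

definition tree where "tree i x \<longleftrightarrow> root i x = x \<or> (x \<noteq> x0 \<and> i = par x)"

section \<open>Stabilizers of roots and the defining graph of the subgroup\<close>

definition stab where "stab i r = {a \<in> A i. act a r = r}"

lemma stab_subgroup: "subgroup (stab i r) G"
proof (rule subgroupI)
  show "stab i r \<subseteq> carrier G" by (auto simp: stab_def intro: A_closed)
  show "stab i r \<noteq> {}" using A_one act_one by (auto simp: stab_def)
  show "inv a \<in> stab i r" if "a \<in> stab i r" for a
    using that act_inv(1)[of a r] by (auto simp: stab_def A_closed A_inv)
  show "a \<otimes> b \<in> stab i r" if "a \<in> stab i r" "b \<in> stab i r" for a b
    using that by (auto simp: stab_def A_closed A_mult act_mult)
qed

definition stab_basis :: "'i \<Rightarrow> 'x \<Rightarrow> 'g sgraph \<times> ('g \<Rightarrow> 'g) \<times> ('g \<Rightarrow> 'g word set)" where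
  "stab_basis i r = (SOME (\<Lambda>, e, \<theta>). raag_basis (G\<lparr>carrier := stab i r\<rparr>) \<Lambda> e \<theta>)"

definition "stab_graph i r = fst (stab_basis i r)"
definition "stab_gen i r = fst (snd (stab_basis i r))"

lemma stab_basis: "raag_basis (G\<lparr>carrier := stab i r\<rparr>) (stab_graph i r) (stab_gen i r) (snd (snd (stab_basis i r)))"
proof -
  have "is_raag (G\<lparr>carrier := stab i r\<rparr>)"
    by (rule hereditary[OF stab_subgroup, where i = i]) (auto simp: stab_def)
  then have "\<exists>b :: 'g sgraph \<times> ('g \<Rightarrow> 'g) \<times> ('g \<Rightarrow> 'g word set).
      case b of (\<Lambda>, e, \<theta>) \<Rightarrow> raag_basis (G\<lparr>carrier := stab i r\<rparr>) \<Lambda> e \<theta>"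
    by (auto elim!: is_raag_basisE)
  from someI_ex[OF this] show ?thesis
    unfolding stab_graph_def stab_gen_def stab_basis_def by (simp add: case_prod_unfold)
qed

text \<open>The shape of Kurosh's theorem: disjoint copies of the defining graphs of the root
  stabilizers give the conjugated factors, and one isolated vertex for each edge outside the tree
  gives the free factor.\<close>

definition \<Lambda> :: "('i \<times> 'x \<times> 'g + 'i \<times> 'x) sgraph" where
  "\<Lambda> = \<lparr>verts = {Inl (i, r, s) |i r s. r \<in> X \<and> root i r = r \<and> s \<in> verts (stab_graph i r)}
          \<union> {Inr (i, x) |i x. x \<in> X \<and> \<not> tree i x},
        edges = {(\<lambda>s. Inl (i, r, s)) ` E |i r E. r \<in> X \<and> root i r = r \<and> E \<in> edges (stab_graph i r)}\<rparr>"

text \<open>Read from right to left, a closed walk at \<open>x0\<close>: along the tree to the root,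
  through the star to \<open>x\<close>, and back along the tree.\<close>

definition loop where "loop i x = inv (rep x) \<otimes> tr i x \<otimes> rep (root i x)"

definition \<Lambda>_gen where
  "\<Lambda>_gen = (\<lambda>v. case v of Inl (i, r, s) \<Rightarrow> inv (rep r) \<otimes> stab_gen i r s \<otimes> rep r | Inr (i, x) \<Rightarrow> loop i x)"

lemma simplicial_\<Lambda>: "simplicial_graph \<Lambda>"
  unfolding simplicial_graph_def
proof
  fix E assume "E \<in> edges \<Lambda>"
  then obtain i r E' where E: "E = (\<lambda>s. Inl (i, r, s)) ` E'" "r \<in> X" "root i r = r" "E' \<in> edges (stab_graph i r)"
    by (auto simp: \<Lambda>_def)
  have "E' \<subseteq> verts (stab_graph i r)" "card E' = 2"
    using stab_basis[of i r] E by (auto simp: raag_basis_def simplicial_graph_def)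
  moreover have "card E = card E'" unfolding E by (rule card_image) (auto simp: inj_on_def)
  ultimately show "E \<subseteq> verts \<Lambda> \<and> card E = 2" using E by (auto simp: \<Lambda>_def)
qed

lemma ex_lift: "r \<in> X \<Longrightarrow> root i r = r \<Longrightarrow> \<exists>J. J \<in> hom (G\<lparr>carrier := stab i r\<rparr>) (raag \<Lambda>) \<and>
    (\<forall>s\<in>verts (stab_graph i r). J (stab_gen i r s) = raag_gen \<Lambda> (Inl (i, r, s)))"
proof -
  assume r: "r \<in> X" "root i r = r"
  have "raag_gen \<Lambda> (Inl (i, r, s)) \<in> carrier (raag \<Lambda>)" if "s \<in> verts (stab_graph i r)" for s
    using r that by (auto simp: \<Lambda>_def intro!: raag_gen_closed)
  moreover have "raag_gen \<Lambda> (Inl (i, r, s)) \<otimes>\<^bsub>raag \<Lambda>\<^esub> raag_gen \<Lambda> (Inl (i, r, t))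
      = raag_gen \<Lambda> (Inl (i, r, t)) \<otimes>\<^bsub>raag \<Lambda>\<^esub> raag_gen \<Lambda> (Inl (i, r, s))"
    if "{s, t} \<in> edges (stab_graph i r)" for s t
  proof (rule raag_gen_commute[OF simplicial_\<Lambda>])
    have "(\<lambda>s. Inl (i, r, s)) ` {s, t} \<in> edges \<Lambda>"
      using r that unfolding \<Lambda>_def by (auto simp del: image_insert)
    then show "{Inl (i, r, s), Inl (i, r, t)} \<in> edges \<Lambda>" by simp
  qed
  ultimately show ?thesis
    using raag_basis_hom_ext[OF stab_basis group_raag, of i r "\<lambda>s. raag_gen \<Lambda> (Inl (i, r, s))"] by metis
qed

definition lift where "lift i r = (SOME J. J \<in> hom (G\<lparr>carrier := stab i r\<rparr>) (raag \<Lambda>) \<and>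
    (\<forall>s\<in>verts (stab_graph i r). J (stab_gen i r s) = raag_gen \<Lambda> (Inl (i, r, s))))"

lemma lift:
  assumes "r \<in> X" "root i r = r"
  shows "lift i r \<in> hom (G\<lparr>carrier := stab i r\<rparr>) (raag \<Lambda>)"
    "s \<in> verts (stab_graph i r) \<Longrightarrow> lift i r (stab_gen i r s) = raag_gen \<Lambda> (Inl (i, r, s))"
  using someI_ex[OF ex_lift[OF assms]] unfolding lift_def by blast+

lemma lift_mult:
  assumes "r \<in> X" "root i r = r" "a \<in> stab i r" "b \<in> stab i r"
  shows "lift i r (a \<otimes> b) = lift i r a \<otimes>\<^bsub>raag \<Lambda>\<^esub> lift i r b"
  using hom_mult[OF lift(1)[OF assms(1,2)]] assms(3,4) by simp

lemma lift_closed: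
  assumes "r \<in> X" "root i r = r" "a \<in> stab i r"
  shows "lift i r a \<in> carrier (raag \<Lambda>)"
  using hom_in_carrier[OF lift(1)[OF assms(1,2)]] assms(3) by simp

lemma lift_one:
  assumes "r \<in> X" "root i r = r"
  shows "lift i r \<one> = \<one>\<^bsub>raag \<Lambda>\<^esub>"
  using hom_one[OF lift(1)[OF assms] subgroup.subgroup_is_group[OF stab_subgroup] group_raag] is_group by simp

section \<open>The cocycle with values in the new right-angled Artin group\<close>

definition lam where "lam i x = (if tree i x then \<one>\<^bsub>raag \<Lambda>\<^esub> else raag_gen \<Lambda> (Inr (i, x)))"

lemma lam_closed: "x \<in> X \<Longrightarrow> lam i x \<in> carrier (raag \<Lambda>)"
proof -
  assume "x \<in> X"
  interpret R: group "raag \<Lambda>" by (rule group_raag)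
  have "Inr (i, x) \<in> verts \<Lambda>" if "\<not> tree i x" using \<open>x \<in> X\<close> that by (auto simp: \<Lambda>_def)
  then show ?thesis by (auto simp: lam_def intro!: raag_gen_closed)
qed

text \<open>The action of \<open>a\<close> at \<open>x\<close> pulled back to the root: from the
  root to \<open>x\<close>, on to \<open>act a x\<close>, and back to the same root.\<close>

definition stab_part where "stab_part i a x = inv (tr i (act a x)) \<otimes> a \<otimes> tr i x"

lemma stab_part_stab: "a \<in> A i \<Longrightarrow> stab_part i a x \<in> stab i (root i x)"
proof -
  assume a: "a \<in> A i"
  have "act (inv (tr i (act a x))) (act a x) = root i x"
    using tr[of i "act a x"] root_act[OF a, of x] act_inv(1)[of "tr i (act a x)" "root i x"] by (simp add: A_closed)
  then show ?thesis
    using a tr[of i x] tr[of i "act a x"] by (simp add: stab_part_def stab_def A_closed A_mult A_inv act_mult)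
qed

lemma stab_part_mult:
  assumes "a \<in> A i" "b \<in> A i"
  shows "stab_part i (a \<otimes> b) x = stab_part i a (act b x) \<otimes> stab_part i b x"
  using assms tr[of i x] tr[of i "act b x"] tr[of i "act a (act b x)"]
  by (simp add: stab_part_def A_closed act_mult m_assoc cancel_left)

text \<open>The step from \<open>x\<close> to \<open>act a x\<close> is led through the common root:
  the two edges contribute \<open>lam\<close>, the part at the root its image under
  \<open>lift\<close>. Off \<open>X\<close>, where neither is controlled, the value is
  trivial.\<close>

definition cocycle where
  "cocycle i a = (act a, \<lambda>x. if x \<in> X then lam i (act a x) \<otimes>\<^bsub>raag \<Lambda>\<^esub> lift i (root i x) (stab_part i a x)
     \<otimes>\<^bsub>raag \<Lambda>\<^esub> inv\<^bsub>raag \<Lambda>\<^esub> (lam i x) else \<one>\<^bsub>raag \<Lambda>\<^esub>)"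

text \<open>Consecutive values telescope: the \<open>lam\<close> factors at the intermediate point
  cancel, and the stabilizer parts multiply by \<open>stab_part_mult\<close> because the root is
  constant on the orbit.\<close>

lemma cocycle_hom: "cocycle i \<in> hom (G\<lparr>carrier := A i\<rparr>) (wreath (raag \<Lambda>))"
proof (rule homI)
  interpret R: group "raag \<Lambda>" by (rule group_raag)
  have l: "lift i (root i x) (stab_part i a x) \<in> carrier (raag \<Lambda>)" if "x \<in> X" "a \<in> A i" for x a
    using that by (intro lift_closed stab_part_stab) (auto simp: root_X root_root)
  fix a assume "a \<in> carrier (G\<lparr>carrier := A i\<rparr>)"
  then have a: "a \<in> A i" by simp
  then show "cocycle i a \<in> carrier (wreath (raag \<Lambda>))"
    using l by (auto simp: wreath_simps cocycle_def bij_act A_closed lam_closed act_A_X)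
  fix b assume "b \<in> carrier (G\<lparr>carrier := A i\<rparr>)"
  then have b: "b \<in> A i" by simp
  have "cocycle i (a \<otimes> b) = cocycle i a \<otimes>\<^bsub>wreath (raag \<Lambda>)\<^esub> cocycle i b"
  proof (rule wreath_eqI)
    fix x
    have "lift i (root i x) (stab_part i (a \<otimes> b) x)
        = lift i (root i x) (stab_part i a (act b x)) \<otimes>\<^bsub>raag \<Lambda>\<^esub> lift i (root i x) (stab_part i b x)" if x: "x \<in> X"
      unfolding stab_part_mult[OF a b] using stab_part_stab[OF a, of "act b x"] stab_part_stab[OF b, of x]
      by (intro lift_mult) (auto simp: x root_X root_root root_act[OF b])
    moreover have "lift i (root i x) (stab_part i a (act b x)) \<in> carrier (raag \<Lambda>)" if x: "x \<in> X"
      using l[OF act_A_X[OF x b] a] by (simp add: root_act[OF b])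
    moreover have "act b x \<notin> X" if "x \<notin> X"
      using that act_A_X[OF _ A_inv[OF b], of "act b x"] by (auto simp: act_inv A_closed[OF b])
    ultimately show "snd (cocycle i (a \<otimes> b)) x = snd (cocycle i a \<otimes>\<^bsub>wreath (raag \<Lambda>)\<^esub> cocycle i b) x"
      using a b l[of x b] by (simp add: cocycle_def wreath_simps act_mult A_closed lam_closed act_A_X root_act
          R.m_assoc R.cancel_left)
  qed (use a b in \<open>auto simp: cocycle_def wreath_simps act_mult A_closed\<close>)
  then show "cocycle i (a \<otimes>\<^bsub>G\<lparr>carrier := A i\<rparr>\<^esub> b) = cocycle i a \<otimes>\<^bsub>wreath (raag \<Lambda>)\<^esub> cocycle i b" by simp
qed

text \<open>The extended cocycle read off at \<open>x0\<close> serves as the map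
  \<open>\<theta>\<close> of a basis: it is trivial along the tree, so on each generator only the
  stabilizer part or the crossed edge survives. That the generators suffice is the argument of
  Schreier.\<close>

theorem is_raag_stabilizer: "is_raag (G\<lparr>carrier := {g \<in> carrier G. act g x0 = x0}\<rparr>)"
proof -
  interpret R: group "raag \<Lambda>" by (rule group_raag)
  obtain F where F: "F \<in> hom G (wreath (raag \<Lambda>))" and FA: "\<And>i a. a \<in> A i \<Longrightarrow> F a = cocycle i a"
    using ext[OF cocycle_hom] by blast
  interpret F: group_hom G "wreath (raag \<Lambda>)" F
    using F group_wreath[OF group_raag] by (auto simp: group_hom_def group_hom_axioms_def is_group)
  define H where "H = {g \<in> carrier G. act g x0 = x0}"
  define c where "c g x = snd (F g) x" for g x
  have fstF: "fst (F g) = act g" if "g \<in> carrier G" for g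
    using that
  proof (induction rule: gen_induct)
    case (base i a)
    then show ?case by (simp add: FA cocycle_def)
  qed (auto simp: wreath_simps fun_eq_iff act_one act_mult)
  have c_closed: "c g x \<in> carrier (raag \<Lambda>)" if "g \<in> carrier G" for g x
    using F.hom_closed[OF that] by (simp add: wreath_simps c_def)
  have c_mult: "c (g \<otimes> h) x = c g (act h x) \<otimes>\<^bsub>raag \<Lambda>\<^esub> c h x" if "g \<in> carrier G" "h \<in> carrier G" for g h x
    using that by (simp add: c_def wreath_simps fstF)
  have c_one: "c \<one> x = \<one>\<^bsub>raag \<Lambda>\<^esub>" for x by (simp add: c_def wreath_simps)
  have H: "H = {g \<in> carrier G. fst (F g) x0 = x0}" by (auto simp: H_def fstF)
  have H_sub: "subgroup H G" and \<theta>: "(\<lambda>h. c h x0) \<in> hom (G\<lparr>carrier := H\<rparr>) (raag \<Lambda>)"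
    unfolding H c_def using wreath_stabilizer[OF is_group group_raag F] by blast+
  have tree_root: "tree i x" if "root i x = x" for i x using that by (simp add: tree_def)
  have c_tr: "c (tr i x) (root i x) = lam i x" if x: "x \<in> X" for i x
  proof -
    have "c (tr i x) (root i x) = lam i x \<otimes>\<^bsub>raag \<Lambda>\<^esub> lift i (root i x) \<one> \<otimes>\<^bsub>raag \<Lambda>\<^esub> inv\<^bsub>raag \<Lambda>\<^esub> \<one>\<^bsub>raag \<Lambda>\<^esub>"
      using tr[of i x] x
      by (simp add: c_def FA[OF tr(1)] cocycle_def root_X root_root stab_part_def tr_root lam_def[of i "root i x"] tree_root A_closed)
    then show ?thesis using x by (simp add: lift_one root_X root_root lam_closed)
  qed
  have c_stab: "c a r = lift i r a" if "r \<in> X" "root i r = r" "a \<in> stab i r" for i r a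
  proof -
    have "a \<in> A i" "act a r = r" using that by (auto simp: stab_def)
    then show ?thesis using that lift_closed[OF that]
      by (simp add: c_def FA[of a i] cocycle_def stab_part_def tr_root lam_def tree_root A_closed)
  qed
  \<comment> \<open>Representatives move along tree edges only, where \<open>lam\<close> is trivial
    and the stabilizer part is the identity.\<close>
  have c_rep: "c (rep x) x0 = \<one>\<^bsub>raag \<Lambda>\<^esub>" if "x \<in> X" for x
    using that
  proof (induction "depth x" arbitrary: x rule: less_induct)
    case less
    show ?case
    proof (cases "x = x0")
      case False
      let ?i = "par x"
      let ?r = "root ?i x"
      have "c (rep ?r) x0 = \<one>\<^bsub>raag \<Lambda>\<^esub>" using less depth_par root_X False by auto
      moreover have "c (tr ?i x) ?r = \<one>\<^bsub>raag \<Lambda>\<^esub>" using c_tr[of x ?i] less False by (simp add: lam_def tree_def)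
      ultimately show ?thesis
        using False less.prems tr[of ?i x] by (simp add: rep_par c_mult rep_closed root_X A_closed act_rep)
    qed (simp add: rep_x0 c_one)
  qed
  have c_inv_rep: "c (inv (rep x)) x = \<one>\<^bsub>raag \<Lambda>\<^esub>" if "x \<in> X" for x
    using c_mult[of "inv (rep x)" "rep x" x0] that
    by (simp add: rep_closed act_rep c_rep c_one c_closed)
  have loop: "loop i x \<in> H" "c (loop i x) x0 = lam i x" if x: "x \<in> X" for i x
    using x tr[of i x] act_inv(1)[of "rep x" x0]
    by (simp_all add: loop_def H_def act_mult rep_closed A_closed root_X act_rep c_mult c_rep c_tr c_inv_rep lam_closed)
  have conj: "inv (rep r) \<otimes> a \<otimes> rep r \<in> H" "c (inv (rep r) \<otimes> a \<otimes> rep r) x0 = lift i r a"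
    if r: "r \<in> X" "root i r = r" "a \<in> stab i r" for i r a
  proof -
    have a: "a \<in> carrier G" "act a r = r" using r by (auto simp: stab_def A_closed)
    have "act (inv (rep r)) r = x0" using r(1) act_inv(1)[of "rep r" x0] by (simp add: rep_closed act_rep)
    then show "inv (rep r) \<otimes> a \<otimes> rep r \<in> H"
      using a r(1) by (simp add: H_def act_mult rep_closed act_rep)
    show "c (inv (rep r) \<otimes> a \<otimes> rep r) x0 = lift i r a"
      using a r(1) lift_closed[OF r] c_stab[OF r]
      by (simp add: act_mult rep_closed act_rep c_mult c_rep c_inv_rep)
  qed
  have stab_gen: "stab_gen i r s \<in> stab i r" if "s \<in> verts (stab_graph i r)" for i r s
    using stab_basis[of i r] that by (auto simp: raag_basis_def)
  have e: "\<Lambda>_gen ` verts \<Lambda> \<subseteq> H"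
    using conj loop stab_gen by (auto simp: \<Lambda>_def \<Lambda>_gen_def)
  let ?M = "generate G (\<Lambda>_gen ` verts \<Lambda>)"
  have eG: "\<Lambda>_gen ` verts \<Lambda> \<subseteq> carrier G" using e subgroup.subset[OF H_sub] by blast
  have M: "subgroup ?M G" by (rule generate_is_subgroup[OF eG])
  \<comment> \<open>A tree edge gives the trivial loop: at a root \<open>tr\<close> is the identity,
    and at a parent edge \<open>rep_par\<close> makes the loop cancel.\<close>
  have loop_M: "loop i x \<in> ?M" if x: "x \<in> X" for i x
  proof (cases "tree i x")
    case True
    have "loop i x = \<one>"
    proof (cases "root i x = x")
      case True
      then show ?thesis using x by (simp add: loop_def tr_root rep_closed)
    next
      case False
      then show ?thesis using x True tr[of i x]
        by (simp add: loop_def tree_def rep_par A_closed rep_closed root_X inv_mult_group m_assoc cancel_left)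
    qed
    then show ?thesis by (simp add: generate.one)
  next
    case False
    then have "Inr (i, x) \<in> verts \<Lambda>" using x by (auto simp: \<Lambda>_def)
    then show ?thesis by (auto simp: \<Lambda>_gen_def intro!: generate.incl rev_image_eqI)
  qed
  have conj_M: "inv (rep r) \<otimes> a \<otimes> rep r \<in> ?M" if r: "r \<in> X" "root i r = r" and a: "a \<in> stab i r" for i r a
  proof -
    have "stab i r = generate (G\<lparr>carrier := stab i r\<rparr>) (stab_gen i r ` verts (stab_graph i r))"
      using stab_basis[of i r] by (simp add: raag_basis_def)
    also have "\<dots> = generate G (stab_gen i r ` verts (stab_graph i r))"
      using stab_gen stab_subgroup by (intro generate_consistent) auto
    finally have "a \<in> generate G (stab_gen i r ` verts (stab_graph i r))" using a by simp
    then show ?thesis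
    proof (induction rule: generate.induct)
      case one
      then show ?case using r by (simp add: rep_closed generate.one)
    next
      case (incl h)
      then obtain s where s: "s \<in> verts (stab_graph i r)" "h = stab_gen i r s" by auto
      then have "Inl (i, r, s) \<in> verts \<Lambda>" using r by (auto simp: \<Lambda>_def)
      then show ?case using s by (auto simp: \<Lambda>_gen_def intro!: generate.incl rev_image_eqI)
    next
      case (inv h)
      then obtain s where s: "s \<in> verts (stab_graph i r)" "h = stab_gen i r s" by auto
      then have "Inl (i, r, s) \<in> verts \<Lambda>" using r by (auto simp: \<Lambda>_def)
      then have "inv (rep r) \<otimes> h \<otimes> rep r \<in> ?M"
        using s by (auto simp: \<Lambda>_gen_def intro!: generate.incl rev_image_eqI)
      then have "inv (inv (rep r) \<otimes> h \<otimes> rep r) \<in> ?M" by (rule subgroup.m_inv_closed[OF M])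
      moreover have "h \<in> carrier G" using s stab_gen[of s i r] by (auto simp: stab_def A_closed)
      ultimately show ?case using r by (simp add: inv_mult_group rep_closed m_assoc)
    next
      case (eng h1 h2)
      have "generate G (stab_gen i r ` verts (stab_graph i r)) \<subseteq> carrier G"
        using stab_gen[of _ i r] by (intro generate_incl) (auto simp: stab_def intro: A_closed)
      then have "h1 \<in> carrier G" "h2 \<in> carrier G" using eng.hyps by auto
      moreover have "(inv (rep r) \<otimes> h1 \<otimes> rep r) \<otimes> (inv (rep r) \<otimes> h2 \<otimes> rep r) \<in> ?M"
        using eng.IH by (rule subgroup.m_closed[OF M])
      ultimately show ?case using r by (simp add: rep_closed m_assoc cancel_left)
    qed
  qed
  \<comment> \<open>The Schreier generator of \<open>a\<close> at \<open>x\<close> is a loop, times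
    a conjugated stabilizer element, times an inverse loop, all passing through the root.\<close>
  have A_M: "inv (rep (act a x)) \<otimes> a \<otimes> rep x \<in> ?M" if a: "a \<in> A i" and x: "x \<in> X" for a i x
  proof -
    let ?r = "root i x"
    have "loop i (act a x) \<otimes> (inv (rep ?r) \<otimes> stab_part i a x \<otimes> rep ?r) \<otimes> inv (loop i x) \<in> ?M"
      using a x by (intro subgroup.m_closed[OF M] subgroup.m_inv_closed[OF M] loop_M act_A_X[OF x a]
          conj_M[of _ i] stab_part_stab) (auto simp: root_X root_root)
    also have "loop i (act a x) \<otimes> (inv (rep ?r) \<otimes> stab_part i a x \<otimes> rep ?r) \<otimes> inv (loop i x)
        = inv (rep (act a x)) \<otimes> a \<otimes> rep x"
      using a x tr[of i x] tr[of i "act a x"]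
      by (simp add: loop_def stab_part_def root_act rep_closed act_A_X root_X A_closed inv_mult_group m_assoc cancel_left)
    finally show ?thesis .
  qed
  \<comment> \<open>The point has to vary in the induction, since the right factor of a product
    moves it before the left factor acts.\<close>
  have G_M: "inv (rep (act g x)) \<otimes> g \<otimes> rep x \<in> ?M" if "g \<in> carrier G" "x \<in> X" for g x
    using that
  proof (induction arbitrary: x rule: gen_induct)
    case one
    then show ?case by (simp add: act_one rep_closed generate.one)
  next
    case (base i a)
    then show ?case by (rule A_M)
  next
    case (mult g h)
    have "(inv (rep (act g (act h x))) \<otimes> g \<otimes> rep (act h x)) \<otimes> (inv (rep (act h x)) \<otimes> h \<otimes> rep x) \<in> ?M"
      using mult.IH(1)[OF act_X[OF mult.hyps(2) mult.prems]] mult.IH(2)[OF mult.prems]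
      by (rule subgroup.m_closed[OF M])
    then show ?case using mult by (simp add: act_mult act_X rep_closed m_assoc cancel_left)
  qed
  have "H \<subseteq> ?M"
  proof
    fix h assume "h \<in> H"
    then show "h \<in> ?M" using G_M[of h x0] by (simp add: H_def rep_x0 x0_X)
  qed
  moreover have "?M \<subseteq> H" by (rule generate_subgroup_incl[OF e H_sub])
  ultimately have gen_H: "H = generate (G\<lparr>carrier := H\<rparr>) (\<Lambda>_gen ` verts \<Lambda>)"
    using generate_consistent[OF e H_sub] by simp
  have comm: "\<Lambda>_gen v \<otimes> \<Lambda>_gen w = \<Lambda>_gen w \<otimes> \<Lambda>_gen v" if "{v, w} \<in> edges \<Lambda>" for v w
  proof -
    obtain i r E where r: "r \<in> X" "root i r = r" and E: "E \<in> edges (stab_graph i r)"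
      and vw: "{v, w} = (\<lambda>s. Inl (i, r, s)) ` E" using \<open>{v, w} \<in> edges \<Lambda>\<close> by (auto simp: \<Lambda>_def)
    have "v \<in> (\<lambda>s. Inl (i, r, s)) ` E" "w \<in> (\<lambda>s. Inl (i, r, s)) ` E" unfolding vw[symmetric] by auto
    then obtain s t where st: "v = Inl (i, r, s)" "w = Inl (i, r, t)" by auto
    have "E = {s, t}"
    proof -
      have "(\<lambda>s. Inl (i, r, s)) ` E = (\<lambda>s. Inl (i, r, s) :: 'i \<times> 'x \<times> 'g + 'i \<times> 'x) ` {s, t}" using vw st by simp
      then show ?thesis by (subst (asm) inj_image_eq_iff) (auto simp: inj_on_def)
    qed
    then have "stab_gen i r s \<otimes> stab_gen i r t = stab_gen i r t \<otimes> stab_gen i r s"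
      and "s \<in> verts (stab_graph i r)" "t \<in> verts (stab_graph i r)"
      using stab_basis[of i r] E by (auto simp: raag_basis_def simplicial_graph_def)
    moreover from this have "stab_gen i r s \<in> carrier G" "stab_gen i r t \<in> carrier G"
      using stab_gen by (auto simp: stab_def intro: A_closed)
    ultimately have "stab_gen i r s \<otimes> (stab_gen i r t \<otimes> rep r) = stab_gen i r t \<otimes> (stab_gen i r s \<otimes> rep r)"
      using r by (simp flip: m_assoc add: rep_closed)
    then show ?thesis
      using r \<open>stab_gen i r s \<in> carrier G\<close> \<open>stab_gen i r t \<in> carrier G\<close>
      by (simp add: st \<Lambda>_gen_def rep_closed m_assoc cancel_left)
  qed
  have \<theta>_gen: "c (\<Lambda>_gen v) x0 = raag_gen \<Lambda> v" if "v \<in> verts \<Lambda>" for v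
    using that conj(2) loop(2) lift(2) stab_gen by (auto simp: \<Lambda>_gen_def \<Lambda>_def[symmetric] lam_def)
      (auto simp: \<Lambda>_def)
  have "raag_basis (G\<lparr>carrier := H\<rparr>) \<Lambda> \<Lambda>_gen (\<lambda>h. c h x0)"
    unfolding raag_basis_def using simplicial_\<Lambda> e gen_H \<theta> \<theta>_gen by (simp, blast intro: comm)
  with subgroup.subgroup_is_group[OF H_sub is_group] show ?thesis
    unfolding H_def by (rule is_raag_if_basis)
qed

end

theorem is_raag_free_product_subgroup:
  fixes G :: "'g monoid" and A :: "'i \<Rightarrow> 'g set"
  assumes G: "group G" and A: "\<And>i. subgroup (A i) G" and gen: "carrier G = generate G (\<Union>i. A i)"
    and hereditary: "\<And>i S. subgroup S G \<Longrightarrow> S \<subseteq> A i \<Longrightarrow> is_raag (G\<lparr>carrier := S\<rparr>)"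
    and ext: "\<And>(\<Lambda> :: ('i \<times> 'g set \<times> 'g + 'i \<times> 'g set) sgraph) f.
      (\<And>i. f i \<in> hom (G\<lparr>carrier := A i\<rparr>) (wreath (raag \<Lambda>))) \<Longrightarrow>
      \<exists>F \<in> hom G (wreath (raag \<Lambda>) :: (('g set \<Rightarrow> 'g set) \<times> _) monoid). \<forall>i. \<forall>a \<in> A i. F a = f i a"
    and H: "subgroup H G"
  shows "is_raag (G\<lparr>carrier := H\<rparr>)"
proof -
  interpret G: group G by fact
  \<comment> \<open>Left translation of cosets, in which \<open>H\<close> is its own stabilizer.
    Sets that are not contained in the group are left fixed, so that \<open>act_one\<close> holds
    for every set.\<close>
  define act where "act g M = (if M \<subseteq> carrier G then g <#\<^bsub>G\<^esub> M else M)" for g M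
  interpret kurosh G A act H
  proof (rule kurosh.intro[OF G], rule kurosh_axioms.intro)
    show "act (g \<otimes>\<^bsub>G\<^esub> h) M = act g (act h M)" if "g \<in> carrier G" "h \<in> carrier G" for g h M
      using that G.lcos_m_assoc[of M g h] G.l_coset_subset_G[of M h] by (auto simp: act_def)
    show "act \<one>\<^bsub>G\<^esub> M = M" for M
      by (simp add: act_def G.lcos_mult_one)
    show "\<exists>F\<in>hom G (wreath (raag \<Lambda>) :: (('g set \<Rightarrow> 'g set) \<times> _) monoid). \<forall>i. \<forall>a\<in>A i. F a = f i a"
      if "\<And>i. f i \<in> hom (G\<lparr>carrier := A i\<rparr>) (wreath (raag \<Lambda>))"
      for \<Lambda> :: "('i \<times> 'g set \<times> 'g + 'i \<times> 'g set) sgraph" and f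
      using that by (rule ext)
  qed (fact A gen hereditary)+
  have "{g \<in> carrier G. act g H = H} = H"
  proof
    have "g \<in> g <#\<^bsub>G\<^esub> H" if "g \<in> carrier G" for g
      using that subgroup.one_closed[OF H] by (force simp: l_coset_def)
    then show "{g \<in> carrier G. act g H = H} \<subseteq> H"
      using subgroup.subset[OF H] by (auto simp: act_def)
    show "H \<subseteq> {g \<in> carrier G. act g H = H}"
      using subgroup.subset[OF H] G.coset_join3[OF _ H] by (auto simp: act_def)
  qed
  then show ?thesis using is_raag_stabilizer by simp
qed

section \<open>Central extensions\<close>

lemma (in group) commute_generate:
  assumes "S \<subseteq> carrier G" "x \<in> carrier G" "\<And>s. s \<in> S \<Longrightarrow> x \<otimes> s = s \<otimes> x" "g \<in> generate G S"
  shows "x \<otimes> g = g \<otimes> x"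
  using assms(4)
proof (induction rule: generate.induct)
  case (inv h)
  then have h: "h \<in> carrier G" "x \<otimes> h = h \<otimes> x" using assms by auto
  then have "inv h \<otimes> x \<otimes> h = x" using assms(2) by (simp add: m_assoc cancel_left)
  then show ?case using h assms(2) by (metis inv_closed inv_solve_right m_closed)
next
  case (eng h1 h2)
  then have "h1 \<in> carrier G" "h2 \<in> carrier G" using generate_in_carrier[OF assms(1)] by auto
  then show ?case using eng assms(2) by (metis m_assoc)
qed (use assms in auto)

text \<open>Lifts of adjacent basis elements commute by \<open>comm\<close>, so they define a
  section \<open>\<sigma>\<close> of \<open>\<rho>\<close>. The element \<open>y\<close> is central
  for the same reason, its image being trivial. Hence \<open>G\<close> is the direct product of the
  image of \<open>\<sigma>\<close> and the powers of \<open>y\<close>.\<close>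

theorem is_raag_central_extension:
  fixes G :: "'g monoid" (structure) and G' :: "'h monoid"
  assumes G: "group G" and G': "is_raag G'"
    and \<rho>: "\<rho> \<in> hom G G'" "\<rho> ` carrier G = carrier G'"
    and comm: "\<And>g h. g \<in> carrier G \<Longrightarrow> h \<in> carrier G \<Longrightarrow>
      \<rho> g \<otimes>\<^bsub>G'\<^esub> \<rho> h = \<rho> h \<otimes>\<^bsub>G'\<^esub> \<rho> g \<Longrightarrow> g \<otimes> h = h \<otimes> g"
    and y: "y \<in> carrier G" "\<rho> y = \<one>\<^bsub>G'\<^esub>"
    and ker: "\<And>g. g \<in> carrier G \<Longrightarrow> \<rho> g = \<one>\<^bsub>G'\<^esub> \<Longrightarrow> \<exists>n::int. g = y [^] n"
    and inf: "\<And>n::int. y [^] n = \<one> \<Longrightarrow> y \<noteq> \<one> \<Longrightarrow> n = 0"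
  shows "is_raag G"
proof -
  interpret G: group G by fact
  interpret G': group G' using G' by (simp add: is_raag_def)
  interpret \<rho>: group_hom G G' \<rho> by unfold_locales (rule \<rho>)
  obtain \<Lambda>' e' \<theta>' where basis: "raag_basis G' (\<Lambda>' :: 'h sgraph) e' \<theta>'" using G' is_raag_basisE by blast
  then have \<Lambda>': "simplicial_graph \<Lambda>'" and e': "e' ` verts \<Lambda>' \<subseteq> carrier G'"
    and comm': "\<And>v w. {v, w} \<in> edges \<Lambda>' \<Longrightarrow> e' v \<otimes>\<^bsub>G'\<^esub> e' w = e' w \<otimes>\<^bsub>G'\<^esub> e' v"
    and gen': "carrier G' = generate G' (e' ` verts \<Lambda>')"
    by (auto simp: raag_basis_def)
  have edge: "v \<in> verts \<Lambda>'" "w \<in> verts \<Lambda>'" if "{v, w} \<in> edges \<Lambda>'" for v w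
    using \<Lambda>' that by (auto simp: simplicial_graph_def)
  define l where "l s = inv_into (carrier G) \<rho> (e' s)" for s
  have l: "l s \<in> carrier G" "\<rho> (l s) = e' s" if "s \<in> verts \<Lambda>'" for s
  proof -
    have "e' s \<in> \<rho> ` carrier G" using e' \<rho>(2) that by auto
    then show "l s \<in> carrier G" "\<rho> (l s) = e' s" by (simp_all add: l_def inv_into_into f_inv_into_f)
  qed
  have l_comm: "l v \<otimes> l w = l w \<otimes> l v" if "{v, w} \<in> edges \<Lambda>'" for v w
    using edge[OF that] comm'[OF that] by (intro comm) (auto simp: l)
  obtain \<sigma> where \<sigma>: "\<sigma> \<in> hom G' G" "\<And>s. s \<in> verts \<Lambda>' \<Longrightarrow> \<sigma> (e' s) = l s"
    using raag_basis_hom_ext[OF basis G, of l] l l_comm by blast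
  interpret \<sigma>: group_hom G' G \<sigma> by unfold_locales (rule \<sigma>)
  have \<rho>\<sigma>: "\<rho> (\<sigma> x) = x" if "x \<in> carrier G'" for x
  proof -
    have "(\<rho> \<circ> \<sigma>) x = id x"
    proof (rule hom_eq_on_generate[where f' = id, OF G'.is_group G'.is_group _ _ e'])
      show "\<rho> \<circ> \<sigma> \<in> hom G' G'" using \<rho>(1) \<sigma>(1) by (metis hom_compose)
      show "id \<in> hom G' G'" by (simp add: hom_def)
    qed (use that gen' \<sigma> l in auto)
    then show ?thesis by simp
  qed
  \<comment> \<open>A direct factor of infinite order becomes the apex \<open>None\<close> of a
    cone; if \<open>y\<close> is trivial there is no apex.\<close>
  define \<Lambda> where "\<Lambda> = \<lparr>verts = Some ` verts \<Lambda>' \<union> (if y = \<one> then {} else {None}),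
    edges = (`) Some ` edges \<Lambda>' \<union> (if y = \<one> then {} else {{None, Some s} |s. s \<in> verts \<Lambda>'})\<rparr>"
  define e where "e v = (case v of None \<Rightarrow> y | Some s \<Rightarrow> l s)" for v
  define N where "N = (if y = \<one> then \<one>\<^bsub>raag \<Lambda>\<^esub> else raag_gen \<Lambda> None)"
  have \<Lambda>: "simplicial_graph \<Lambda>"
    using \<Lambda>' by (auto simp: simplicial_graph_def \<Lambda>_def card_image split: if_splits)
  interpret R: group "raag \<Lambda>" by (rule group_raag)
  have Some_edge: "{Some s, Some t} \<in> edges \<Lambda>" if "{s, t} \<in> edges \<Lambda>'" for s t
  proof -
    have "Some ` {s, t} \<in> edges \<Lambda>" using that unfolding \<Lambda>_def by (auto simp del: image_insert)
    then show ?thesis by simp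
  qed
  have Some_vert: "Some s \<in> verts \<Lambda>" if "s \<in> verts \<Lambda>'" for s using that by (simp add: \<Lambda>_def)
  have None_vert: "None \<in> verts \<Lambda>" if "y \<noteq> \<one>" using that by (simp add: \<Lambda>_def)
  obtain J where J: "J \<in> hom G' (raag \<Lambda>)" "\<And>s. s \<in> verts \<Lambda>' \<Longrightarrow> J (e' s) = raag_gen \<Lambda> (Some s)"
    using raag_basis_hom_ext[OF basis group_raag, of "\<lambda>s. raag_gen \<Lambda> (Some s)" \<Lambda>]
      raag_gen_commute[OF \<Lambda> Some_edge] raag_gen_closed[OF Some_vert] by blast
  interpret J: group_hom G' "raag \<Lambda>" J by unfold_locales (rule J)
  have N: "N \<in> carrier (raag \<Lambda>)" using raag_gen_closed[OF None_vert] by (auto simp: N_def)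
  have N_gen: "N \<otimes>\<^bsub>raag \<Lambda>\<^esub> raag_gen \<Lambda> v = raag_gen \<Lambda> v \<otimes>\<^bsub>raag \<Lambda>\<^esub> N" if v: "v \<in> verts \<Lambda>" for v
  proof (cases "y = \<one>")
    case True
    then show ?thesis using raag_gen_closed[OF v] by (simp add: N_def)
  next
    case False
    then have "v = None \<or> {None, v} \<in> edges \<Lambda>" using v by (auto simp: \<Lambda>_def)
    then show ?thesis using False raag_gen_commute[OF \<Lambda>, of None v] by (auto simp: N_def)
  qed
  have N_comm: "N \<otimes>\<^bsub>raag \<Lambda>\<^esub> x = x \<otimes>\<^bsub>raag \<Lambda>\<^esub> N" if "x \<in> carrier (raag \<Lambda>)" for x
  proof (rule R.commute_generate[where S = "raag_gen \<Lambda> ` verts \<Lambda>"])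
    show "x \<in> generate (raag \<Lambda>) (raag_gen \<Lambda> ` verts \<Lambda>)" using that carrier_raag_generate by blast
  qed (use N N_gen raag_gen_closed in auto)
  have y_comm: "y \<otimes> g = g \<otimes> y" if "g \<in> carrier G" for g
    using that y by (intro comm) auto
  have ex: "\<exists>n::int. g = \<sigma> (\<rho> g) \<otimes> y [^] n" if g: "g \<in> carrier G" for g
  proof -
    have "\<exists>n::int. inv (\<sigma> (\<rho> g)) \<otimes> g = y [^] n" using g by (intro ker) (auto simp: \<rho>\<sigma>)
    then show ?thesis using g by (metis G.inv_solve_left' G.inv_closed G.m_closed \<rho>.hom_closed \<sigma>.hom_closed G.int_pow_closed G.inv_solve_left y(1))
  qed
  \<comment> \<open>For trivial \<open>y\<close> every exponent is possible, and a free choice would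
    not be additive; hence the value 0.\<close>
  define k where "k g = (if y = \<one> then 0 else SOME n::int. g = \<sigma> (\<rho> g) \<otimes> y [^] n)" for g
  have k: "g = \<sigma> (\<rho> g) \<otimes> y [^] k g" if "g \<in> carrier G" for g
  proof (cases "y = \<one>")
    case True
    then show ?thesis using ex[OF that] by (auto simp: k_def)
  next
    case False
    then show ?thesis using someI_ex[OF ex[OF that]] by (simp add: k_def)
  qed
  have k_eq: "k g = n" if "g = \<sigma> x \<otimes> y [^] n" "x \<in> carrier G'" "y \<noteq> \<one>" for g x n
  proof -
    have g: "g \<in> carrier G" using that y by simp
    have "\<rho> g = x" using that y by (simp add: \<rho>\<sigma> \<rho>.hom_int_pow)
    then have "\<sigma> x \<otimes> y [^] k g = \<sigma> x \<otimes> y [^] n" using that(1) k[OF g] by simp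
    then have "y [^] k g = y [^] n" using that(2) y by simp
    then have "y [^] (k g - n) = \<one>" using y by (simp add: G.int_pow_diff)
    then show ?thesis using inf that(3) by fastforce
  qed
  have k_mult: "k (g \<otimes> h) = k g + k h" if gh: "g \<in> carrier G" "h \<in> carrier G" for g h
  proof (cases "y = \<one>")
    case False
    let ?a = "\<sigma> (\<rho> g)" and ?b = "\<sigma> (\<rho> h)" and ?p = "y [^] k g" and ?q = "y [^] k h"
    have car: "?a \<in> carrier G" "?b \<in> carrier G" "?p \<in> carrier G" "?q \<in> carrier G" using gh y by auto
    have "?p \<otimes> ?b = ?b \<otimes> ?p" using car y y_comm by (intro G.int_pow_commute) auto
    then have "(?a \<otimes> ?p) \<otimes> (?b \<otimes> ?q) = (?a \<otimes> ?b) \<otimes> (?p \<otimes> ?q)"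
      using car by (metis G.m_assoc G.m_closed)
    then have "g \<otimes> h = \<sigma> (\<rho> g \<otimes>\<^bsub>G'\<^esub> \<rho> h) \<otimes> y [^] (k g + k h)"
      using gh y k[OF gh(1)] k[OF gh(2)] by (simp add: G.int_pow_mult)
    then show ?thesis using gh False by (intro k_eq[where x = "\<rho> g \<otimes>\<^bsub>G'\<^esub> \<rho> h"]) auto
  qed (simp add: k_def)
  define \<theta> where "\<theta> g = J (\<rho> g) \<otimes>\<^bsub>raag \<Lambda>\<^esub> N [^]\<^bsub>raag \<Lambda>\<^esub> k g" for g
  have \<theta>: "\<theta> \<in> hom G (raag \<Lambda>)"
  proof (rule homI)
    fix g h assume gh: "g \<in> carrier G" "h \<in> carrier G"
    let ?a = "J (\<rho> g)" and ?b = "J (\<rho> h)" and ?p = "N [^]\<^bsub>raag \<Lambda>\<^esub> k g" and ?q = "N [^]\<^bsub>raag \<Lambda>\<^esub> k h"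
    have car: "?a \<in> carrier (raag \<Lambda>)" "?b \<in> carrier (raag \<Lambda>)" "?p \<in> carrier (raag \<Lambda>)" "?q \<in> carrier (raag \<Lambda>)"
      using gh N by auto
    have "?p \<otimes>\<^bsub>raag \<Lambda>\<^esub> ?b = ?b \<otimes>\<^bsub>raag \<Lambda>\<^esub> ?p" using car N N_comm by (intro R.int_pow_commute) auto
    then have "(?a \<otimes>\<^bsub>raag \<Lambda>\<^esub> ?p) \<otimes>\<^bsub>raag \<Lambda>\<^esub> (?b \<otimes>\<^bsub>raag \<Lambda>\<^esub> ?q)
        = (?a \<otimes>\<^bsub>raag \<Lambda>\<^esub> ?b) \<otimes>\<^bsub>raag \<Lambda>\<^esub> (?p \<otimes>\<^bsub>raag \<Lambda>\<^esub> ?q)"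
      using car by (metis R.m_assoc R.m_closed)
    then show "\<theta> (g \<otimes> h) = \<theta> g \<otimes>\<^bsub>raag \<Lambda>\<^esub> \<theta> h"
      using gh N by (simp add: \<theta>_def k_mult R.int_pow_mult)
  qed (use N in \<open>simp add: \<theta>_def\<close>)
  have \<theta>_gen: "\<theta> (e v) = raag_gen \<Lambda> v" if v: "v \<in> verts \<Lambda>" for v
  proof (cases v)
    case (Some s)
    then have s: "s \<in> verts \<Lambda>'" using v by (auto simp: \<Lambda>_def split: if_splits)
    have "k (l s) = 0"
    proof (cases "y = \<one>")
      case False
      then show ?thesis using s e' l(1)[OF s] \<sigma>(2)[OF s] by (intro k_eq[where x = "e' s"]) auto
    qed (simp add: k_def)
    then show ?thesis
      using s v Some raag_gen_closed[OF v] by (simp add: \<theta>_def e_def l J(2))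
  next
    case None
    then have "y \<noteq> \<one>" using v by (auto simp: \<Lambda>_def split: if_splits)
    moreover from this have "k y = 1" using y by (intro k_eq[where x = "\<one>\<^bsub>G'\<^esub>"]) auto
    ultimately show ?thesis using None raag_gen_closed[OF v] y by (simp add: \<theta>_def e_def N_def)
  qed
  have e: "e ` verts \<Lambda> \<subseteq> carrier G"
    using l(1) y(1) by (auto simp: \<Lambda>_def e_def split: if_splits)
  have e_comm: "e v \<otimes> e w = e w \<otimes> e v" if vw: "{v, w} \<in> edges \<Lambda>" for v w
  proof -
    have "v \<in> verts \<Lambda>" "w \<in> verts \<Lambda>" using \<Lambda> vw by (auto simp: simplicial_graph_def)
    then have car: "e v \<in> carrier G" "e w \<in> carrier G" using e by auto
    have edge': "{s, t} \<in> edges \<Lambda>'" if "v = Some s" "w = Some t" for s t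
    proof -
      have "None \<notin> {Some s, Some t}" "{Some s, Some t} \<in> edges \<Lambda>" using vw that by auto
      then have "{Some s, Some t} \<in> (`) Some ` edges \<Lambda>'"
        unfolding \<Lambda>_def by (auto simp del: insert_iff split: if_splits)
      then obtain E where E: "E \<in> edges \<Lambda>'" "{Some s, Some t} = Some ` E" by (rule imageE)
      have "Some ` {s, t} = Some ` E" using E(2) by simp
      then have "{s, t} = E" by (simp only: inj_image_eq_iff inj_Some)
      then show ?thesis using E(1) by simp
    qed
    consider "v = None" | "w = None" | s t where "v = Some s" "w = Some t" by (cases v; cases w) auto
    then show ?thesis
    proof cases
      case 1
      then have "e v = y" by (simp add: e_def)
      then show ?thesis using y_comm[OF car(2)] by simp
    next
      case 2
      then have "e w = y" by (simp add: e_def)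
      then show ?thesis using y_comm[OF car(1)] by simp
    next
      case 3
      then show ?thesis using l_comm[OF edge'[OF 3]] by (simp add: e_def)
    qed
  qed
  have e_generate: "carrier G = generate G (e ` verts \<Lambda>)"
  proof
    show "generate G (e ` verts \<Lambda>) \<subseteq> carrier G" by (rule G.generate_incl[OF e])
    have sub: "subgroup (generate G (e ` verts \<Lambda>)) G" by (rule G.generate_is_subgroup[OF e])
    have "\<sigma> ` carrier G' = generate G (\<sigma> ` e' ` verts \<Lambda>')" using \<sigma>.generate_img[OF e'] gen' by simp
    also have "\<dots> \<subseteq> generate G (e ` verts \<Lambda>)"
    proof (rule G.mono_generate)
      show "\<sigma> ` e' ` verts \<Lambda>' \<subseteq> e ` verts \<Lambda>"
      proof safe
        fix s assume s: "s \<in> verts \<Lambda>'"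
        then have "\<sigma> (e' s) = e (Some s)" "Some s \<in> verts \<Lambda>" using \<sigma>(2) by (auto simp: e_def \<Lambda>_def)
        then show "\<sigma> (e' s) \<in> e ` verts \<Lambda>" by simp
      qed
    qed
    finally have "\<sigma> (\<rho> g) \<in> generate G (e ` verts \<Lambda>)" if "g \<in> carrier G" for g using that by auto
    moreover have "y \<in> generate G (e ` verts \<Lambda>)"
    proof (cases "y = \<one>")
      case True
      then show ?thesis by (simp add: generate.one)
    next
      case False
      have "e None \<in> generate G (e ` verts \<Lambda>)" using None_vert[OF False] by (intro generate.incl imageI)
      then show ?thesis by (simp add: e_def)
    qed
    ultimately have "\<sigma> (\<rho> g) \<otimes> y [^] k g \<in> generate G (e ` verts \<Lambda>)" if "g \<in> carrier G" for g
      using that by (intro subgroup.m_closed[OF sub] G.subgroup_int_pow_closed[OF sub])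
    then show "carrier G \<subseteq> generate G (e ` verts \<Lambda>)" using k by (metis subsetI)
  qed
  have "raag_basis G \<Lambda> e \<theta>"
    unfolding raag_basis_def by (intro conjI allI impI ballI \<Lambda> e e_comm e_generate \<theta> \<theta>_gen)
  then show ?thesis by (rule is_raag_if_basis[OF G])
qed

lemma int_subgroup_multiples:
  fixes S :: "int set"
  assumes "0 \<in> S" "\<And>a b. a \<in> S \<Longrightarrow> b \<in> S \<Longrightarrow> a - b \<in> S"
  obtains m where "\<And>n. n \<in> S \<longleftrightarrow> m dvd n"
proof -
  have neg: "- a \<in> S" if "a \<in> S" for a using assms(2)[OF assms(1) that] by simp
  have add: "a + b \<in> S" if "a \<in> S" "b \<in> S" for a b using assms(2)[OF that(1) neg[OF that(2)]] by simp
  have mult: "a * int j \<in> S" if "a \<in> S" for a j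
    by (induction j) (auto simp: assms(1) add that algebra_simps)
  have mult': "a * j \<in> S" if "a \<in> S" for a j
    using mult[OF that, of "nat j"] mult[OF neg[OF that], of "nat (- j)"] by (cases "j \<ge> 0") auto
  show ?thesis
  proof (cases "\<exists>a\<in>S. a \<noteq> 0")
    case False
    then show ?thesis using that[of 0] assms(1) by auto
  next
    case True
    then have "\<exists>j. j > 0 \<and> int j \<in> S" by (metis neg neg_0_less_iff_less linorder_neqE_linordered_idom zero_less_imp_eq_int)
    then obtain j where j: "j > 0" "int j \<in> S" and least: "\<And>i. i > 0 \<Longrightarrow> int i \<in> S \<Longrightarrow> j \<le> i"
      using LeastI_ex[of "\<lambda>j. j > 0 \<and> int j \<in> S"] Least_le[of "\<lambda>j. j > 0 \<and> int j \<in> S"] by blast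
    have "int j dvd n" if "n \<in> S" for n
    proof -
      have "n - int j * (n div int j) \<in> S" using assms(2) that mult' j by blast
      then have "n mod int j \<in> S" by (simp add: minus_mult_div_eq_mod)
      moreover have "0 \<le> n mod int j" "n mod int j < int j" using j by auto
      ultimately have "n mod int j = 0" using least[of "nat (n mod int j)"] by fastforce
      then show ?thesis by auto
    qed
    then show ?thesis using that[of "int j"] mult'[OF j(2)] by (auto elim!: dvdE)
  qed
qed

section \<open>Parabolic subgroups and their Bestvina--Brady subgroups\<close>

locale simplicial_raag =
  fixes \<Gamma> :: "'a sgraph" and G :: "'a word set monoid" (structure)
  assumes simplicial: "simplicial_graph \<Gamma>" and G: "G = raag \<Gamma>"

sublocale simplicial_raag \<subseteq> group G
  by (simp add: G group_raag)

context simplicial_raag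
begin

abbreviation "gen \<equiv> raag_gen \<Gamma>"
abbreviation "chi \<equiv> bb_char \<Gamma>"

text \<open>Taken inside the fixed group \<open>G\<close> and not as the right-angled Artin group of
  an induced subgraph, so the induction on \<open>W\<close> never changes the surrounding
  group.\<close>

definition parabolic where "parabolic W = generate G (gen ` W)"

definition bb_parabolic where "bb_parabolic W = {g \<in> parabolic W. chi g = 0}"

definition hereditarily_raag where
  "hereditarily_raag W \<longleftrightarrow> (\<forall>H. subgroup H G \<longrightarrow> H \<subseteq> bb_parabolic W \<longrightarrow> is_raag (G\<lparr>carrier := H\<rparr>))"

lemma gen_closed: "v \<in> verts \<Gamma> \<Longrightarrow> gen v \<in> carrier G"
  by (simp add: G raag_gen_closed)

lemma gen_image: "W \<subseteq> verts \<Gamma> \<Longrightarrow> gen ` W \<subseteq> carrier G"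
  using gen_closed by auto

lemma edge_verts: "{v, w} \<in> edges \<Gamma> \<Longrightarrow> v \<in> verts \<Gamma> \<and> w \<in> verts \<Gamma> \<and> v \<noteq> w"
  using simplicial by (force simp: simplicial_graph_def)

lemma gen_commute: "{v, w} \<in> edges \<Gamma> \<Longrightarrow> gen v \<otimes> gen w = gen w \<otimes> gen v"
  unfolding G by (rule raag_gen_commute[OF simplicial])

lemma chi_hom: "chi \<in> hom G integer_group"
  by (simp add: G bb_char_hom)

sublocale chi: group_hom G integer_group chi
  by (simp add: group_hom_def group_hom_axioms_def is_group chi_hom)

lemma chi_gen: "v \<in> verts \<Gamma> \<Longrightarrow> chi (gen v) = 1"
  by (rule bb_char_gen)

lemma chi_pow: "v \<in> verts \<Gamma> \<Longrightarrow> chi (gen v [^] (n::int)) = n"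
  by (simp add: chi.hom_int_pow gen_closed chi_gen)

lemma parabolic_subgroup: "W \<subseteq> verts \<Gamma> \<Longrightarrow> subgroup (parabolic W) G"
  unfolding parabolic_def by (rule generate_is_subgroup[OF gen_image])

lemma parabolic_closed: "W \<subseteq> verts \<Gamma> \<Longrightarrow> g \<in> parabolic W \<Longrightarrow> g \<in> carrier G"
  by (rule subgroup.mem_carrier[OF parabolic_subgroup])

lemma gen_parabolic: "v \<in> W \<Longrightarrow> gen v \<in> parabolic W"
  by (auto simp: parabolic_def intro: generate.incl)

lemma parabolic_mono: "U \<subseteq> W \<Longrightarrow> parabolic U \<subseteq> parabolic W"
  unfolding parabolic_def by (intro mono_generate image_mono)

lemma parabolic_verts: "parabolic (verts \<Gamma>) = carrier G"
  using carrier_raag_generate[of \<Gamma>] by (simp add: parabolic_def flip: G)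

lemma bb_parabolic_subgroup: "W \<subseteq> verts \<Gamma> \<Longrightarrow> subgroup (bb_parabolic W) G"
proof (rule subgroupI)
  assume W: "W \<subseteq> verts \<Gamma>"
  note sub = parabolic_subgroup[OF W] and car = parabolic_closed[OF W]
  show "bb_parabolic W \<noteq> {}"
    using subgroup.one_closed[OF sub] chi.hom_one by (auto simp: bb_parabolic_def)
qed (auto simp: bb_parabolic_def parabolic_closed subgroup.m_closed[OF parabolic_subgroup]
      subgroup.m_inv_closed[OF parabolic_subgroup])

lemma raag_ext:
  assumes "group K" "\<And>v. v \<in> verts \<Gamma> \<Longrightarrow> u v \<in> carrier K"
    "\<And>v w. {v, w} \<in> edges \<Gamma> \<Longrightarrow> u v \<otimes>\<^bsub>K\<^esub> u w = u w \<otimes>\<^bsub>K\<^esub> u v"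
  obtains f where "f \<in> hom G K" "\<And>v. v \<in> verts \<Gamma> \<Longrightarrow> f (gen v) = u v"
  using raag_hom_ext[OF simplicial, of K u] assms unfolding G by blast

text \<open>On at most one generator, exponent sum zero leaves only the identity, and the trivial
  group belongs to the empty graph.\<close>

lemma hereditarily_raag_small:
  assumes "W \<subseteq> {v}" "W \<subseteq> verts \<Gamma>"
  shows "hereditarily_raag W"
  unfolding hereditarily_raag_def
proof (intro allI impI)
  fix H assume H: "subgroup H G" "H \<subseteq> bb_parabolic W"
  have "bb_parabolic W \<subseteq> {\<one>}"
  proof (cases "W = {}")
    case True
    then show ?thesis by (auto simp: bb_parabolic_def parabolic_def generate_empty)
  next
    case False
    then have W: "W = {v}" "v \<in> verts \<Gamma>" using assms by auto
    then have "parabolic W = {gen v [^] k |k::int. True}"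
      by (simp add: parabolic_def generate_pow gen_closed)
    then show ?thesis using chi_pow[OF W(2)] by (auto simp: bb_parabolic_def)
  qed
  then have "H = {\<one>}" using H subgroup.one_closed[OF H(1)] by auto
  moreover define \<Lambda> :: "'a sgraph" where "\<Lambda> = \<lparr>verts = {}, edges = {}\<rparr>"
  moreover have "generate (G\<lparr>carrier := H\<rparr>) {} = generate G {}" using H by (intro generate_consistent) auto
  ultimately have "raag_basis (G\<lparr>carrier := H\<rparr>) \<Lambda> (\<lambda>_. \<one>) (\<lambda>_. \<one>\<^bsub>raag \<Lambda>\<^esub>)"
    using group.is_monoid[OF group_raag, of \<Lambda>]
    by (auto simp: raag_basis_def simplicial_graph_def hom_def generate_empty monoid.one_closed monoid.l_one)
  then show "is_raag (G\<lparr>carrier := H\<rparr>)"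
    by (rule is_raag_if_basis[OF subgroup.subgroup_is_group[OF H(1) is_group]])
qed

end

section \<open>Two dominating vertices: a central cyclic factor\<close>

context simplicial_raag
begin

theorem hereditarily_raag_two_dominating:
  assumes W: "W \<subseteq> verts \<Gamma>" and uv: "u \<in> W" "v \<in> W" "u \<noteq> v"
    and u: "\<And>w. w \<in> W \<Longrightarrow> w \<noteq> u \<Longrightarrow> {u, w} \<in> edges \<Gamma>"
    and v: "\<And>w. w \<in> W \<Longrightarrow> w \<noteq> v \<Longrightarrow> {v, w} \<in> edges \<Gamma>"
    and IH: "hereditarily_raag (W - {v})"
  shows "hereditarily_raag W"
  unfolding hereditarily_raag_def
proof (intro allI impI)
  fix H assume H: "subgroup H G" "H \<subseteq> bb_parabolic W"
  have uV: "u \<in> verts \<Gamma>" and vV: "v \<in> verts \<Gamma>" using W uv by auto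
  define z where "z = gen v \<otimes> inv (gen u)"
  have car: "gen u \<in> carrier G" "gen v \<in> carrier G" using uV vV gen_closed by auto
  have zc: "z \<in> carrier G" using car by (simp add: z_def)
  \<comment> \<open>Substituting \<open>u\<close> for \<open>v\<close> kills \<open>z\<close> and
    keeps exponent sums on \<open>parabolic W\<close>. It respects the relations because
    \<open>u\<close> dominates \<open>W\<close>; vertices outside \<open>W\<close> go to the
    identity, so their edges impose nothing.\<close>
  obtain \<rho> where \<rho>: "\<rho> \<in> hom G G"
    and \<rho>_gen: "\<And>w. w \<in> verts \<Gamma> \<Longrightarrow> \<rho> (gen w) = (if w = v then gen u else if w \<in> W then gen w else \<one>)"
  proof (rule raag_ext[OF is_group, of "\<lambda>w. if w = v then gen u else if w \<in> W then gen w else \<one>"])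
    show "(if w = v then gen u else if w \<in> W then gen w else \<one>) \<in> carrier G" if "w \<in> verts \<Gamma>" for w
      using that gen_closed car by simp
    show "(if w = v then gen u else if w \<in> W then gen w else \<one>) \<otimes> (if w' = v then gen u else if w' \<in> W then gen w' else \<one>)
      = (if w' = v then gen u else if w' \<in> W then gen w' else \<one>) \<otimes> (if w = v then gen u else if w \<in> W then gen w else \<one>)"
      if "{w, w'} \<in> edges \<Gamma>" for w w'
    proof -
      have uw: "gen u \<otimes> gen x = gen x \<otimes> gen u" if "x \<in> W" for x
        using gen_commute[OF u[OF that]] by (cases "x = u") auto
      show ?thesis
        using edge_verts[OF that] gen_commute[OF that] uw gen_closed car by auto
    qed
  qed (rule that)
  interpret \<rho>: group_hom G G \<rho> by (simp add: group_hom_def group_hom_axioms_def is_group \<rho>)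
  have sub: "gen ` W \<subseteq> carrier G" using gen_image[OF W] .
  have comm_u: "gen u \<otimes> gen w = gen w \<otimes> gen u" and comm_v: "gen v \<otimes> gen w = gen w \<otimes> gen v" if "w \<in> W" for w
    using gen_commute[OF u[OF that]] gen_commute[OF v[OF that]] by (cases "w = u"; cases "w = v"; auto)+
  have z_gen: "z \<otimes> gen w = gen w \<otimes> z" if w: "w \<in> W" for w
  proof -
    have "gen w \<in> carrier G" using w sub by auto
    moreover have "inv (gen u) \<otimes> gen w = gen w \<otimes> inv (gen u)"
      using int_pow_commute[of "gen u" "gen w" "- 1"] comm_u[OF w] \<open>gen w \<in> carrier G\<close> car
      by (simp add: int_pow_neg)
    ultimately show ?thesis using comm_v[OF w] car by (simp add: z_def m_assoc) (simp flip: m_assoc)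
  qed
  have z_comm: "z \<otimes> g = g \<otimes> z" if "g \<in> parabolic W" for g
    by (rule commute_generate[OF sub zc _ that[unfolded parabolic_def]]) (elim imageE, simp only: z_gen)
  have zn_comm: "z [^] (n::int) \<otimes> g = g \<otimes> z [^] n" if "g \<in> parabolic W" for g n
    by (rule int_pow_commute[OF zc parabolic_closed[OF W that] z_comm[OF that]])
  have zn_mult: "(a \<otimes> z [^] (n::int)) \<otimes> (b \<otimes> z [^] (m::int)) = (a \<otimes> b) \<otimes> (z [^] n \<otimes> z [^] m)"
    if "a \<in> carrier G" "b \<in> parabolic W" for a b n m
  proof -
    have "z [^] n \<otimes> (b \<otimes> z [^] m) = b \<otimes> (z [^] n \<otimes> z [^] m)"
      using that zc parabolic_closed[OF W] zn_comm[OF that(2), of n] by (simp flip: m_assoc)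
    then show ?thesis using that zc parabolic_closed[OF W] by (simp add: m_assoc)
  qed
  have \<rho>_img: "\<rho> g \<in> parabolic (W - {v})" if "g \<in> parabolic W" for g
  proof -
    have "\<rho> ` parabolic W = generate G (\<rho> ` gen ` W)"
      unfolding parabolic_def using \<rho>.generate_img[OF sub] by simp
    also have "\<dots> \<subseteq> parabolic (W - {v})"
      unfolding parabolic_def using \<rho>_gen W uv by (intro mono_generate) (auto split: if_splits)
    finally show ?thesis using that by auto
  qed
  have \<rho>_chi: "chi (\<rho> g) = chi g" if "g \<in> parabolic W" for g
  proof -
    have "(chi \<circ> \<rho>) g = chi g"
    proof (rule hom_eq_on_generate[where f = "chi \<circ> \<rho>" and f' = chi, OF is_group group_integer_group _ chi_hom sub])
      show "chi \<circ> \<rho> \<in> hom G integer_group" using \<rho> chi_hom by (auto simp: hom_def)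
      fix s assume "s \<in> gen ` W"
      then obtain w where w: "w \<in> W" "s = gen w" by (rule imageE) auto
      then have "w \<in> verts \<Gamma>" using W by auto
      then show "(chi \<circ> \<rho>) s = chi s" using w by (simp add: \<rho>_gen chi_gen uV)
    qed (use that in \<open>simp add: parabolic_def\<close>)
    then show ?thesis by simp
  qed
  \<comment> \<open>Since \<open>z\<close> is central in \<open>parabolic W\<close>, the powers of
    \<open>z\<close> that arise when \<open>v\<close> is replaced by \<open>u\<close> can be
    collected on the right.\<close>
  have z_pow: "\<exists>n::int. g = \<rho> g \<otimes> z [^] n" if "g \<in> parabolic W" for g
    using that unfolding parabolic_def
  proof (induction rule: generate.induct)
    case one
    then show ?case by (intro exI[of _ 0]) simp
  next
    case (incl h)
    then obtain w where w: "w \<in> W" "h = gen w" by auto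
    then have wc: "gen w \<in> carrier G" "w \<in> verts \<Gamma>" using W sub by auto
    show ?case
    proof (cases "w = v")
      case True
      have "gen u \<otimes> z = gen v" using comm_u[OF uv(2)] car by (simp add: z_def flip: m_assoc) (simp add: m_assoc)
      then show ?thesis using True w wc zc \<rho>_gen by (intro exI[of _ 1]) simp
    next
      case False
      then show ?thesis using w wc \<rho>_gen by (intro exI[of _ 0]) simp
    qed
  next
    case (inv h)
    then obtain w where w: "w \<in> W" "h = gen w" by auto
    then have wc: "gen w \<in> carrier G" "w \<in> verts \<Gamma>" using W sub by auto
    show ?case
    proof (cases "w = v")
      case True
      have "inv (gen u) \<otimes> inv z = inv (gen v)"
        using car by (simp add: z_def inv_mult_group cancel_left)
      then show ?thesis using True w wc zc \<rho>_gen by (intro exI[of _ "-1"]) (simp add: int_pow_neg)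
    next
      case False
      then show ?thesis using w wc \<rho>_gen by (intro exI[of _ 0]) simp
    qed
  next
    case (eng h1 h2)
    then obtain n m :: int where nm: "h1 = \<rho> h1 \<otimes> z [^] n" "h2 = \<rho> h2 \<otimes> z [^] m" by blast
    have h: "h1 \<in> parabolic W" "h2 \<in> parabolic W" using eng by (auto simp: parabolic_def)
    then have hc: "h1 \<in> carrier G" "h2 \<in> carrier G" using parabolic_closed[OF W] by auto
    have "\<rho> h2 \<in> parabolic W" using \<rho>_img[OF h(2)] parabolic_mono[of "W - {v}" W] by auto
    then have "(\<rho> h1 \<otimes> z [^] n) \<otimes> (\<rho> h2 \<otimes> z [^] m) = (\<rho> h1 \<otimes> \<rho> h2) \<otimes> (z [^] n \<otimes> z [^] m)"
      using zn_mult hc by simp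
    also have "\<dots> = \<rho> (h1 \<otimes> h2) \<otimes> z [^] (n + m)"
      using hc zc by (simp add: int_pow_mult)
    finally show ?case using HOL.trans[OF arg_cong2[OF nm, of "(\<otimes>)"]] by blast
  qed
  let ?G = "G\<lparr>carrier := H\<rparr>" and ?H = "\<rho> ` H"
  have HW: "H \<subseteq> parabolic W" and Hchi: "\<And>h. h \<in> H \<Longrightarrow> chi h = 0" using H(2) by (auto simp: bb_parabolic_def)
  have Hc: "H \<subseteq> carrier G" using subgroup.subset[OF H(1)] .
  have H': "subgroup ?H G" using \<rho>.subgroup_img_is_subgroup[OF H(1)] .
  moreover have "?H \<subseteq> bb_parabolic (W - {v})" using HW Hchi \<rho>_img \<rho>_chi by (auto simp: bb_parabolic_def)
  ultimately have raag': "is_raag (G\<lparr>carrier := ?H\<rparr>)" using IH by (auto simp: hereditarily_raag_def)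
  \<comment> \<open>The kernel of \<open>\<rho>\<close> on \<open>H\<close> consists of the powers
    of \<open>z\<close> lying in \<open>H\<close>. The value \<open>m = 0\<close> occurs when this
    kernel is trivial, and then \<open>y\<close> is the identity.\<close>
  obtain m where m: "\<And>n. n \<in> {n::int. z [^] n \<in> H} \<longleftrightarrow> m dvd n"
  proof (rule int_subgroup_multiples[of "{n::int. z [^] n \<in> H}"])
    show "0 \<in> {n::int. z [^] n \<in> H}" using subgroup.one_closed[OF H(1)] by simp
    show "a - b \<in> {n::int. z [^] n \<in> H}" if "a \<in> {n::int. z [^] n \<in> H}" "b \<in> {n::int. z [^] n \<in> H}" for a b
      using that zc subgroup.m_closed[OF H(1)] subgroup.m_inv_closed[OF H(1)] by (simp add: int_pow_diff)
  qed (rule that)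
  define y where "y = z [^] m"
  have y: "y \<in> H" using m[of m] by (simp add: y_def)
  \<comment> \<open>The exponent sum of \<open>v\<close> alone takes the value \<open>n\<close> on
    \<open>z [^] n\<close>; thus \<open>z\<close> has infinite order, which \<open>chi\<close>
    cannot show because \<open>chi z = 0\<close>.\<close>
  obtain \<omega> where \<omega>: "\<omega> \<in> hom G integer_group" "\<And>w. w \<in> verts \<Gamma> \<Longrightarrow> \<omega> (gen w) = (if w = v then 1 else 0)"
    using raag_ext[OF group_integer_group, of "\<lambda>w. if w = v then 1 else 0"] by (auto simp: add.commute)
  interpret \<omega>: group_hom G integer_group \<omega> by (simp add: group_hom_def group_hom_axioms_def is_group \<omega>)
  have \<omega>z: "\<omega> (z [^] n) = n" for n :: int
    using car zc uv(3) by (simp add: \<omega>.hom_int_pow) (simp add: z_def \<omega>(2)[OF uV] \<omega>(2)[OF vV])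
  have \<rho>z: "\<rho> z = \<one>" using car uv \<rho>_gen[OF uV] \<rho>_gen[OF vV] by (simp add: z_def)
  have pow_H: "y [^]\<^bsub>?G\<^esub> n = y [^] n" for n :: int
    using int_pow_consistent[OF H(1) y] by simp
  show "is_raag ?G"
  proof (rule is_raag_central_extension[OF _ raag'])
    show "group ?G" by (rule subgroup.subgroup_is_group[OF H(1) is_group])
    show "\<rho> \<in> hom ?G (G\<lparr>carrier := ?H\<rparr>)" using Hc by (intro homI) (auto simp: subset_iff)
    show "\<rho> ` carrier ?G = carrier (G\<lparr>carrier := ?H\<rparr>)" by simp
    show "y \<in> carrier ?G" using y by simp
    show "\<rho> y = \<one>\<^bsub>G\<lparr>carrier := ?H\<rparr>\<^esub>" using zc \<rho>z by (simp add: y_def \<rho>.hom_int_pow)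
    show "g \<otimes>\<^bsub>?G\<^esub> h = h \<otimes>\<^bsub>?G\<^esub> g"
      if gh: "g \<in> carrier ?G" "h \<in> carrier ?G"
        and c: "\<rho> g \<otimes>\<^bsub>G\<lparr>carrier := ?H\<rparr>\<^esub> \<rho> h = \<rho> h \<otimes>\<^bsub>G\<lparr>carrier := ?H\<rparr>\<^esub> \<rho> g" for g h
    proof -
      \<comment> \<open>Each element differs from its image under \<open>\<rho>\<close> by a central
        power of \<open>z\<close>, so the commutation of images passes to the elements.\<close>
      have ghW: "g \<in> parabolic W" "h \<in> parabolic W" using gh HW by auto
      obtain n :: int where n: "g = \<rho> g \<otimes> z [^] n" using z_pow[OF ghW(1)] ..
      obtain k :: int where k: "h = \<rho> h \<otimes> z [^] k" using z_pow[OF ghW(2)] ..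
      have p: "\<rho> g \<in> parabolic W" "\<rho> h \<in> parabolic W"
        using \<rho>_img[OF ghW(1)] \<rho>_img[OF ghW(2)] parabolic_mono[of "W - {v}" W] by auto
      then have "\<rho> g \<in> carrier G" "\<rho> h \<in> carrier G" using parabolic_closed[OF W] by auto
      then have "g \<otimes> h = (\<rho> g \<otimes> \<rho> h) \<otimes> (z [^] n \<otimes> z [^] k)"
        "h \<otimes> g = (\<rho> h \<otimes> \<rho> g) \<otimes> (z [^] k \<otimes> z [^] n)"
        using HOL.trans[OF arg_cong2[OF n k, of "(\<otimes>)"] zn_mult] HOL.trans[OF arg_cong2[OF k n, of "(\<otimes>)"] zn_mult] p
        by blast+
      moreover have "z [^] n \<otimes> z [^] k = z [^] k \<otimes> z [^] n"
        using zc by (simp add: add.commute flip: int_pow_mult)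
      ultimately show ?thesis using c by simp
    qed
    show "\<exists>n::int. g = y [^]\<^bsub>?G\<^esub> n" if g: "g \<in> carrier ?G" "\<rho> g = \<one>\<^bsub>G\<lparr>carrier := ?H\<rparr>\<^esub>" for g
    proof -
      have "g \<in> parabolic W" using g HW by auto
      from z_pow[OF this] obtain n :: int where n: "g = \<rho> g \<otimes> z [^] n" ..
      also have "\<dots> = z [^] n" using g(2) zc by simp
      finally have gz: "g = z [^] n" .
      then have "m dvd n" using m[of n] g by simp
      then obtain j where "n = m * j" by (auto elim: dvdE)
      then have "g = y [^] j" using gz zc by (simp add: y_def int_pow_pow)
      then show ?thesis using pow_H by auto
    qed
    show "n = 0" if "y [^]\<^bsub>?G\<^esub> n = \<one>\<^bsub>?G\<^esub>" "y \<noteq> \<one>\<^bsub>?G\<^esub>" for n :: int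
    proof -
      have "y [^] n = \<one>" using that pow_H by simp
      then have "z [^] (m * n) = \<one>" using zc by (simp add: y_def int_pow_pow)
      then have "m * n = 0" using \<omega>z[of "m * n"] by simp
      moreover have "m \<noteq> 0" using that(2) by (cases "m = 0") (simp_all add: y_def)
      ultimately show ?thesis by simp
    qed
  qed
qed

section \<open>Cut vertices: free products of Bestvina--Brady groups\<close>

definition level_map :: "'a \<Rightarrow> ('a word set \<Rightarrow> 'k) \<Rightarrow> 'a word set \<Rightarrow> (int \<Rightarrow> int) \<times> (int \<Rightarrow> 'k)" where
  "level_map v f g = (\<lambda>n. n + chi g, \<lambda>n. f (gen v [^] (- (n + chi g)) \<otimes> g \<otimes> gen v [^] n))"

text \<open>This is induction from the subgroup of exponent sum zero to the parabolic subgroup: the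
  powers of \<open>v\<close> represent the cosets, level \<open>n\<close> standing for the
  \<open>n\<close>-th power, and the inner powers cancel in a product.\<close>

lemma level_map_hom:
  assumes W: "W \<subseteq> verts \<Gamma>" and v: "v \<in> W" and K: "group K" and f: "f \<in> hom (G\<lparr>carrier := bb_parabolic W\<rparr>) K"
  shows "level_map v f \<in> hom (G\<lparr>carrier := parabolic W\<rparr>) (wreath K)"
proof (rule homI)
  let ?t = "gen v"
  have vV: "v \<in> verts \<Gamma>" using W v by auto
  have tc: "?t \<in> carrier G" using vV gen_closed by auto
  note sub = parabolic_subgroup[OF W]
  have t_pow: "?t [^] (n::int) \<in> parabolic W" for n
    using subgroup_int_pow_closed[OF sub gen_parabolic[OF v]] .
  have bb: "?t [^] (- (n + chi g)) \<otimes> g \<otimes> ?t [^] n \<in> bb_parabolic W" if "g \<in> parabolic W" for g and n :: int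
    using that parabolic_closed[OF W that] t_pow tc
    by (auto simp: bb_parabolic_def chi_pow[OF vV] intro!: subgroup.m_closed[OF sub])
  fix g assume "g \<in> carrier (G\<lparr>carrier := parabolic W\<rparr>)"
  then have g: "g \<in> parabolic W" by simp
  have "bij (\<lambda>n::int. n + chi g)" by (rule o_bij[of "\<lambda>n. n - chi g"]) auto
  then show "level_map v f g \<in> carrier (wreath K)"
    using bb[OF g] hom_in_carrier[OF f] by (simp add: level_map_def wreath_simps)
  fix h assume "h \<in> carrier (G\<lparr>carrier := parabolic W\<rparr>)"
  then have h: "h \<in> parabolic W" by simp
  have gc: "g \<in> carrier G" and hc: "h \<in> carrier G" using g h parabolic_closed[OF W] by auto
  have "level_map v f (g \<otimes> h) = level_map v f g \<otimes>\<^bsub>wreath K\<^esub> level_map v f h"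
  proof (rule wreath_eqI)
    show "fst (level_map v f (g \<otimes> h)) = fst (level_map v f g \<otimes>\<^bsub>wreath K\<^esub> level_map v f h)"
      using gc hc by (auto simp: level_map_def wreath_simps fun_eq_iff)
    fix n :: int
    let ?m = "n + chi h"
    have "?t [^] (- (n + chi (g \<otimes> h))) \<otimes> (g \<otimes> h) \<otimes> ?t [^] n
      = (?t [^] (- (?m + chi g)) \<otimes> g \<otimes> ?t [^] ?m) \<otimes> (?t [^] (- ?m) \<otimes> h \<otimes> ?t [^] n)"
    proof -
      have e1: "a \<otimes> (g \<otimes> h) \<otimes> d = (a \<otimes> g \<otimes> b) \<otimes> (inv b \<otimes> h \<otimes> d)"
        if "a \<in> carrier G" "b \<in> carrier G" "d \<in> carrier G" for a b d
        using that gc hc by (simp add: m_assoc cancel_left)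
      have e2: "?t [^] (- ?m) = inv (?t [^] ?m)" using tc by (rule int_pow_neg)
      have e3: "n + chi (g \<otimes> h) = ?m + chi g" using gc hc by simp
      show ?thesis unfolding e3 e2 by (rule e1) (use tc in simp_all)
    qed
    then show "snd (level_map v f (g \<otimes> h)) n = snd (level_map v f g \<otimes>\<^bsub>wreath K\<^esub> level_map v f h) n"
      using hom_mult[OF f, of "?t [^] (- (?m + chi g)) \<otimes> g \<otimes> ?t [^] ?m" "?t [^] (- ?m) \<otimes> h \<otimes> ?t [^] n"]
        bb[OF g, of ?m] bb[OF h, of n]
      by (simp add: level_map_def wreath_simps)
  qed
  then show "level_map v f (g \<otimes>\<^bsub>G\<lparr>carrier := parabolic W\<rparr>\<^esub> h) = level_map v f g \<otimes>\<^bsub>wreath K\<^esub> level_map v f h"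
    by simp
qed

text \<open>Over a cut vertex the Bestvina--Brady group is a free product: the semidirect decompositions of
  the two parabolic subgroups along the powers of the cut vertex turn homomorphisms out of
  the factors into homomorphisms to a wreath product over the integers, where they can be glued.\<close>

lemma bb_free_product_ext:
  fixes K :: "('k, 'z) monoid_scheme"
  assumes W: "W1 \<subseteq> verts \<Gamma>" "W2 \<subseteq> verts \<Gamma>" "W1 \<inter> W2 = {v}"
    and no_edge: "\<And>x y. x \<in> W1 - {v} \<Longrightarrow> y \<in> W2 - {v} \<Longrightarrow> {x, y} \<notin> edges \<Gamma>"
    and K: "group K" and f1: "f1 \<in> hom (G\<lparr>carrier := bb_parabolic W1\<rparr>) K"
    and f2: "f2 \<in> hom (G\<lparr>carrier := bb_parabolic W2\<rparr>) K"
  obtains F where "F \<in> hom (G\<lparr>carrier := bb_parabolic (W1 \<union> W2)\<rparr>) K"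
    "\<And>g. g \<in> bb_parabolic W1 \<Longrightarrow> F g = f1 g" "\<And>g. g \<in> bb_parabolic W2 \<Longrightarrow> F g = f2 g"
proof -
  let ?Wr = "wreath K :: ((int \<Rightarrow> int) \<times> (int \<Rightarrow> 'k)) monoid"
  have Wr: "group ?Wr" by (rule group_wreath[OF K])
  interpret Wr: group ?Wr by fact
  have v: "v \<in> W1" "v \<in> W2" using W by auto
  have vV: "v \<in> verts \<Gamma>" using W v by auto
  note h1 = level_map_hom[OF W(1) v(1) K f1] and h2 = level_map_hom[OF W(2) v(2) K f2]
  have one: "f \<one> = \<one>\<^bsub>K\<^esub>" if "f \<in> hom (G\<lparr>carrier := bb_parabolic W\<rparr>) K" "W \<subseteq> verts \<Gamma>" for f W
    using hom_one[OF that(1) subgroup.subgroup_is_group[OF bb_parabolic_subgroup[OF that(2)] is_group] K] by simp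
  \<comment> \<open>The cut vertex becomes the pure shift whatever \<open>f\<close> is, so the two
    induced maps agree on the only common generator.\<close>
  have "level_map v f (gen v) = (\<lambda>n. n + 1, \<lambda>n. \<one>\<^bsub>K\<^esub>)"
    if "f \<in> hom (G\<lparr>carrier := bb_parabolic W\<rparr>) K" "W \<subseteq> verts \<Gamma>" for f W
  proof -
    have "gen v [^] (- (n + 1)) \<otimes> gen v \<otimes> gen v [^] n = \<one>" for n :: int
    proof -
      have "gen v [^] (- (n + 1)) \<otimes> gen v [^] (1::int) \<otimes> gen v [^] n = \<one>"
        using gen_closed[OF vV] by (simp flip: int_pow_mult del: int_pow_1)
      then show ?thesis using gen_closed[OF vV] by simp
    qed
    then show ?thesis using one[OF that] chi_gen[OF vV] by (simp add: level_map_def)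
  qed
  note agree = this[OF f1 W(1)] this[OF f2 W(2)]
  define u where "u w = (if w \<in> W1 then level_map v f1 (gen w) else if w \<in> W2 then level_map v f2 (gen w) else \<one>\<^bsub>?Wr\<^esub>)" for w
  have u1: "u w = level_map v f1 (gen w)" if "w \<in> W1" for w using that by (simp add: u_def)
  have u2: "u w = level_map v f2 (gen w)" if "w \<in> W2" for w
  proof (cases "w \<in> W1")
    case True
    then have "w = v" using that W(3) by auto
    then show ?thesis using agree v by (simp add: u_def)
  qed (use that in \<open>simp add: u_def\<close>)
  have u_closed: "u w \<in> carrier ?Wr" for w
    using hom_in_carrier[OF h1, of "gen w"] hom_in_carrier[OF h2, of "gen w"] gen_parabolic[of w] by (auto simp: u_def)
  have comm: "level_map v f (gen x) \<otimes>\<^bsub>?Wr\<^esub> level_map v f (gen y) = level_map v f (gen y) \<otimes>\<^bsub>?Wr\<^esub> level_map v f (gen x)"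
    if "level_map v f \<in> hom (G\<lparr>carrier := parabolic U\<rparr>) ?Wr" "x \<in> U" "y \<in> U" "{x, y} \<in> edges \<Gamma>" for f U x y
    using hom_mult[OF that(1), of "gen x" "gen y"] hom_mult[OF that(1), of "gen y" "gen x"] that
      gen_parabolic[of x U] gen_parabolic[of y U] gen_commute[OF that(4)] by simp
  obtain F where F: "F \<in> hom G ?Wr" "\<And>w. w \<in> verts \<Gamma> \<Longrightarrow> F (gen w) = u w"
  proof (rule raag_ext[OF Wr, of u])
    show "u x \<otimes>\<^bsub>?Wr\<^esub> u y = u y \<otimes>\<^bsub>?Wr\<^esub> u x" if xy: "{x, y} \<in> edges \<Gamma>" for x y
    proof -
      consider "x \<in> W1" "y \<in> W1" | "x \<in> W2" "y \<in> W2" | "x \<notin> W1 \<union> W2" | "y \<notin> W1 \<union> W2"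
        | "x \<in> W1 - {v}" "y \<in> W2 - {v}" | "y \<in> W1 - {v}" "x \<in> W2 - {v}" using v by blast
      then show ?thesis
      proof cases
        case 1
        then show ?thesis using comm[OF h1 _ _ xy] by (simp add: u1)
      next
        case 2
        then show ?thesis using comm[OF h2 _ _ xy] by (simp add: u2)
      next
        case 3
        then have "u x = \<one>\<^bsub>?Wr\<^esub>" by (simp add: u_def)
        then show ?thesis using u_closed by simp
      next
        case 4
        then have "u y = \<one>\<^bsub>?Wr\<^esub>" by (simp add: u_def)
        then show ?thesis using u_closed by simp
      next
        case 5
        then show ?thesis using no_edge xy by blast
      next
        case 6
        then show ?thesis using no_edge xy by (metis insert_commute)
      qed
    qed
  qed (use u_closed in auto)
  interpret F: group_hom G ?Wr F by (simp add: group_hom_def group_hom_axioms_def is_group Wr F(1))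
  have agree': "F g = level_map v f g"
    if "level_map v f \<in> hom (G\<lparr>carrier := parabolic U\<rparr>) ?Wr" "U \<subseteq> verts \<Gamma>" "g \<in> parabolic U"
      "\<And>w. w \<in> U \<Longrightarrow> u w = level_map v f (gen w)" for f U g
  proof (rule hom_eq_on_generate[OF subgroup.subgroup_is_group[OF parabolic_subgroup[OF that(2)] is_group] Wr _ that(1)])
    show "F \<in> hom (G\<lparr>carrier := parabolic U\<rparr>) ?Wr" using F(1) parabolic_closed[OF that(2)] by (intro hom_subgroup) auto
    show "gen ` U \<subseteq> carrier (G\<lparr>carrier := parabolic U\<rparr>)" using gen_parabolic by auto
    have "generate (G\<lparr>carrier := parabolic U\<rparr>) (gen ` U) = generate G (gen ` U)"
      using gen_parabolic by (intro generate_consistent parabolic_subgroup that(2)) auto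
    then show "g \<in> generate (G\<lparr>carrier := parabolic U\<rparr>) (gen ` U)" using that(3) by (simp add: parabolic_def)
  qed (use that F(2) in auto)
  have fstF: "fst (F g) = (\<lambda>n. n + chi g)" if "g \<in> parabolic (W1 \<union> W2)" for g
    using that unfolding parabolic_def
  proof (induction rule: generate.induct)
    case one
    then show ?case by (simp add: wreath_simps fun_eq_iff)
  next
    case (incl h)
    then show ?case using W u1 u2 F(2) by (auto simp: level_map_def)
  next
    case (inv h)
    then have h: "fst (F h) = (\<lambda>n. n + chi h)" "h \<in> carrier G" using W u1 u2 F(2) gen_closed by (auto simp: level_map_def)
    have "fst (F h \<otimes>\<^bsub>?Wr\<^esub> F (inv h)) n = n" for n
      using h(2) by (simp add: wreath_simps del: F.hom_inv flip: F.hom_mult)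
    then have "fst (F (inv h)) n + chi h = n" for n using h(1) by (simp only: wreath_simps comp_apply)
    then show ?case using h(2) by (auto simp: fun_eq_iff eq_diff_eq)
  next
    case (eng g h)
    then have "g \<in> carrier G" "h \<in> carrier G"
      using parabolic_closed[of "W1 \<union> W2"] W by (auto simp: parabolic_def)
    then show ?case using eng by (simp add: wreath_simps fun_eq_iff)
  qed
  let ?S = "{g \<in> carrier G. fst (F g) 0 = 0}"
  \<comment> \<open>Elements of exponent sum zero fix every level. Level 0 is singled out because no
    conjugation by \<open>v\<close> takes place there, so the second component returns
    \<open>f1\<close> and \<open>f2\<close> themselves.\<close>
  have bbS: "bb_parabolic (W1 \<union> W2) \<subseteq> ?S"
    using fstF parabolic_closed[of "W1 \<union> W2"] W by (auto simp: bb_parabolic_def)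
  have "(\<lambda>g. snd (F g) 0) \<in> hom (G\<lparr>carrier := ?S\<rparr>) K"
    by (rule wreath_stabilizer(2)[OF is_group K F(1)])
  from hom_subgroup[OF this, of "bb_parabolic (W1 \<union> W2)"]
  have "(\<lambda>g. snd (F g) 0) \<in> hom (G\<lparr>carrier := bb_parabolic (W1 \<union> W2)\<rparr>) K"
    using bbS by simp
  moreover have "snd (F g) 0 = f1 g" if "g \<in> bb_parabolic W1" for g
    using that agree'[OF h1 W(1), of g] u1 parabolic_closed[OF W(1)] by (auto simp: bb_parabolic_def level_map_def)
  moreover have "snd (F g) 0 = f2 g" if "g \<in> bb_parabolic W2" for g
    using that agree'[OF h2 W(2), of g] u2 parabolic_closed[OF W(2)] by (auto simp: bb_parabolic_def level_map_def)
  ultimately show ?thesis using that by blast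
qed

lemma bb_parabolic_conj:
  assumes "W \<subseteq> verts \<Gamma>" "v \<in> W" "g \<in> bb_parabolic W"
  shows "gen v [^] (n::int) \<otimes> g \<otimes> gen v [^] (- n) \<in> bb_parabolic W"
proof -
  have "gen v [^] (k::int) \<in> parabolic W" for k
    using subgroup_int_pow_closed[OF parabolic_subgroup gen_parabolic] assms by blast
  then have "gen v [^] n \<otimes> g \<otimes> gen v [^] (- n) \<in> parabolic W"
    using assms subgroup.m_closed[OF parabolic_subgroup[OF assms(1)]] by (auto simp: bb_parabolic_def)
  moreover have "v \<in> verts \<Gamma>" "g \<in> carrier G" using assms parabolic_closed by (auto simp: bb_parabolic_def)
  ultimately show ?thesis using assms by (simp add: bb_parabolic_def chi_pow gen_closed)
qed

text \<open>Conjugation by powers of \<open>v\<close> preserves both subgroups of exponent sum zero,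
  hence also the subgroup that they generate.\<close>

lemma bb_generate:
  assumes W: "W1 \<subseteq> verts \<Gamma>" "W2 \<subseteq> verts \<Gamma>" "v \<in> W1" "v \<in> W2"
  shows "bb_parabolic (W1 \<union> W2) = generate G (bb_parabolic W1 \<union> bb_parabolic W2)"
proof
  let ?M = "generate G (bb_parabolic W1 \<union> bb_parabolic W2)" and ?t = "gen v"
  have vV: "v \<in> verts \<Gamma>" using W by auto
  have tc: "?t \<in> carrier G" using gen_closed[OF vV] .
  have S: "bb_parabolic W1 \<union> bb_parabolic W2 \<subseteq> carrier G"
    using W parabolic_closed by (auto simp: bb_parabolic_def)
  have M: "subgroup ?M G" by (rule generate_is_subgroup[OF S])
  show "?M \<subseteq> bb_parabolic (W1 \<union> W2)"
  proof (rule generate_subgroup_incl)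
    show "bb_parabolic W1 \<union> bb_parabolic W2 \<subseteq> bb_parabolic (W1 \<union> W2)"
      using parabolic_mono[of W1 "W1 \<union> W2"] parabolic_mono[of W2 "W1 \<union> W2"] by (auto simp: bb_parabolic_def)
  qed (use W in \<open>auto intro: bb_parabolic_subgroup\<close>)
  have conj: "?t [^] n \<otimes> g \<otimes> ?t [^] (- n) \<in> ?M" if "g \<in> ?M" for g and n :: int
  proof -
    interpret c: group_hom G G "\<lambda>g. ?t [^] n \<otimes> g \<otimes> ?t [^] (- n)"
      unfolding group_hom_def group_hom_axioms_def using tc
      by (auto simp: is_group int_pow_neg m_assoc cancel_left intro!: homI)
    have "(\<lambda>g. ?t [^] n \<otimes> g \<otimes> ?t [^] (- n)) ` ?M
        = generate G ((\<lambda>g. ?t [^] n \<otimes> g \<otimes> ?t [^] (- n)) ` (bb_parabolic W1 \<union> bb_parabolic W2))"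
      by (rule c.generate_img[OF S, symmetric])
    also have "\<dots> \<subseteq> ?M"
      using bb_parabolic_conj[OF W(1,3)] bb_parabolic_conj[OF W(2,4)] by (intro mono_generate) auto
    finally show ?thesis using that by auto
  qed
  \<comment> \<open>The factors of a product need not have exponent sum zero; the correction by a
    power of \<open>v\<close> makes an induction over all of the parabolic subgroup
    possible.\<close>
  have main: "g \<otimes> ?t [^] (- chi g) \<in> ?M" if "g \<in> parabolic (W1 \<union> W2)" for g
    using that unfolding parabolic_def
  proof (induction rule: generate.induct)
    case one
    then show ?case by (simp add: generate.one)
  next
    case (incl h)
    then obtain w where w: "w \<in> W1 \<union> W2" "h = gen w" by auto
    then have wV: "w \<in> verts \<Gamma>" using W by auto
    have "gen w \<otimes> ?t [^] (- 1 :: int) \<in> bb_parabolic U" if "w \<in> U" "v \<in> U" "U \<subseteq> verts \<Gamma>" for U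
      using that subgroup.m_closed[OF parabolic_subgroup[OF that(3)]] gen_parabolic[of w U]
        subgroup_int_pow_closed[OF parabolic_subgroup[OF that(3)] gen_parabolic[of v U], of "- 1"] wV vV
      by (simp add: bb_parabolic_def gen_closed chi_gen chi_pow)
    then have "gen w \<otimes> ?t [^] (- 1 :: int) \<in> bb_parabolic W1 \<union> bb_parabolic W2" using w W by auto
    then show ?case using w wV by (auto simp: chi_gen intro: generate.incl)
  next
    case (inv h)
    then obtain w where w: "w \<in> W1 \<union> W2" "h = gen w" by auto
    then have wV: "w \<in> verts \<Gamma>" using W by auto
    have "inv (gen w) \<otimes> ?t [^] (1 :: int) \<in> bb_parabolic U" if "w \<in> U" "v \<in> U" "U \<subseteq> verts \<Gamma>" for U
      using that subgroup.m_closed[OF parabolic_subgroup[OF that(3)]] gen_parabolic[of w U] gen_parabolic[of v U]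
        subgroup.m_inv_closed[OF parabolic_subgroup[OF that(3)]] wV vV
      by (simp add: bb_parabolic_def gen_closed chi_gen)
    then have "inv (gen w) \<otimes> ?t [^] (1 :: int) \<in> bb_parabolic W1 \<union> bb_parabolic W2" using w W by auto
    then show ?case using w wV by (auto simp: chi_gen gen_closed intro: generate.incl)
  next
    case (eng g h)
    then have car: "g \<in> carrier G" "h \<in> carrier G"
      using parabolic_closed[of "W1 \<union> W2"] W by (auto simp: parabolic_def)
    have "(g \<otimes> ?t [^] (- chi g)) \<otimes> (?t [^] chi g \<otimes> (h \<otimes> ?t [^] (- chi h)) \<otimes> ?t [^] (- chi g)) \<in> ?M"
      using eng.IH conj subgroup.m_closed[OF M] by blast
    also have "(g \<otimes> ?t [^] (- chi g)) \<otimes> (?t [^] chi g \<otimes> (h \<otimes> ?t [^] (- chi h)) \<otimes> ?t [^] (- chi g))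
        = g \<otimes> h \<otimes> (?t [^] (- chi h) \<otimes> ?t [^] (- chi g))"
      using car tc by (simp add: int_pow_neg m_assoc cancel_left)
    also have "?t [^] (- chi h) \<otimes> ?t [^] (- chi g) = ?t [^] (- chi (g \<otimes> h))"
      using car tc by (simp add: int_pow_mult[symmetric] add.commute)
    finally show ?case .
  qed
  show "bb_parabolic (W1 \<union> W2) \<subseteq> ?M"
  proof
    fix g assume "g \<in> bb_parabolic (W1 \<union> W2)"
    then show "g \<in> ?M" using main[of g] parabolic_closed[of "W1 \<union> W2" g] W by (auto simp: bb_parabolic_def)
  qed
qed

theorem hereditarily_raag_cut_vertex:
  assumes W: "W1 \<subseteq> verts \<Gamma>" "W2 \<subseteq> verts \<Gamma>" "W1 \<inter> W2 = {v}"
    and no_edge: "\<And>x y. x \<in> W1 - {v} \<Longrightarrow> y \<in> W2 - {v} \<Longrightarrow> {x, y} \<notin> edges \<Gamma>"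
    and IH: "hereditarily_raag W1" "hereditarily_raag W2"
  shows "hereditarily_raag (W1 \<union> W2)"
  unfolding hereditarily_raag_def
proof (intro allI impI)
  fix H assume H: "subgroup H G" "H \<subseteq> bb_parabolic (W1 \<union> W2)"
  let ?B = "bb_parabolic (W1 \<union> W2)"
  let ?G = "G\<lparr>carrier := ?B\<rparr>"
  define A where "A b = (if b then bb_parabolic W1 else bb_parabolic W2)" for b
  have B: "subgroup ?B G" using W by (intro bb_parabolic_subgroup) auto
  have A: "subgroup (A b) G" for b using W bb_parabolic_subgroup by (auto simp: A_def)
  have AB: "A b \<subseteq> ?B" for b
    using parabolic_mono[of W1 "W1 \<union> W2"] parabolic_mono[of W2 "W1 \<union> W2"] by (auto simp: A_def bb_parabolic_def)
  have "is_raag (?G\<lparr>carrier := H\<rparr>)"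
  proof (rule is_raag_free_product_subgroup[where A = A])
    show "group ?G" by (rule subgroup.subgroup_is_group[OF B is_group])
    show "subgroup (A b) ?G" for b using subgroup_incl[OF A B AB] .
    show "subgroup H ?G" using subgroup_incl[OF H(1) B H(2)] .
    have "generate ?G (\<Union>b. A b) = generate G (\<Union>b. A b)" using AB B by (intro generate_consistent) auto
    also have UN: "(\<Union>b. A b) = bb_parabolic W1 \<union> bb_parabolic W2" by (auto simp: A_def split: if_splits)
    also have "generate G \<dots> = ?B" using bb_generate[OF W(1,2), of v] W(3) by auto
    finally show "carrier ?G = generate ?G (\<Union>b. A b)" by (simp add: UN)
    show "is_raag (?G\<lparr>carrier := S\<rparr>)" if S: "subgroup S ?G" "S \<subseteq> A b" for b S
    proof -
      have "subgroup S G" using incl_subgroup[OF B S(1)] .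
      then have "is_raag (G\<lparr>carrier := S\<rparr>)" using IH S(2) by (auto simp: hereditarily_raag_def A_def split: if_splits)
      then show ?thesis by simp
    qed
    fix \<Lambda> :: "(bool \<times> 'a word set set \<times> 'a word set + bool \<times> 'a word set set) sgraph" and f
    assume f: "\<And>b. f b \<in> hom (?G\<lparr>carrier := A b\<rparr>)
      (wreath (raag \<Lambda>) :: (('a word set set \<Rightarrow> 'a word set set) \<times> _) monoid)"
    have "f True \<in> hom (G\<lparr>carrier := bb_parabolic W1\<rparr>) (wreath (raag \<Lambda>))"
      "f False \<in> hom (G\<lparr>carrier := bb_parabolic W2\<rparr>) (wreath (raag \<Lambda>))"
      using f[of True] f[of False] by (simp_all add: A_def)
    from bb_free_product_ext[OF W no_edge group_wreath[OF group_raag] this]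
    obtain F where "F \<in> hom ?G (wreath (raag \<Lambda>) :: (('a word set set \<Rightarrow> 'a word set set) \<times> _) monoid)"
      "\<And>g. g \<in> bb_parabolic W1 \<Longrightarrow> F g = f True g" "\<And>g. g \<in> bb_parabolic W2 \<Longrightarrow> F g = f False g"
      by metis
    then show "\<exists>F\<in>hom ?G (wreath (raag \<Lambda>) :: (('a word set set \<Rightarrow> 'a word set set) \<times> _) monoid).
        \<forall>b. \<forall>a\<in>A b. F a = f b a"
      by (intro bexI[of _ F]) (auto simp: A_def)
  qed
  then show "is_raag (G\<lparr>carrier := H\<rparr>)" by simp
qed

end

section \<open>Induced subgraphs\<close>

text \<open>Trades the isomorphism of edge sets for an embedding in the opposite direction, which
  names the vertices directly.\<close>

lemma has_inducedI:
  assumes \<Gamma>: "simplicial_graph \<Gamma>" and \<Lambda>: "simplicial_graph \<Lambda>"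
    and f: "inj_on f (verts \<Lambda>)" "f ` verts \<Lambda> \<subseteq> verts \<Gamma>"
    and edge: "\<And>x y. x \<in> verts \<Lambda> \<Longrightarrow> y \<in> verts \<Lambda> \<Longrightarrow> {f x, f y} \<in> edges \<Gamma> \<longleftrightarrow> {x, y} \<in> edges \<Lambda>"
  shows "has_induced \<Gamma> \<Lambda>"
proof -
  let ?W = "f ` verts \<Lambda>"
  define g where "g = inv_into (verts \<Lambda>) f"
  have gf: "g ` f ` A = A" if "A \<subseteq> verts \<Lambda>" for A
    using that f(1) unfolding g_def by (simp add: inv_into_image_cancel)
  have fg: "f ` g ` B = B" if "B \<subseteq> ?W" for B
    using that unfolding g_def by (simp add: image_inv_into_cancel)
  have "bij_betw ((`) g) (edges (induced_subgraph \<Gamma> ?W)) (edges \<Lambda>)"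
  proof (rule bij_betw_byWitness[where f' = "(`) f"])
    show "\<forall>e\<in>edges (induced_subgraph \<Gamma> ?W). f ` g ` e = e"
      by (intro ballI fg) (simp add: induced_subgraph_def)
    show "\<forall>e\<in>edges \<Lambda>. g ` f ` e = e"
      using \<Lambda> by (intro ballI gf) (simp add: simplicial_graph_def)
    show "(`) g ` edges (induced_subgraph \<Gamma> ?W) \<subseteq> edges \<Lambda>"
    proof (rule image_subsetI)
      fix e assume e: "e \<in> edges (induced_subgraph \<Gamma> ?W)"
      then have "card e = 2" "e \<subseteq> ?W" "e \<in> edges \<Gamma>" using \<Gamma> by (auto simp: simplicial_graph_def induced_subgraph_def)
      then obtain a b where ab: "e = {a, b}" by (auto simp: card_2_iff)
      with \<open>e \<subseteq> ?W\<close> obtain x y where xy: "x \<in> verts \<Lambda>" "y \<in> verts \<Lambda>" "a = f x" "b = f y" by auto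
      then have "{x, y} \<in> edges \<Lambda>" using edge ab \<open>e \<in> edges \<Gamma>\<close> by auto
      moreover have "g ` e = {x, y}" using gf[of "{x, y}"] xy ab by simp
      ultimately show "g ` e \<in> edges \<Lambda>" by simp
    qed
    show "(`) f ` edges \<Lambda> \<subseteq> edges (induced_subgraph \<Gamma> ?W)"
    proof (rule image_subsetI)
      fix e assume e: "e \<in> edges \<Lambda>"
      then have "card e = 2" and sub: "e \<subseteq> verts \<Lambda>" using \<Lambda> by (auto simp: simplicial_graph_def)
      then obtain x y where "e = {x, y}" by (auto simp: card_2_iff)
      then have "f ` e \<in> edges \<Gamma>" using edge[of x y] e sub by auto
      then show "f ` e \<in> edges (induced_subgraph \<Gamma> ?W)" using sub by (auto simp: induced_subgraph_def)
    qed
  qed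
  moreover have "bij_betw g ?W (verts \<Lambda>)"
    unfolding g_def using f(1) by (simp add: bij_betw_inv_into inj_on_imp_bij_betw)
  ultimately have "isomorphic_graphs (induced_subgraph \<Gamma> ?W) \<Lambda>"
    unfolding isomorphic_graphs_def graph_iso_def by (auto simp: induced_subgraph_def)
  then show ?thesis using f(2) by (auto simp: has_induced_def)
qed

lemma has_inducedE:
  assumes "has_induced \<Gamma> \<Lambda>"
  obtains f where "inj_on f (verts \<Lambda>)" "f ` verts \<Lambda> \<subseteq> verts \<Gamma>"
    "\<And>x y. x \<in> verts \<Lambda> \<Longrightarrow> y \<in> verts \<Lambda> \<Longrightarrow> {f x, f y} \<in> edges \<Gamma> \<longleftrightarrow> {x, y} \<in> edges \<Lambda>"
proof -
  obtain W g where W: "W \<subseteq> verts \<Gamma>" and g: "bij_betw g W (verts \<Lambda>)"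
    and ge: "bij_betw ((`) g) {e \<in> edges \<Gamma>. e \<subseteq> W} (edges \<Lambda>)"
    using assms by (auto simp: has_induced_def isomorphic_graphs_def graph_iso_def induced_subgraph_def)
  define f where "f = inv_into W g"
  have f: "bij_betw f (verts \<Lambda>) W" unfolding f_def by (rule bij_betw_inv_into[OF g])
  have gf: "g (f x) = x" if "x \<in> verts \<Lambda>" for x unfolding f_def using g that by (rule bij_betw_inv_into_right)
  have fg: "f (g x) = x" if "x \<in> W" for x unfolding f_def using g that by (rule bij_betw_inv_into_left)
  have fW: "f x \<in> W" if "x \<in> verts \<Lambda>" for x using f that by (auto simp: bij_betw_def)
  have "{f x, f y} \<in> edges \<Gamma> \<longleftrightarrow> {x, y} \<in> edges \<Lambda>" if xy: "x \<in> verts \<Lambda>" "y \<in> verts \<Lambda>" for x y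
  proof
    assume "{f x, f y} \<in> edges \<Gamma>"
    then have "g ` {f x, f y} \<in> edges \<Lambda>" using ge fW xy unfolding bij_betw_def by blast
    then show "{x, y} \<in> edges \<Lambda>" using gf xy by simp
  next
    assume "{x, y} \<in> edges \<Lambda>"
    then obtain e where e: "e \<in> edges \<Gamma>" "e \<subseteq> W" "{x, y} = g ` e" using ge unfolding bij_betw_def by blast
    have "f ` g ` e = e" using fg e(2) by (force simp: image_image)
    then have "{f x, f y} = e" using e(3) by (metis image_empty image_insert)
    then show "{f x, f y} \<in> edges \<Gamma>" using e by simp
  qed
  moreover have "inj_on f (verts \<Lambda>)" "f ` verts \<Lambda> \<subseteq> verts \<Gamma>" using f W by (auto simp: bij_betw_def)
  ultimately show ?thesis using that by blast
qed

lemma cycle_graph_edge: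
  assumes "i < j" "j < n"
  shows "{i, j} \<in> edges (cycle_graph n) \<longleftrightarrow> j = i + 1 \<or> (i = 0 \<and> j = n - 1)"
proof
  assume "{i, j} \<in> edges (cycle_graph n)"
  then obtain k where k: "k < n" "{i, j} = {k, (k + 1) mod n}" by (auto simp: cycle_graph_def)
  then show "j = i + 1 \<or> (i = 0 \<and> j = n - 1)"
    using assms by (cases "k + 1 = n") (auto simp: doubleton_eq_iff)
next
  assume "j = i + 1 \<or> (i = 0 \<and> j = n - 1)"
  then show "{i, j} \<in> edges (cycle_graph n)"
  proof
    assume "j = i + 1"
    then show ?thesis using assms by (auto simp: cycle_graph_def intro!: exI[of _ i])
  next
    assume "i = 0 \<and> j = n - 1"
    then show ?thesis using assms by (auto simp: cycle_graph_def intro!: exI[of _ j])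
  qed
qed

lemma simplicial_cycle_graph:
  assumes "n \<ge> 2"
  shows "simplicial_graph (cycle_graph n)"
  unfolding simplicial_graph_def
proof
  fix e assume "e \<in> edges (cycle_graph n)"
  then obtain i where i: "i < n" "e = {i, (i + 1) mod n}" by (auto simp: cycle_graph_def)
  then have "i \<noteq> (i + 1) mod n" using assms by (cases "i + 1 = n") auto
  then show "e \<subseteq> verts (cycle_graph n) \<and> card e = 2" using i by (auto simp: cycle_graph_def)
qed

section \<open>Connected chordal graphs without gems and overlapping gems\<close>

locale simplicial =
  fixes \<Gamma> :: "'a sgraph"
  assumes simplicial: "simplicial_graph \<Gamma>"
begin

definition adj where "adj x y \<longleftrightarrow> {x, y} \<in> edges \<Gamma>"

lemma adj_sym: "adj x y \<Longrightarrow> adj y x"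
  by (simp add: adj_def insert_commute)

lemma adj_neq: "adj x y \<Longrightarrow> x \<noteq> y"
  using simplicial by (force simp: adj_def simplicial_graph_def)

lemma adj_verts: "adj x y \<Longrightarrow> x \<in> verts \<Gamma> \<and> y \<in> verts \<Gamma>"
  using simplicial by (force simp: adj_def simplicial_graph_def)

lemma has_induced_adjI:
  assumes "simplicial_graph \<Lambda>" "f ` verts \<Lambda> \<subseteq> verts \<Gamma>" "inj_on f (verts \<Lambda>)"
    "\<And>x y. x \<in> verts \<Lambda> \<Longrightarrow> y \<in> verts \<Lambda> \<Longrightarrow> adj (f x) (f y) \<longleftrightarrow> {x, y} \<in> edges \<Lambda>"
  shows "has_induced \<Gamma> \<Lambda>"
  by (rule has_inducedI[OF simplicial assms(1,3,2) assms(4)[unfolded adj_def]])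

text \<open>A shortest walk from \<open>x\<close> to \<open>y\<close> with interior in \<open>C\<close> closes up to an induced cycle through \<open>v\<close>.\<close>

lemma chordal_walk:
  assumes chordal: "chordal \<Gamma>" and vxy: "adj v x" "adj v y" "\<not> adj x y" "x \<noteq> y"
    and C: "\<And>c. c \<in> C \<Longrightarrow> c \<noteq> v \<and> \<not> adj v c"
    and walk: "\<exists>f m. f 0 = x \<and> f m = y \<and> (\<forall>i<m. adj (f i) (f (Suc i))) \<and> (\<forall>i. 0 < i \<longrightarrow> i < m \<longrightarrow> f i \<in> C)"
  shows False
proof -
  define P where "P m \<longleftrightarrow> (\<exists>f. f 0 = x \<and> f m = y \<and> (\<forall>i<m. adj (f i) (f (Suc i))) \<and> (\<forall>i. 0 < i \<longrightarrow> i < m \<longrightarrow> f i \<in> C))" for m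
  define m where "m = (LEAST m. P m)"
  have "\<exists>m. P m" unfolding P_def using walk by blast
  then have "P m" unfolding m_def by (rule LeastI_ex)
  then obtain f where f: "f 0 = x" "f m = y" "\<And>i. i < m \<Longrightarrow> adj (f i) (f (Suc i))"
    "\<And>i. 0 < i \<Longrightarrow> i < m \<Longrightarrow> f i \<in> C" unfolding P_def by blast
  have least: "m \<le> k" if "P k" for k unfolding m_def using that by (rule Least_le)
  have no_chord: "\<not> adj (f i) (f j)" if ij: "i < j" "j \<le> m" "j \<noteq> i + 1" for i j
  proof
    assume a: "adj (f i) (f j)"
    define d where "d = j - i - 1"
    \<comment> \<open>The chord replaces \<open>j - i\<close> steps of the walk by a single one, and
      the interior stays in \<open>C\<close>.\<close>
    have "P (m - d)"
      unfolding P_def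
    proof (intro exI[of _ "\<lambda>k. if k \<le> i then f k else f (k + d)"] conjI allI impI)
      fix k assume "k < m - d"
      then show "adj (if k \<le> i then f k else f (k + d)) (if Suc k \<le> i then f (Suc k) else f (Suc k + d))"
        using f(3)[of k] f(3)[of "k + d"] ij a by (cases "k = i") (auto simp: d_def)
    qed (use f ij in \<open>auto simp: d_def\<close>)
    then have "m \<le> m - d" by (rule least)
    then show False using ij by (auto simp: d_def)
  qed
  have distinct: "f i \<noteq> f j" if ij: "i < j" "j \<le> m" for i j
  proof
    assume a: "f i = f j"
    define d where "d = j - i"
    have "P (m - d)"
      unfolding P_def
    proof (intro exI[of _ "\<lambda>k. if k \<le> i then f k else f (k + d)"] conjI allI impI)
      fix k assume "k < m - d"
      then show "adj (if k \<le> i then f k else f (k + d)) (if Suc k \<le> i then f (Suc k) else f (Suc k + d))"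
        using f(3)[of k] f(3)[of "k + d"] ij a by (cases "k = i") (auto simp: d_def)
    next
      \<comment> \<open>For \<open>j = m\<close> the shortened walk ends at index \<open>i\<close>,
        where \<open>f i = f m\<close>.\<close>
      show "(if m - d \<le> i then f (m - d) else f (m - d + d)) = y"
        using f(2) ij a by (cases "j = m") (auto simp: d_def)
    qed (use f ij in \<open>auto simp: d_def\<close>)
    then have "m \<le> m - d" by (rule least)
    then show False using ij by (auto simp: d_def)
  qed
  have "m \<noteq> 0" using f vxy by (metis)
  moreover have "m \<noteq> 1" using f(1,2) f(3)[of 0] vxy by auto
  ultimately have m: "m \<ge> 2" by simp
  \<comment> \<open>The vertex \<open>v\<close> is appended at index \<open>m + 1\<close> and closes
    the walk; \<open>m \<ge> 2\<close> gives a cycle of length at least 4.\<close>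
  define g where "g k = (if k \<le> m then f k else v)" for k
  have adj_g: "adj (g i) (g j) \<longleftrightarrow> j = i + 1 \<or> (i = 0 \<and> j = m + 1)" if ij: "i < j" "j < m + 2" for i j
  proof (cases "j \<le> m")
    case True
    then show ?thesis using no_chord[of i j] f(3)[of i] ij m by (auto simp: g_def)
  next
    case False
    then have "j = m + 1" "i \<le> m" using ij by auto
    moreover have "\<not> adj (f i) v" if "0 < i" "i < m" using C[OF f(4)[OF that]] adj_sym by blast
    ultimately show ?thesis using vxy f(1,2) adj_sym ij by (cases "i = 0"; cases "i = m") (auto simp: g_def)
  qed
  have neq_g: "g i \<noteq> g j" if ij: "i < j" "j < m + 2" for i j
  proof (cases "j \<le> m")
    case True
    then show ?thesis using distinct[of i j] ij by (auto simp: g_def)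
  next
    case False
    then have "j = m + 1" "i \<le> m" using ij by auto
    moreover have "f i \<noteq> v"
      using vxy f(1,2) adj_neq C f(4)[of i] \<open>i \<le> m\<close> by (cases "i = 0"; cases "i = m") auto
    ultimately show ?thesis by (auto simp: g_def)
  qed
  have "has_induced \<Gamma> (cycle_graph (m + 2))"
  proof (rule has_induced_adjI)
    show "simplicial_graph (cycle_graph (m + 2))" by (rule simplicial_cycle_graph) simp
    show "inj_on g (verts (cycle_graph (m + 2)))"
      using neq_g by (auto simp: cycle_graph_def inj_on_def) (metis linorder_neqE_nat)
    have "g i \<in> verts \<Gamma>" if "i < m + 2" for i
      using adj_g[of i "i + 1"] adj_g[of 0 i] that adj_verts by (cases "i + 1 < m + 2") fastforce+
    then show "g ` verts (cycle_graph (m + 2)) \<subseteq> verts \<Gamma>" by (auto simp: cycle_graph_def)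
    fix i j assume "i \<in> verts (cycle_graph (m + 2))" "j \<in> verts (cycle_graph (m + 2))"
    then have ij: "i < m + 2" "j < m + 2" by (auto simp: cycle_graph_def)
    consider "i < j" | "j < i" | "i = j" by linarith
    then show "adj (g i) (g j) \<longleftrightarrow> {i, j} \<in> edges (cycle_graph (m + 2))"
    proof cases
      case 1
      then show ?thesis using adj_g[of i j] cycle_graph_edge[of i j "m + 2"] ij by simp
    next
      case 2
      then have "adj (g j) (g i) \<longleftrightarrow> {j, i} \<in> edges (cycle_graph (m + 2))"
        using adj_g[of j i] cycle_graph_edge[of j i "m + 2"] ij by simp
      then show ?thesis using adj_sym by (metis insert_commute)
    next
      case 3
      have "{i} \<notin> edges (cycle_graph (m + 2))"
        using simplicial_cycle_graph[of "m + 2"] by (force simp: simplicial_graph_def)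
      then show ?thesis using 3 adj_neq by auto
    qed
  qed
  then show False using chordal m unfolding chordal_def by (metis add_2_eq_Suc' add_le_mono1 numeral_Bit0 one_add_one)
qed

section \<open>Simplicial vertices of chordal graphs\<close>

definition simplicial_vertex where
  "simplicial_vertex W s \<longleftrightarrow> s \<in> W \<and> (\<forall>x\<in>W. \<forall>y\<in>W. adj s x \<longrightarrow> adj s y \<longrightarrow> x \<noteq> y \<longrightarrow> adj x y)"

text \<open>Dirac's argument: a component \<open>C\<close> of the non-neighbours of \<open>v\<close>
  is separated from the rest by a clique \<open>S\<close> of neighbours of \<open>v\<close>.
  Avoiding a prescribed vertex and its neighbours is what lets the induction hypothesis land beyond
  the clique.\<close>

lemma simplicial_vertex_avoiding:
  assumes chordal: "chordal \<Gamma>"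
  shows "finite W \<Longrightarrow> W \<subseteq> verts \<Gamma> \<Longrightarrow> v \<in> W \<Longrightarrow> \<exists>c\<in>W. c \<noteq> v \<and> \<not> adj v c \<Longrightarrow>
    \<exists>s. simplicial_vertex W s \<and> s \<noteq> v \<and> \<not> adj v s"
proof (induction "card W" arbitrary: W v rule: less_induct)
  case less
  define D where "D = {c \<in> W. c \<noteq> v \<and> \<not> adj v c}"
  define R where "R = {(a, b). a \<in> D \<and> b \<in> D \<and> adj a b}"
  obtain c0 where c0: "c0 \<in> D" using less.prems by (auto simp: D_def)
  define C where "C = {c. (c0, c) \<in> R\<^sup>*}"
  have "sym R" using adj_sym by (auto simp: R_def sym_def)
  then have symR: "sym (R\<^sup>*)" by (rule sym_rtrancl)
  have CD: "C \<subseteq> D"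
  proof
    fix c assume "c \<in> C"
    then have "(c0, c) \<in> R\<^sup>*" by (simp add: C_def)
    then show "c \<in> D" by (induction rule: rtrancl_induct) (auto simp: c0 R_def)
  qed
  have C_step: "b \<in> C" if "a \<in> C" "b \<in> D" "adj a b" for a b
  proof -
    have "(a, b) \<in> R" using that CD by (auto simp: R_def)
    then show ?thesis using that(1) unfolding C_def by (auto intro: rtrancl_into_rtrancl)
  qed
  define S where "S = {x \<in> W - C. \<exists>c\<in>C. adj c x}"
  have Sv: "adj v x" if "x \<in> S" for x
  proof -
    have x: "x \<in> W" "x \<notin> C" "\<exists>c\<in>C. adj c x" using that by (simp_all add: S_def)
    then obtain c where c: "c \<in> C" "adj c x" by blast
    then have "x \<notin> D" using C_step x(2) by blast
    moreover have "x \<noteq> v" using c CD adj_sym by (auto simp: D_def)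
    ultimately show ?thesis using x(1) by (auto simp: D_def)
  qed
  have clique: "adj x y" if x: "x \<in> S" and y: "y \<in> S" and "x \<noteq> y" for x y
  proof (rule ccontr)
    assume "\<not> adj x y"
    obtain c1 c2 where c: "c1 \<in> C" "adj c1 x" "c2 \<in> C" "adj c2 y" using x y by (auto simp: S_def)
    have "(c1, c2) \<in> R\<^sup>*" using c symR unfolding C_def by (auto dest: symD intro: rtrancl_trans)
    then obtain n where "(c1, c2) \<in> R ^^ n" using rtrancl_imp_relpow by blast
    then obtain h where h: "h 0 = c1" "h n = c2" "\<And>i. i < n \<Longrightarrow> (h i, h (Suc i)) \<in> R"
      unfolding relpow_fun_conv by blast
    have hC: "h i \<in> C" if "i \<le> n" for i
      using that
    proof (induction i)
      case (Suc i)
      then show ?case using h(3)[of i] C_step[of "h i" "h (Suc i)"] by (auto simp: R_def)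
    qed (use c h in simp)
    \<comment> \<open>Two nonadjacent vertices of \<open>S\<close> are joined by a walk through
      \<open>C\<close>, which \<open>chordal_walk\<close> excludes.\<close>
    define f where "f k = (if k = 0 then x else if k \<le> n + 1 then h (k - 1) else y)" for k
    have "f 0 = x" "f (n + 2) = y" by (auto simp: f_def)
    moreover have "adj (f i) (f (Suc i))" if i: "i < n + 2" for i
    proof -
      consider "i = 0" | "0 < i" "i < n + 1" | "i = n + 1" using i by linarith
      then show ?thesis
      proof cases
        case 2
        then show ?thesis using h(3)[of "i - 1"] by (auto simp: f_def R_def)
      qed (use c h adj_sym in \<open>auto simp: f_def\<close>)
    qed
    moreover have "f i \<in> C" if "0 < i" "i < n + 2" for i using that hC by (auto simp: f_def)
    ultimately have "\<exists>f m. f 0 = x \<and> f m = y \<and> (\<forall>i<m. adj (f i) (f (Suc i))) \<and> (\<forall>i. 0 < i \<longrightarrow> i < m \<longrightarrow> f i \<in> C)"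
      by blast
    then show False
      using chordal_walk[OF chordal Sv[OF x] Sv[OF y] \<open>\<not> adj x y\<close> \<open>x \<noteq> y\<close>, of C] CD by (auto simp: D_def)
  qed
  let ?W = "C \<union> S"
  have WW: "?W \<subseteq> W" using CD by (auto simp: D_def S_def)
  moreover have "v \<notin> ?W" using CD Sv adj_neq by (auto simp: D_def)
  ultimately have "?W \<subset> W" using less.prems by auto
  then have card_W: "card ?W < card W" using less.prems by (simp add: psubset_card_mono)
  moreover have "C \<subseteq> ?W" by auto
  ultimately have card_C: "card C < card W" using WW less.prems by (meson card_mono finite_subset le_less_trans)
  have fin: "finite ?W" "finite C" using WW less.prems finite_subset by auto
  \<comment> \<open>The vertex must lie in \<open>C\<close>, since only then do all its neighbours
    in \<open>W\<close> lie in \<open>C \<union> S\<close>. If some \<open>x\<close> in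
    \<open>S\<close> misses a vertex of this set, the induction hypothesis for \<open>x\<close>
    avoids the whole clique \<open>S\<close>; otherwise each vertex of \<open>S\<close> is adjacent
    to all others, and a simplicial vertex of \<open>C\<close> suffices.\<close>
  have "\<exists>s\<in>C. simplicial_vertex ?W s"
  proof (cases "\<exists>x\<in>S. \<exists>c\<in>?W. c \<noteq> x \<and> \<not> adj x c")
    case True
    then obtain x where x: "x \<in> S" "\<exists>c\<in>?W. c \<noteq> x \<and> \<not> adj x c" by blast
    then obtain s where "simplicial_vertex ?W s" "s \<noteq> x" "\<not> adj x s"
      using less.hyps[OF card_W fin(1), of x] WW less.prems by auto
    moreover from this have "s \<notin> S" using clique x by auto
    ultimately show ?thesis by (auto simp: simplicial_vertex_def)
  next
    case False
    have "\<exists>s. simplicial_vertex C s"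
    proof (cases "\<exists>x\<in>C. \<exists>c\<in>C. c \<noteq> x \<and> \<not> adj x c")
      case True
      then obtain x where x: "x \<in> C" "\<exists>c\<in>C. c \<noteq> x \<and> \<not> adj x c" by blast
      then show ?thesis using less.hyps[OF card_C fin(2), of x] WW less.prems by auto
    next
      case False
      have "c0 \<in> C" by (simp add: C_def)
      then show ?thesis using False by (auto simp: simplicial_vertex_def intro!: exI[of _ c0])
    qed
    then obtain s where "simplicial_vertex C s" by blast
    then have "simplicial_vertex ?W s"
      using False adj_sym unfolding simplicial_vertex_def by (metis UnE UnI1)
    then show ?thesis using \<open>simplicial_vertex C s\<close> by (auto simp: simplicial_vertex_def)
  qed
  then obtain s where s: "s \<in> C" "simplicial_vertex ?W s" by blast
  have "simplicial_vertex W s"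
    unfolding simplicial_vertex_def
  proof (intro conjI ballI impI)
    show "s \<in> W" using s WW by auto
    fix x y assume xy: "x \<in> W" "y \<in> W" "adj s x" "adj s y" "x \<noteq> y"
    then have "x \<in> ?W" "y \<in> ?W" using s(1) by (auto simp: S_def)
    then show "adj x y" using s(2) xy by (auto simp: simplicial_vertex_def)
  qed
  then show ?case using s CD by (auto simp: D_def)
qed

lemma ex_simplicial_vertex:
  assumes "chordal \<Gamma>" "finite W" "W \<subseteq> verts \<Gamma>" "W \<noteq> {}"
  shows "\<exists>s. simplicial_vertex W s"
proof (cases "\<exists>v\<in>W. \<exists>c\<in>W. c \<noteq> v \<and> \<not> adj v c")
  case True
  then show ?thesis using simplicial_vertex_avoiding[OF assms(1-3)] by blast
next
  case False
  obtain w where "w \<in> W" using assms(4) by blast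
  moreover have "adj x y" if xy: "x \<in> W" "y \<in> W" "x \<noteq> y" for x y
  proof (rule ccontr)
    assume "\<not> adj x y"
    then have "\<exists>c\<in>W. c \<noteq> x \<and> \<not> adj x c" using xy by (intro bexI[of _ y]) auto
    then show False using False xy(1) by blast
  qed
  ultimately have "simplicial_vertex W w" by (simp add: simplicial_vertex_def)
  then show ?thesis ..
qed

text \<open>Connectedness by cuts and not by walks, so that deleting a vertex or splitting at one
  becomes an argument about a single crossing edge.\<close>

definition conn where
  "conn W \<longleftrightarrow> (\<forall>U. U \<subseteq> W \<longrightarrow> U \<noteq> {} \<longrightarrow> U \<noteq> W \<longrightarrow> (\<exists>x\<in>U. \<exists>y\<in>W - U. adj x y))"

lemma connD: "conn W \<Longrightarrow> U \<subseteq> W \<Longrightarrow> U \<noteq> {} \<Longrightarrow> U \<noteq> W \<Longrightarrow> \<exists>x\<in>U. \<exists>y\<in>W - U. adj x y"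
  by (simp add: conn_def)

definition dominating where "dominating W u \<longleftrightarrow> u \<in> W \<and> (\<forall>w\<in>W. w \<noteq> u \<longrightarrow> adj u w)"

text \<open>Neighbours of a simplicial vertex are adjacent to each other, so a passage through it
  can be bypassed.\<close>

lemma conn_delete_simplicial:
  assumes "simplicial_vertex W s" "conn W"
  shows "conn (W - {s})"
  unfolding conn_def
proof (intro allI impI)
  fix U assume U: "U \<subseteq> W - {s}" "U \<noteq> {}" "U \<noteq> W - {s}"
  show "\<exists>x\<in>U. \<exists>y\<in>W - {s} - U. adj x y"
  proof (rule ccontr)
    assume no: "\<not> (\<exists>x\<in>U. \<exists>y\<in>W - {s} - U. adj x y)"
    obtain x where x: "x \<in> U" "adj x s" using connD[OF assms(2), of U] U no assms(1) by (auto simp: simplicial_vertex_def)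
    obtain y z where y: "y \<in> insert s U" "z \<in> W - insert s U" "adj y z"
      using connD[OF assms(2), of "insert s U"] U assms(1) by (auto simp: simplicial_vertex_def)
    then have "adj s z" using no by auto
    then have "adj x z" using assms(1) x y U adj_sym unfolding simplicial_vertex_def by blast
    then show False using no x y by auto
  qed
qed

text \<open>The path is \<open>a\<close>, \<open>b\<close>, \<open>d\<close>, \<open>e\<close> and
  the apex is \<open>c\<close>. Distinctness of the vertices follows from the pattern of adjacencies
  and non-adjacencies, here and in the next definition.\<close>

definition gem_free where
  "gem_free \<longleftrightarrow> (\<forall>a b d e c. adj a b \<longrightarrow> adj b d \<longrightarrow> adj d e \<longrightarrow> \<not> adj a d \<longrightarrow> \<not> adj a e \<longrightarrow> \<not> adj b e \<longrightarrow>
     adj c a \<longrightarrow> adj c b \<longrightarrow> adj c d \<longrightarrow> \<not> adj c e)"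

definition overlapping_gems_free where
  "overlapping_gems_free \<longleftrightarrow> (\<forall>a b c d e f. adj b c \<longrightarrow> adj b e \<longrightarrow> adj b f \<longrightarrow> adj c e \<longrightarrow> adj c f \<longrightarrow> adj e f \<longrightarrow>
     adj a b \<longrightarrow> adj a f \<longrightarrow> adj d c \<longrightarrow> adj d e \<longrightarrow> \<not> adj a c \<longrightarrow> \<not> adj a e \<longrightarrow> \<not> adj a d \<longrightarrow>
     \<not> adj d b \<longrightarrow> adj d f)"

text \<open>After deletion of a simplicial vertex \<open>s\<close> the rest has two dominating
  vertices by induction. As \<open>s\<close> has two neighbours, either two vertices dominate all of
  \<open>W\<close>, or a vertex missed by a neighbour of \<open>s\<close> completes a forbidden
  subgraph.\<close>

lemma two_dominating:
  assumes chordal: "chordal \<Gamma>" and free: gem_free overlapping_gems_free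
  shows "finite W \<Longrightarrow> W \<subseteq> verts \<Gamma> \<Longrightarrow> card W \<ge> 2 \<Longrightarrow> conn W \<Longrightarrow> (\<And>x. x \<in> W \<Longrightarrow> conn (W - {x})) \<Longrightarrow>
    \<exists>u v. u \<noteq> v \<and> dominating W u \<and> dominating W v"
proof (induction "card W" arbitrary: W rule: less_induct)
  case less
  have "W \<noteq> {}" using less.prems by auto
  then obtain s where s: "simplicial_vertex W s" using ex_simplicial_vertex[OF chordal less.prems(1,2)] by blast
  then have sW: "s \<in> W" by (simp add: simplicial_vertex_def)
  let ?W = "W - {s}"
  have card: "card ?W = card W - 1" using sW less.prems by simp
  have "W \<noteq> {s}" using less.prems by auto
  then obtain k1 where k1: "k1 \<in> W" "adj s k1"
    using connD[OF less.prems(4), of "{s}"] sW by auto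
  show ?case
  proof (cases "card W = 2")
    case True
    then have "card ?W = 1" using card by simp
    then obtain w where w: "?W = {w}" by (auto simp: card_1_singleton_iff)
    have "k1 \<in> ?W" using k1 adj_neq[OF k1(2)] by simp
    then have "?W = {k1}" using w by (metis singletonD)
    then have "W = {s, k1}" using insert_Diff[OF sW] by simp
    then show ?thesis
      using k1(2) adj_sym[OF k1(2)] adj_neq[OF k1(2)] by (intro exI[of _ s] exI[of _ k1]) (simp add: dominating_def)
  next
    case False
    have card': "card ?W < card W" "card ?W \<ge> 2" using card False less.prems by auto
    \<comment> \<open>The vertex \<open>s\<close> remains simplicial when \<open>x\<close> is
      deleted, so deleting \<open>s\<close> afterwards keeps the graph connected.\<close>
    have conn': "conn (?W - {x})" if "x \<in> ?W" for x
    proof -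
      have "simplicial_vertex (W - {x}) s" using s that by (auto simp: simplicial_vertex_def)
      moreover have "conn (W - {x})" using less.prems(5) that by blast
      ultimately have "conn (W - {x} - {s})" by (rule conn_delete_simplicial)
      moreover have "W - {x} - {s} = ?W - {x}" by auto
      ultimately show ?thesis by simp
    qed
    have "\<exists>u v. u \<noteq> v \<and> dominating ?W u \<and> dominating ?W v"
    proof (rule less.hyps[OF card'(1) _ _ card'(2) conn_delete_simplicial[OF s less.prems(4)]])
      show "finite ?W" "?W \<subseteq> verts \<Gamma>" using less.prems(1,2) by auto
    qed (rule conn')
    then obtain e1 e2 where e: "e1 \<noteq> e2" "dominating ?W e1" "dominating ?W e2" by blast
    \<comment> \<open>A single neighbour \<open>k1\<close> of \<open>s\<close> would be a cut
      vertex; hence there is a second neighbour \<open>k2\<close>.\<close>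
    have "W - {k1} \<noteq> {s}"
    proof
      assume "W - {k1} = {s}"
      then have "W = {s, k1}" using insert_Diff[OF k1(1)] by auto
      then show False using False less.prems(3) adj_neq[OF k1(2)] by simp
    qed
    then obtain k2 where k2: "k2 \<in> W" "adj s k2" "k2 \<noteq> k1"
      using connD[OF less.prems(5)[OF k1(1)], of "{s}"] sW adj_neq[OF k1(2)] by auto
    have clique: "adj x y" if "x \<in> W" "y \<in> W" "adj s x" "adj s y" "x \<noteq> y" for x y
      using s that by (auto simp: simplicial_vertex_def)
    have dom: "adj x w" if "dominating ?W x" "w \<in> W" "w \<noteq> s" "w \<noteq> x" for x w
      using that by (auto simp: dominating_def)
    have domW: "x \<in> W" "x \<noteq> s" if "dominating ?W x" for x using that by (auto simp: dominating_def)
    have dom_W: "dominating W x" if "dominating ?W x" "adj s x" for x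
      using that adj_sym[OF that(2)] by (auto simp: dominating_def)
    have kW: "k1 \<noteq> s" "k2 \<noteq> s" using adj_neq[OF k1(2)] adj_neq[OF k2(2)] by auto
    have far: "\<not> adj s y" if "y \<in> W" "x \<in> W" "adj s x" "\<not> adj x y" "x \<noteq> y" for x y
      using clique that by blast
    show ?thesis
    proof (cases "\<exists>c. dominating ?W c \<and> adj s c")
      case True
      then obtain c where c: "dominating ?W c" "adj s c" by blast
      obtain e where e': "e \<noteq> c" "dominating ?W e" using e by metis
      obtain k where k: "k \<noteq> c" "k \<in> W" "adj s k" "k \<noteq> s" using k1 k2 kW by metis
      show ?thesis
      proof (cases "dominating ?W k \<or> adj s e")
        case True
        then show ?thesis using dom_W c k e' by metis
      next
        case False
        then obtain y where y: "y \<in> W" "y \<noteq> s" "y \<noteq> k" "\<not> adj k y" using k by (auto simp: dominating_def)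
        have ke: "adj k e" using dom[OF e'(2) k(2,4)] False k adj_sym by metis
        have kc: "adj k c" using dom[OF c(1) k(2,4,1)] adj_sym by blast
        have "adj e y" using dom[OF e'(2) y(1,2)] y ke by metis
        moreover have "adj c y" using dom[OF c(1) y(1,2)] y kc by metis
        moreover have "adj c e" using dom[OF c(1)] domW[OF e'(2)] e' by blast
        \<comment> \<open>A gem on the path \<open>s\<close>, \<open>k\<close>, \<open>e\<close>,
          \<open>y\<close> with apex \<open>c\<close>.\<close>
        ultimately show ?thesis
          using free(1)[unfolded gem_free_def, rule_format, of s k e y c]
            k ke kc c False y far[OF y(1) k(2,3) y(4)] adj_sym by blast
      qed
    next
      case False
      then have ne: "\<not> adj s e1" "\<not> adj s e2" "\<not> dominating ?W k1" using e k1 by auto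
      then obtain y where y: "y \<in> W" "y \<noteq> s" "y \<noteq> k1" "\<not> adj k1 y" using k1 kW by (auto simp: dominating_def)
      have ek: "adj e1 k1" "adj e1 k2" "adj e2 k1" "adj e2 k2"
        using dom e k1 k2 kW ne by metis+
      have ey: "adj e1 y" "adj e2 y" using dom e y ek adj_sym by metis+
      have ee: "adj e1 e2" using dom[OF e(2)] domW[OF e(3)] e(1) by blast
      have sy: "\<not> adj s y" using far[OF y(1) k1 y(4)] y by blast
      have kk: "adj k1 k2" using clique[OF k1(1) k2(1) k1(2) k2(2)] k2(3) by simp
      show ?thesis
      proof (cases "adj k2 y")
        case True
        \<comment> \<open>A gem on the path \<open>s\<close>, \<open>k1\<close>, \<open>e1\<close>,
          \<open>y\<close> with apex \<open>k2\<close>.\<close>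
        then show ?thesis using free(1)[unfolded gem_free_def, rule_format, of s k1 e1 y k2] k1 k2 ek ey ne sy y kk adj_sym by blast
      next
        case False
        \<comment> \<open>Overlapping gems: \<open>k1\<close>, \<open>e1\<close>, \<open>e2\<close>,
          \<open>k2\<close> span the complete graph, \<open>s\<close> sees only \<open>k1\<close>
          and \<open>k2\<close> in it, and \<open>y\<close> sees only \<open>e1\<close> and
          \<open>e2\<close>.\<close>
        then show ?thesis
          using free(2)[unfolded overlapping_gems_free_def, rule_format, of k1 e1 e2 k2 s y] ek ee kk k1 k2 ey ne sy y adj_sym by blast
      qed
    qed
  qed
qed

text \<open>Edges that leave \<open>U\<close> inside \<open>W\<close> can only end in
  \<open>x\<close>. Of the two sides of a cut, the one without \<open>x\<close> lies in
  \<open>U\<close>, so an edge leaving it in \<open>W\<close> stays in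
  \<open>insert x U\<close>.\<close>

lemma conn_split:
  assumes W: "conn W" "x \<in> W" and U: "U \<subseteq> W - {x}" "\<And>a b. a \<in> U \<Longrightarrow> b \<in> W - {x} - U \<Longrightarrow> \<not> adj a b"
  shows "conn (insert x U)"
  unfolding conn_def
proof (intro allI impI)
  fix T assume T: "T \<subseteq> insert x U" "T \<noteq> {}" "T \<noteq> insert x U"
  show "\<exists>a\<in>T. \<exists>b\<in>insert x U - T. adj a b"
  proof (cases "x \<in> T")
    case False
    then have "T \<subseteq> W" "T \<noteq> W" using T(1) U(1) W(2) by auto
    then obtain a b where ab: "a \<in> T" "b \<in> W - T" "adj a b" using connD[OF W(1) _ T(2)] by blast
    then have "b \<in> insert x U" using U(2)[of a b] T False by auto
    then show ?thesis using ab by blast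
  next
    case True
    let ?T = "insert x U - T"
    have "?T \<subseteq> W" "?T \<noteq> {}" "?T \<noteq> W" using T True U W by auto
    then obtain a b where ab: "a \<in> ?T" "b \<in> W - ?T" "adj a b" using connD[OF W(1)] by blast
    then have "b \<in> insert x U" using U(2)[of a b] True by auto
    then show ?thesis using ab adj_sym by blast
  qed
qed

lemma conn_verts: "connected_graph \<Gamma> \<Longrightarrow> conn (verts \<Gamma>)"
  unfolding conn_def
proof (intro allI impI)
  fix U assume c: "connected_graph \<Gamma>" and U: "U \<subseteq> verts \<Gamma>" "U \<noteq> {}" "U \<noteq> verts \<Gamma>"
  then obtain u w where uw: "u \<in> U" "w \<in> verts \<Gamma> - U" by blast
  then have "(u, w) \<in> {(x, y). {x, y} \<in> edges \<Gamma>}\<^sup>*" using c U by (auto simp: connected_graph_def)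
  then have "w \<in> U \<or> (\<exists>x\<in>U. \<exists>y\<in>verts \<Gamma> - U. adj x y)"
  proof (induction rule: rtrancl_induct)
    case (step y z)
    then have "adj y z" by (simp add: adj_def)
    then show ?case using step adj_verts by blast
  qed (use uw in simp)
  then show "\<exists>x\<in>U. \<exists>y\<in>verts \<Gamma> - U. adj x y" using uw by blast
qed

end

section \<open>The induction over connected vertex sets\<close>

sublocale simplicial_raag \<subseteq> graph: simplicial \<Gamma>
  by (simp add: simplicial_def simplicial)

lemma (in simplicial_raag) hereditarily_raag_chordal:
  assumes chordal: "chordal \<Gamma>" and free: graph.gem_free graph.overlapping_gems_free
  shows "finite W \<Longrightarrow> W \<subseteq> verts \<Gamma> \<Longrightarrow> graph.conn W \<Longrightarrow> hereditarily_raag W"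
proof (induction "card W" arbitrary: W rule: less_induct)
  case less
  show ?case
  proof (cases "card W \<ge> 2")
    case False
    then have "card W = 0 \<or> card W = 1" by auto
    then obtain v where "W \<subseteq> {v}" using less.prems(1) by (auto simp: card_1_singleton_iff)
    then show ?thesis using less.prems(2) by (rule hereditarily_raag_small)
  next
    case True
    show ?thesis
    proof (cases "\<forall>x\<in>W. graph.conn (W - {x})")
      case no_cut: True
      obtain u v where uv: "u \<noteq> v" "graph.dominating W u" "graph.dominating W v"
        using graph.two_dominating[OF chordal free less.prems(1,2) True less.prems(3)] no_cut by blast
      then have W: "u \<in> W" "v \<in> W" by (auto simp: graph.dominating_def)
      have "card (W - {v}) < card W" using less.prems(1) W(2) by (rule card_Diff1_less)
      then have "hereditarily_raag (W - {v})"
        using less.prems(1,2) no_cut W(2) by (intro less.hyps) auto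
      then show ?thesis
        using uv by (intro hereditarily_raag_two_dominating[OF less.prems(2) W uv(1)])
          (auto simp: graph.dominating_def graph.adj_def)
    next
      case False
      then obtain x where x: "x \<in> W" and "\<not> graph.conn (W - {x})" by blast
      then obtain U where U: "U \<subseteq> W - {x}" "U \<noteq> {}" "U \<noteq> W - {x}"
        and no: "\<And>a b. a \<in> U \<Longrightarrow> b \<in> W - {x} - U \<Longrightarrow> \<not> graph.adj a b"
        unfolding graph.conn_def by blast
      let ?V = "W - {x} - U"
      have no': "\<not> graph.adj a b" if "a \<in> ?V" "b \<in> W - {x} - ?V" for a b
        using no[of b a] that graph.adj_sym[of a b] by auto
      have c1: "graph.conn (insert x U)" by (rule graph.conn_split[OF less.prems(3) x U(1) no])
      have c2: "graph.conn (insert x ?V)" by (rule graph.conn_split[OF less.prems(3) x _ no']) auto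
      have W: "insert x U \<union> insert x ?V = W" using U x by auto
      have sub: "insert x U \<subset> W" "insert x ?V \<subset> W" using U x by auto
      have card: "card (insert x U) < card W" "card (insert x ?V) < card W"
        by (rule psubset_card_mono[OF less.prems(1) sub(1)], rule psubset_card_mono[OF less.prems(1) sub(2)])
      have IH: "hereditarily_raag (insert x U)" "hereditarily_raag (insert x ?V)"
        using less.hyps[OF card(1) _ _ c1] less.hyps[OF card(2) _ _ c2] sub less.prems(1,2)
        by (meson finite_subset psubset_imp_subset subset_trans)+
      have "hereditarily_raag (insert x U \<union> insert x ?V)"
      proof (rule hereditarily_raag_cut_vertex[OF _ _ _ _ IH])
        show "insert x U \<inter> insert x ?V = {x}" using U by auto
        show "{a, b} \<notin> edges \<Gamma>" if "a \<in> insert x U - {x}" "b \<in> insert x ?V - {x}" for a b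
          using no[of a b] that by (auto simp: graph.adj_def)
      qed (use sub less.prems(2) in auto)
      then show ?thesis by (simp only: W)
    qed
  qed
qed

section \<open>Subgroups with torsion in the abelianization\<close>

text \<open>The sign at \<open>x\<close> is a homomorphism on the stabilizer with value -1 at
  \<open>g\<close>; in a right-angled Artin group it would lift to the integers, where every
  homomorphism kills \<open>g\<close>.\<close>

lemma not_raag_stabilizer:
  assumes G: "group G" and \<Theta>: "\<Theta> \<in> hom G (wreath sign_group)"
    and g: "g \<in> carrier G" "fst (\<Theta> g) x = x" "snd (\<Theta> g) x = - 1"
    and torsion: "\<And>\<psi>. \<psi> \<in> hom (G\<lparr>carrier := {g \<in> carrier G. fst (\<Theta> g) x = x}\<rparr>) integer_group \<Longrightarrow> \<psi> g = 0"
  shows "\<exists>H. subgroup H G \<and> \<not> is_raag (G\<lparr>carrier := H\<rparr>)"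
proof -
  let ?H = "{g \<in> carrier G. fst (\<Theta> g) x = x}"
  have "\<not> is_raag (G\<lparr>carrier := ?H\<rparr>)"
    using raag_sign_trivial[of "G\<lparr>carrier := ?H\<rparr>" g "\<lambda>g. snd (\<Theta> g) x"]
      wreath_stabilizer(2)[OF G group_sign_group \<Theta>, of x] g torsion by auto
  then show ?thesis using wreath_stabilizer(1)[OF G group_sign_group \<Theta>, of x] by blast
qed

lemma (in group) inv_commute:
  assumes "x \<in> carrier G" "y \<in> carrier G" "x \<otimes> y = y \<otimes> x"
  shows "inv x \<otimes> y = y \<otimes> inv x"
  using int_pow_commute[OF assms, of "- 1"] assms(1) by (simp add: int_pow_neg)

text \<open>In right-nested products a commuting pair stands before a tail; this form turns
  commutation into a rewrite rule.\<close>

lemma (in group) left_commute: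
  assumes "x \<in> carrier G" "y \<in> carrier G" "x \<otimes> y = y \<otimes> x" "z \<in> carrier G"
  shows "x \<otimes> (y \<otimes> z) = y \<otimes> (x \<otimes> z)"
  using assms by (simp flip: m_assoc)

section \<open>Signed permutations of four points\<close>

type_synonym signed_perm = "(bool \<times> bool \<Rightarrow> bool \<times> bool) \<times> (bool \<times> bool \<Rightarrow> int)"

abbreviation signed_perms :: "signed_perm monoid" where "signed_perms \<equiv> wreath sign_group"

lemma group_signed_perms: "group signed_perms"
  by (rule group_wreath[OF group_sign_group])

text \<open>All images chosen below are involutions, so inverses can be evaluated like the elements
  themselves.\<close>

lemma involution_inv:
  assumes "group G" "\<Theta> \<in> hom G signed_perms" "g \<in> carrier G"
    "\<Theta> g \<otimes>\<^bsub>signed_perms\<^esub> \<Theta> g = \<one>\<^bsub>signed_perms\<^esub>"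
  shows "\<Theta> (inv\<^bsub>G\<^esub> g) = \<Theta> g"
proof -
  interpret \<Theta>: group_hom G signed_perms \<Theta>
    using assms group_signed_perms by (simp add: group_hom_def group_hom_axioms_def)
  show ?thesis using assms(3,4) by (metis \<Theta>.hom_inv \<Theta>.hom_closed \<Theta>.H.inv_equality)
qed

text \<open>The elements \<open>path_a\<close> and \<open>path_d\<close> flip the second coordinate,
  \<open>path_b\<close> and \<open>path_c\<close> the first. The signs let neighbours on the path
  commute while \<open>path_a\<close> and \<open>path_c\<close> commute only up to -1: the product
  of \<open>path_b\<close> and \<open>path_c\<close> is diagonal, and conjugation by
  \<open>path_a\<close> negates it.\<close>

definition path_a :: signed_perm where "path_a = (\<lambda>(i, j). (i, \<not> j), \<lambda>_. 1)"
definition path_b :: signed_perm where "path_b = (\<lambda>(i, j). (\<not> i, j), \<lambda>_. 1)"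
definition path_c :: signed_perm where "path_c = (\<lambda>(i, j). (\<not> i, j), \<lambda>(i, j). if j then - 1 else 1)"
definition path_d :: signed_perm where "path_d = (\<lambda>(i, j). (i, \<not> j), \<lambda>(i, j). if i then - 1 else 1)"

text \<open>Chosen for the quotients along the edges: those of \<open>a\<close> by \<open>b\<close>
  and of \<open>c\<close> by \<open>d\<close> flip the first coordinate, those of \<open>b\<close>
  by \<open>c\<close> and of \<open>d\<close> by \<open>a\<close> are diagonal. The quotient of
  \<open>b\<close> by \<open>c\<close> is -1 exactly where the coordinates differ, so conjugation by
  the quotient of \<open>a\<close> by \<open>b\<close> negates it.\<close>

definition cycle_a :: signed_perm where "cycle_a = (\<lambda>(i, j). (i, \<not> j), \<lambda>_. 1)"
definition cycle_b :: signed_perm where "cycle_b = (\<lambda>(i, j). (\<not> i, \<not> j), \<lambda>_. 1)"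
definition cycle_c :: signed_perm where "cycle_c = (\<lambda>(i, j). (\<not> i, \<not> j), \<lambda>(i, j). if i \<noteq> j then - 1 else 1)"
definition cycle_d :: signed_perm where "cycle_d = (\<lambda>(i, j). (i, \<not> j), \<lambda>(i, j). if i then - 1 else 1)"

lemmas path_defs = path_a_def path_b_def path_c_def path_d_def
  and cycle_defs = cycle_a_def cycle_b_def cycle_c_def cycle_d_def

lemma signed_perm_eqI:
  fixes g h :: signed_perm
  assumes "\<And>i j. fst g (i, j) = fst h (i, j)" "\<And>i j. snd g (i, j) = snd h (i, j)"
  shows "g = h"
  using assms by (auto simp: prod_eq_iff fun_eq_iff)

lemma bij_bool_prod: "(\<And>i j. f (f (i, j)) = (i, j)) \<Longrightarrow> bij f" for f :: "bool \<times> bool \<Rightarrow> bool \<times> bool"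
  by (rule o_bij[of f]) (auto simp: fun_eq_iff)

lemma path_closed:
  "path_a \<in> carrier signed_perms" "path_b \<in> carrier signed_perms"
  "path_c \<in> carrier signed_perms" "path_d \<in> carrier signed_perms"
  by (auto simp: wreath_simps path_defs intro: bij_bool_prod split: prod.splits if_splits)

lemma cycle_closed:
  "cycle_a \<in> carrier signed_perms" "cycle_b \<in> carrier signed_perms"
  "cycle_c \<in> carrier signed_perms" "cycle_d \<in> carrier signed_perms"
  by (auto simp: wreath_simps cycle_defs intro: bij_bool_prod split: prod.splits if_splits)

lemma path_commute:
  "path_a \<otimes>\<^bsub>signed_perms\<^esub> path_b = path_b \<otimes>\<^bsub>signed_perms\<^esub> path_a"
  "path_b \<otimes>\<^bsub>signed_perms\<^esub> path_c = path_c \<otimes>\<^bsub>signed_perms\<^esub> path_b"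
  "path_c \<otimes>\<^bsub>signed_perms\<^esub> path_d = path_d \<otimes>\<^bsub>signed_perms\<^esub> path_c"
  by (rule signed_perm_eqI; simp add: wreath_simps path_defs)+

lemma cycle_commute:
  "cycle_a \<otimes>\<^bsub>signed_perms\<^esub> cycle_b = cycle_b \<otimes>\<^bsub>signed_perms\<^esub> cycle_a"
  "cycle_b \<otimes>\<^bsub>signed_perms\<^esub> cycle_c = cycle_c \<otimes>\<^bsub>signed_perms\<^esub> cycle_b"
  "cycle_c \<otimes>\<^bsub>signed_perms\<^esub> cycle_d = cycle_d \<otimes>\<^bsub>signed_perms\<^esub> cycle_c"
  "cycle_d \<otimes>\<^bsub>signed_perms\<^esub> cycle_a = cycle_a \<otimes>\<^bsub>signed_perms\<^esub> cycle_d"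
  by (rule signed_perm_eqI; auto simp add: wreath_simps cycle_defs)+

lemma path_involution:
  "g \<in> {path_a, path_b, path_c, path_d} \<Longrightarrow> g \<otimes>\<^bsub>signed_perms\<^esub> g = \<one>\<^bsub>signed_perms\<^esub>"
  by (rule signed_perm_eqI) (auto simp: wreath_simps path_defs)

lemma cycle_involution:
  "g \<in> {cycle_a, cycle_b, cycle_c, cycle_d} \<Longrightarrow> g \<otimes>\<^bsub>signed_perms\<^esub> g = \<one>\<^bsub>signed_perms\<^esub>"
  by (rule signed_perm_eqI) (auto simp: wreath_simps cycle_defs)

text \<open>The squares of \<open>b c\<close> and of its conjugate by \<open>a\<close> have the same image in the
  abelianization of the stabilizer, because \<open>c\<^sup>2\<close> and its conjugate by \<open>a\<close> are conjugate there by
  \<open>a d\<^sup>-\<^sup>1\<close>; the sign tells \<open>b c\<close> and its conjugate apart.\<close>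

lemma path_not_raag:
  fixes G :: "'g monoid" (structure)
  assumes G: "group G" and \<Theta>: "\<Theta> \<in> hom G signed_perms"
    and car: "a \<in> carrier G" "b \<in> carrier G" "c \<in> carrier G" "d \<in> carrier G"
    and comm: "a \<otimes> b = b \<otimes> a" "b \<otimes> c = c \<otimes> b" "c \<otimes> d = d \<otimes> c"
    and im: "\<Theta> a = path_a" "\<Theta> b = path_b" "\<Theta> c = path_c" "\<Theta> d = path_d"
  shows "\<exists>H. subgroup H G \<and> \<not> is_raag (G\<lparr>carrier := H\<rparr>)"
proof -
  interpret G: group G by fact
  interpret \<Theta>: group_hom G signed_perms \<Theta>
    using G \<Theta> group_signed_perms by (simp add: group_hom_def group_hom_axioms_def)
  let ?x = "(False, False)"
  let ?H = "{g \<in> carrier G. fst (\<Theta> g) ?x = ?x}"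
  have inv: "\<Theta> (inv a) = path_a" "\<Theta> (inv b) = path_b" "\<Theta> (inv c) = path_c" "\<Theta> (inv d) = path_d"
    using car[THEN involution_inv[OF G \<Theta>]] path_involution by (simp_all add: im)
  note [simp del] = \<Theta>.hom_inv
  note [simp] = car
  note eval = inv im wreath_simps path_defs
  \<comment> \<open>The element \<open>a\<close> moves the base point, so \<open>x1\<close> is not
    visibly conjugate to \<open>x0\<close> in the stabilizer. But \<open>b2\<close> commutes with
    \<open>a\<close>, and \<open>t\<close> fixes the base point and conjugates \<open>c2\<close> as
    \<open>a\<close> does, because \<open>d\<close> commutes with \<open>c\<close>.\<close>
  define x0 x1 t b2 c2 where "x0 = b \<otimes> c" and "x1 = a \<otimes> (b \<otimes> c) \<otimes> inv a" and "t = a \<otimes> inv d"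
    and "b2 = b \<otimes> b" and "c2 = c \<otimes> c"
  note defs = x0_def x1_def t_def b2_def c2_def
  have mem: "x0 \<in> ?H" "x1 \<in> ?H" "t \<in> ?H" "b2 \<in> ?H" "c2 \<in> ?H"
    by (simp_all add: defs eval)
  have H: "subgroup ?H G" by (rule wreath_stabilizer(1)[OF G group_sign_group \<Theta>])
  interpret H: group "G\<lparr>carrier := ?H\<rparr>" by (rule subgroup.subgroup_is_group[OF H G])
  note rules = G.left_commute[OF _ _ comm(1)[symmetric]] G.left_commute[OF _ _ comm(2)[symmetric]]
    G.left_commute[OF _ _ G.inv_commute[OF _ _ comm(3)[symmetric]]] G.m_assoc G.cancel_left G.inv_mult_group
  have sq: "x0 \<otimes> x0 = b2 \<otimes> c2" "x1 \<otimes> x1 = b2 \<otimes> (t \<otimes> c2 \<otimes> inv t)"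
    by (simp_all add: defs rules)
  show ?thesis
  proof (rule not_raag_stabilizer[OF G \<Theta>, of "x1 \<otimes> inv x0" ?x])
    show "x1 \<otimes> inv x0 \<in> carrier G" "fst (\<Theta> (x1 \<otimes> inv x0)) ?x = ?x" "snd (\<Theta> (x1 \<otimes> inv x0)) ?x = - 1"
      by (simp_all add: defs eval G.inv_mult_group)
    fix \<psi> assume \<psi>: "\<psi> \<in> hom (G\<lparr>carrier := ?H\<rparr>) integer_group"
    interpret \<psi>: group_hom "G\<lparr>carrier := ?H\<rparr>" integer_group \<psi>
      using \<psi> H.is_group by (simp add: group_hom_def group_hom_axioms_def)
    have m: "\<psi> (g \<otimes> h) = \<psi> g + \<psi> h" if "g \<in> ?H" "h \<in> ?H" for g h
      using \<psi>.hom_mult[of g h] that by simp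
    have i: "\<psi> (inv g) = - \<psi> g" "inv g \<in> ?H" if "g \<in> ?H" for g
      using \<psi>.hom_inv[of g] that G.m_inv_consistent[OF H that] subgroup.m_inv_closed[OF H that] by simp_all
    have tc: "t \<otimes> c2 \<in> ?H" "t \<otimes> c2 \<otimes> inv t \<in> ?H"
      using subgroup.m_closed[OF H mem(3,5)] subgroup.m_closed[OF H subgroup.m_closed[OF H mem(3,5)] i(2)[OF mem(3)]] .
    have "\<psi> x0 + \<psi> x0 = \<psi> b2 + \<psi> c2"
      using m[OF mem(1,1)] m[OF mem(4,5)] by (simp only: sq)
    moreover have "\<psi> x1 + \<psi> x1 = \<psi> b2 + (\<psi> t + \<psi> c2 - \<psi> t)"
      using m[OF mem(2) mem(2)] m[OF mem(4) tc(2)] m[OF tc(1) i(2)[OF mem(3)]] m[OF mem(3,5)] i(1)[OF mem(3)]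
      by (simp only: sq)
    ultimately have "\<psi> x0 = \<psi> x1" by simp
    then show "\<psi> (x1 \<otimes> inv x0) = 0" using m[OF mem(2) i(2)[OF mem(1)]] i(1)[OF mem(1)] by simp
  qed
qed

lemma (in group) quotient_commute:
  assumes "x \<in> carrier G" "x' \<in> carrier G" "y \<in> carrier G" "y' \<in> carrier G"
    and "x \<otimes> y = y \<otimes> x" "x \<otimes> y' = y' \<otimes> x" "x' \<otimes> y = y \<otimes> x'" "x' \<otimes> y' = y' \<otimes> x'"
  shows "(x \<otimes> inv x') \<otimes> (y \<otimes> inv y') = (y \<otimes> inv y') \<otimes> (x \<otimes> inv x')"
proof -
  have "inv (y' \<otimes> x') = inv (x' \<otimes> y')" by (simp only: assms(8))
  then have c: "inv x' \<otimes> inv y' = inv y' \<otimes> inv x'" using assms(2,4) by (simp add: inv_mult_group)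
  note car = assms(1-4) assms(1-4)[THEN inv_closed]
  note inv_comm = inv_commute[OF assms(2,3,7)] inv_commute[OF assms(4,1) assms(6)[symmetric], symmetric]
  have "x \<otimes> (inv x' \<otimes> (y \<otimes> inv y')) = x \<otimes> (y \<otimes> (inv x' \<otimes> inv y'))"
    using left_commute[OF car(6,3) inv_comm(1) car(8)] by simp
  also have "\<dots> = y \<otimes> (x \<otimes> (inv x' \<otimes> inv y'))"
    by (rule left_commute[OF car(1,3) assms(5)]) (use car in simp)
  also have "\<dots> = y \<otimes> (x \<otimes> (inv y' \<otimes> inv x'))" by (simp only: c)
  also have "\<dots> = y \<otimes> (inv y' \<otimes> (x \<otimes> inv x'))"
    using left_commute[OF car(1,8) inv_comm(2) car(6)] by simp
  finally show ?thesis using assms(1-4) by (simp add: m_assoc)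
qed

section \<open>Gems and overlapping gems in Bestvina--Brady groups\<close>

context simplicial_raag
begin

lemma bb_eq: "bestvina_brady \<Gamma> = G\<lparr>carrier := {g \<in> carrier G. chi g = 0}\<rparr>"
  by (simp add: bestvina_brady_def kernel_def G)

lemma bb_subgroup: "subgroup {g \<in> carrier G. chi g = 0} G"
  using chi.subgroup_kernel by (simp add: kernel_def)

text \<open>Vertices outside the induced subgraph go to the identity, so only edges inside it impose
  conditions, and the rest of \<open>\<Gamma>\<close> may be arbitrary.\<close>

lemma induced_hom:
  assumes K: "group K" and f: "inj_on f I" "f ` I \<subseteq> verts \<Gamma>" and p: "\<And>i. i \<in> I \<Longrightarrow> p i \<in> carrier K"
    and comm: "\<And>i j. i \<in> I \<Longrightarrow> j \<in> I \<Longrightarrow> {f i, f j} \<in> edges \<Gamma> \<Longrightarrow> p i \<otimes>\<^bsub>K\<^esub> p j = p j \<otimes>\<^bsub>K\<^esub> p i"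
  obtains \<Theta> where "\<Theta> \<in> hom G K" "\<And>i. i \<in> I \<Longrightarrow> \<Theta> (gen (f i)) = p i"
proof -
  interpret K: group K by fact
  define u where "u v = (if v \<in> f ` I then p (inv_into I f v) else \<one>\<^bsub>K\<^esub>)" for v
  have uf: "u (f i) = p i" if "i \<in> I" for i using f(1) that by (simp add: u_def)
  have uc: "u v \<in> carrier K" for v using p f(1) by (auto simp: u_def)
  have "u v \<otimes>\<^bsub>K\<^esub> u w = u w \<otimes>\<^bsub>K\<^esub> u v" if "{v, w} \<in> edges \<Gamma>" for v w
  proof (cases "v \<in> f ` I \<and> w \<in> f ` I")
    case True
    then show ?thesis using that comm by (auto simp: uf)
  next
    case False
    then have "u v = \<one>\<^bsub>K\<^esub> \<or> u w = \<one>\<^bsub>K\<^esub>" by (auto simp: u_def)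
    then show ?thesis using uc[of v] uc[of w] by auto
  qed
  then obtain \<Theta> where \<Theta>: "\<Theta> \<in> hom G K" "\<And>v. v \<in> verts \<Gamma> \<Longrightarrow> \<Theta> (gen v) = u v"
    using raag_ext[OF K, of u, OF uc] by blast
  show ?thesis
  proof (rule that[OF \<Theta>(1)])
    show "\<Theta> (gen (f i)) = p i" if "i \<in> I" for i
      using \<Theta>(2)[of "f i"] uf[OF that] f(2) that by auto
  qed
qed

text \<open>Quotients of two generators have exponent sum zero, and two of them commute once each
  end of one equals or is adjacent to each end of the other. This is the common part of the two gem
  graphs.\<close>

lemma bb_path_not_raag:
  assumes V: "a \<in> verts \<Gamma>" "a' \<in> verts \<Gamma>" "b \<in> verts \<Gamma>" "b' \<in> verts \<Gamma>" "c \<in> verts \<Gamma>" "c' \<in> verts \<Gamma>"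
      "d \<in> verts \<Gamma>" "d' \<in> verts \<Gamma>"
    and comm: "\<And>x y. (x, y) \<in> ({a, a'} \<times> {b, b'}) \<union> ({b, b'} \<times> {c, c'}) \<union> ({c, c'} \<times> {d, d'}) \<Longrightarrow>
      x = y \<or> {x, y} \<in> edges \<Gamma>"
    and \<Theta>: "\<Theta> \<in> hom G signed_perms"
    and im: "\<Theta> (gen a \<otimes> inv (gen a')) = path_a" "\<Theta> (gen b \<otimes> inv (gen b')) = path_b"
      "\<Theta> (gen c \<otimes> inv (gen c')) = path_c" "\<Theta> (gen d \<otimes> inv (gen d')) = path_d"
  shows "\<exists>H. subgroup H (bestvina_brady \<Gamma>) \<and> \<not> is_raag ((bestvina_brady \<Gamma>)\<lparr>carrier := H\<rparr>)"
proof -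
  let ?B = "bestvina_brady \<Gamma>"
  let ?q = "\<lambda>x y. gen x \<otimes> inv (gen y)"
  have mem: "?q x y \<in> carrier ?B" if "x \<in> verts \<Gamma>" "y \<in> verts \<Gamma>" for x y
    using that by (simp add: bb_eq gen_closed chi_gen)
  have q_comm: "?q x x' \<otimes>\<^bsub>?B\<^esub> ?q y y' = ?q y y' \<otimes>\<^bsub>?B\<^esub> ?q x x'"
    if "x \<in> verts \<Gamma>" "x' \<in> verts \<Gamma>" "y \<in> verts \<Gamma>" "y' \<in> verts \<Gamma>"
      "\<And>z w. z \<in> {x, x'} \<Longrightarrow> w \<in> {y, y'} \<Longrightarrow> z = w \<or> {z, w} \<in> edges \<Gamma>" for x x' y y'
  proof -
    have c: "gen z \<otimes> gen w = gen w \<otimes> gen z" if "z = w \<or> {z, w} \<in> edges \<Gamma>" for z w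
      using that gen_commute by auto
    have "?q x x' \<otimes> ?q y y' = ?q y y' \<otimes> ?q x x'"
      by (rule quotient_commute) (use that in \<open>auto intro!: c gen_closed\<close>)
    then show ?thesis by (simp add: bb_eq)
  qed
  show ?thesis
  proof (rule path_not_raag[OF group_bestvina_brady, where a = "?q a a'" and b = "?q b b'" and c = "?q c c'" and d = "?q d d'"])
    show "\<Theta> \<in> hom ?B signed_perms" unfolding bb_eq by (rule hom_subgroup[OF \<Theta>]) auto
    show "?q a a' \<otimes>\<^bsub>?B\<^esub> ?q b b' = ?q b b' \<otimes>\<^bsub>?B\<^esub> ?q a a'" using V by (intro q_comm comm) auto
    show "?q b b' \<otimes>\<^bsub>?B\<^esub> ?q c c' = ?q c c' \<otimes>\<^bsub>?B\<^esub> ?q b b'" using V by (intro q_comm comm) auto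
    show "?q c c' \<otimes>\<^bsub>?B\<^esub> ?q d d' = ?q d d' \<otimes>\<^bsub>?B\<^esub> ?q c c'" using V by (intro q_comm comm) auto
  qed (use V mem im in auto)
qed

lemma inv_one_signed_perms: "inv\<^bsub>signed_perms\<^esub> \<one>\<^bsub>signed_perms\<^esub> = \<one>\<^bsub>signed_perms\<^esub>"
  by (rule monoid.inv_one[OF group.is_monoid[OF group_signed_perms]])

lemma bb_gem_not_raag:
  assumes "has_induced \<Gamma> gem_graph"
  shows "\<exists>H. subgroup H (bestvina_brady \<Gamma>) \<and> \<not> is_raag ((bestvina_brady \<Gamma>)\<lparr>carrier := H\<rparr>)"
proof -
  interpret S: group signed_perms by (rule group_signed_perms)
  let ?g = gem_graph
  have verts: "verts ?g = UNIV" using gem_vertex.exhaust by (auto simp: gem_graph_def)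
  obtain f where inj: "inj f" and f: "range f \<subseteq> verts \<Gamma>"
    and edge: "\<And>x y. {f x, f y} \<in> edges \<Gamma> \<longleftrightarrow> {x, y} \<in> edges ?g"
    using has_inducedE[OF assms] unfolding verts by auto
  have fV: "f x \<in> verts \<Gamma>" for x using f by auto
  \<comment> \<open>With the apex sent to the identity, the quotient of a path vertex by the apex
    has the image of the path vertex.\<close>
  define p where "p x = (case x of Gem_a1 \<Rightarrow> path_a | Gem_a2 \<Rightarrow> path_b | Gem_a3 \<Rightarrow> path_c | Gem_a4 \<Rightarrow> path_d
    | Gem_c \<Rightarrow> \<one>\<^bsub>signed_perms\<^esub>)" for x
  have pc: "p x \<in> carrier signed_perms" for x using path_closed by (cases x) (auto simp: p_def)
  obtain \<Theta> where \<Theta>: "\<Theta> \<in> hom G signed_perms" "\<And>x. \<Theta> (gen (f x)) = p x"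
  proof (rule induced_hom[OF group_signed_perms inj f, of p])
    show "p x \<otimes>\<^bsub>signed_perms\<^esub> p y = p y \<otimes>\<^bsub>signed_perms\<^esub> p x" if "{f x, f y} \<in> edges \<Gamma>" for x y
      using that path_commute path_closed unfolding edge by (auto simp: gem_graph_def doubleton_eq_iff p_def)
  qed (use pc in auto)
  interpret \<Theta>: group_hom G signed_perms \<Theta>
    using \<Theta> group_signed_perms by (simp add: group_hom_def group_hom_axioms_def is_group)
  show ?thesis
  proof (rule bb_path_not_raag[where a = "f Gem_a1" and b = "f Gem_a2" and c = "f Gem_a3" and d = "f Gem_a4"
        and a' = "f Gem_c" and b' = "f Gem_c" and c' = "f Gem_c" and d' = "f Gem_c" and \<Theta> = \<Theta>])
    show "x = y \<or> {x, y} \<in> edges \<Gamma>"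
      if xy: "(x, y) \<in> {f Gem_a1, f Gem_c} \<times> {f Gem_a2, f Gem_c} \<union> {f Gem_a2, f Gem_c} \<times> {f Gem_a3, f Gem_c}
        \<union> {f Gem_a3, f Gem_c} \<times> {f Gem_a4, f Gem_c}" for x y
    proof -
      have "X = Y \<or> {X, Y} \<in> edges ?g" if "(X, Y) \<in> {Gem_a1, Gem_c} \<times> {Gem_a2, Gem_c} \<union> {Gem_a2, Gem_c} \<times> {Gem_a3, Gem_c}
        \<union> {Gem_a3, Gem_c} \<times> {Gem_a4, Gem_c}" for X Y
        using that by (auto simp: gem_graph_def doubleton_eq_iff)
      moreover obtain X Y where "x = f X" "y = f Y" "(X, Y) \<in> {Gem_a1, Gem_c} \<times> {Gem_a2, Gem_c} \<union> {Gem_a2, Gem_c} \<times> {Gem_a3, Gem_c}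
        \<union> {Gem_a3, Gem_c} \<times> {Gem_a4, Gem_c}"
        using xy by blast
      ultimately show ?thesis using edge by blast
    qed
  qed (use fV path_closed \<Theta> gen_closed in \<open>auto simp: p_def inv_one_signed_perms\<close>)
qed

lemma bb_overlapping_gems_not_raag:
  assumes "has_induced \<Gamma> overlapping_gems_graph"
  shows "\<exists>H. subgroup H (bestvina_brady \<Gamma>) \<and> \<not> is_raag ((bestvina_brady \<Gamma>)\<lparr>carrier := H\<rparr>)"
proof -
  interpret S: group signed_perms by (rule group_signed_perms)
  let ?g = overlapping_gems_graph
  have verts: "verts ?g = UNIV" using og_vertex.exhaust by (auto simp: overlapping_gems_graph_def)
  obtain f where inj: "inj f" and f: "range f \<subseteq> verts \<Gamma>"
    and edge: "\<And>x y. {f x, f y} \<in> edges \<Gamma> \<longleftrightarrow> {x, y} \<in> edges ?g"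
    using has_inducedE[OF assms] unfolding verts by auto
  have fV: "f x \<in> verts \<Gamma>" for x using f by auto
  \<comment> \<open>The four elements are the quotients of \<open>a\<close> by \<open>b\<close>,
    \<open>b\<close> by \<open>f\<close>, \<open>c\<close> by \<open>e\<close>, and \<open>d\<close>
    by \<open>c\<close>. The additional factors \<open>path_b\<close> at \<open>a\<close> and
    \<open>path_c\<close> at \<open>d\<close> cancel in the first and the last of them.\<close>
  define p where "p x = (case x of OG_a \<Rightarrow> path_a \<otimes>\<^bsub>signed_perms\<^esub> path_b | OG_b \<Rightarrow> path_b | OG_c \<Rightarrow> path_c
    | OG_d \<Rightarrow> path_d \<otimes>\<^bsub>signed_perms\<^esub> path_c | _ \<Rightarrow> \<one>\<^bsub>signed_perms\<^esub>)" for x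
  have pc: "p x \<in> carrier signed_perms" for x using path_closed by (cases x) (auto simp: p_def)
  have ab: "path_a \<otimes>\<^bsub>signed_perms\<^esub> path_b \<otimes>\<^bsub>signed_perms\<^esub> path_b = path_b \<otimes>\<^bsub>signed_perms\<^esub> (path_a \<otimes>\<^bsub>signed_perms\<^esub> path_b)"
    "path_d \<otimes>\<^bsub>signed_perms\<^esub> path_c \<otimes>\<^bsub>signed_perms\<^esub> path_c = path_c \<otimes>\<^bsub>signed_perms\<^esub> (path_d \<otimes>\<^bsub>signed_perms\<^esub> path_c)"
    by (simp_all add: S.m_assoc path_closed S.left_commute[OF path_closed(2,1) path_commute(1)[symmetric] path_closed(2)]
        S.left_commute[OF path_closed(3,4) path_commute(3) path_closed(3)])
  obtain \<Theta> where \<Theta>: "\<Theta> \<in> hom G signed_perms" "\<And>x. \<Theta> (gen (f x)) = p x"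
  proof (rule induced_hom[OF group_signed_perms inj f, of p])
    show "p x \<otimes>\<^bsub>signed_perms\<^esub> p y = p y \<otimes>\<^bsub>signed_perms\<^esub> p x" if "{f x, f y} \<in> edges \<Gamma>" for x y
      using that path_commute path_closed ab unfolding edge by (auto simp: overlapping_gems_graph_def doubleton_eq_iff p_def)
  qed (use pc in auto)
  interpret \<Theta>: group_hom G signed_perms \<Theta>
    using \<Theta> group_signed_perms by (simp add: group_hom_def group_hom_axioms_def is_group)
  show ?thesis
  proof (rule bb_path_not_raag[where a = "f OG_a" and a' = "f OG_b" and b = "f OG_b" and b' = "f OG_f"
        and c = "f OG_c" and c' = "f OG_e" and d = "f OG_d" and d' = "f OG_c" and \<Theta> = \<Theta>])
    show "x = y \<or> {x, y} \<in> edges \<Gamma>"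
      if xy: "(x, y) \<in> {f OG_a, f OG_b} \<times> {f OG_b, f OG_f} \<union> {f OG_b, f OG_f} \<times> {f OG_c, f OG_e}
        \<union> {f OG_c, f OG_e} \<times> {f OG_d, f OG_c}" for x y
    proof -
      have "X = Y \<or> {X, Y} \<in> edges ?g" if "(X, Y) \<in> {OG_a, OG_b} \<times> {OG_b, OG_f} \<union> {OG_b, OG_f} \<times> {OG_c, OG_e}
        \<union> {OG_c, OG_e} \<times> {OG_d, OG_c}" for X Y
        using that by (auto simp: overlapping_gems_graph_def doubleton_eq_iff)
      moreover obtain X Y where "x = f X" "y = f Y" "(X, Y) \<in> {OG_a, OG_b} \<times> {OG_b, OG_f} \<union> {OG_b, OG_f} \<times> {OG_c, OG_e}
        \<union> {OG_c, OG_e} \<times> {OG_d, OG_c}"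
        using xy by blast
      ultimately show ?thesis using edge by blast
    qed
  qed (use fV path_closed \<Theta> gen_closed in \<open>auto simp: p_def inv_one_signed_perms S.m_assoc\<close>)
qed

end

text \<open>The relations \<open>s\<^sup>k p\<^sup>k u\<^sup>k q\<^sub>k = 1\<close> for \<open>k = 1, 2, 3\<close>, where \<open>q\<^sub>k = d\<^sup>k a\<^sup>-\<^sup>k\<close>, together
  force twice the difference of \<open>s p s\<^sup>-\<^sup>1\<close> and \<open>p\<close> to vanish in the abelianization.\<close>

lemma (in group) cycle_torsion:
  assumes H: "subgroup H G" and \<psi>: "\<psi> \<in> hom (G\<lparr>carrier := H\<rparr>) integer_group"
    and car: "a \<in> carrier G" "b \<in> carrier G" "c \<in> carrier G" "d \<in> carrier G"
    and comm: "a \<otimes> b = b \<otimes> a" "b \<otimes> c = c \<otimes> b" "c \<otimes> d = d \<otimes> c"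
  defines "s \<equiv> a \<otimes> inv b" and "p \<equiv> b \<otimes> inv c" and "u \<equiv> c \<otimes> inv d"
    and "q1 \<equiv> d \<otimes> inv a" and "q2 \<equiv> d \<otimes> (d \<otimes> (inv a \<otimes> inv a))"
    and "q3 \<equiv> d \<otimes> (d \<otimes> (d \<otimes> (inv a \<otimes> (inv a \<otimes> inv a))))"
  assumes mem: "p \<in> H" "s \<otimes> p \<otimes> inv s \<in> H" "s \<otimes> u \<in> H" "s \<otimes> s \<in> H" "u \<otimes> u \<in> H" "q1 \<in> H" "q2 \<in> H" "q3 \<in> H"
    and q: "\<psi> q2 = 2 * \<psi> q1" "\<psi> q3 = 3 * \<psi> q1"
  shows "\<psi> (s \<otimes> p \<otimes> inv s \<otimes> inv p) = 0"
proof -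
  interpret H: group "G\<lparr>carrier := H\<rparr>" by (rule subgroup.subgroup_is_group[OF H is_group])
  interpret \<psi>: group_hom "G\<lparr>carrier := H\<rparr>" integer_group \<psi>
    using \<psi> H.is_group by (simp add: group_hom_def group_hom_axioms_def)
  have m: "\<psi> (g \<otimes> h) = \<psi> g + \<psi> h" if "g \<in> H" "h \<in> H" for g h
    using \<psi>.hom_mult[of g h] that by simp
  have one: "\<psi> \<one> = 0" using \<psi>.hom_one by simp
  note closed = subgroup.m_closed[OF H]
  note [simp] = car
  have inv_comm: "inv b \<otimes> a = a \<otimes> inv b" "inv c \<otimes> b = b \<otimes> inv c" "inv d \<otimes> c = c \<otimes> inv d"
    by (rule inv_commute; simp add: comm)+
  have inv_bc: "inv c \<otimes> inv b = inv b \<otimes> inv c"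
    by (metis car(2,3) comm(2) inv_mult_group)
  note rules = left_commute[OF _ _ inv_comm(1)] left_commute[OF _ _ inv_comm(2)] left_commute[OF _ _ inv_comm(3)]
    left_commute[OF _ _ inv_bc] m_assoc cancel_left inv_mult_group
  \<comment> \<open>In the application \<open>s\<close> and \<open>u\<close> move the base point, so
    the relations are regrouped into factors that lie in \<open>H\<close>. Subtracting the equations
    for \<open>k = 1\<close> and \<open>k = 2\<close> from that for \<open>k = 3\<close> leaves
    twice \<open>\<psi> ?x\<close> equal to twice \<open>\<psi> p\<close>.\<close>
  let ?x = "s \<otimes> p \<otimes> inv s"
  have "?x \<otimes> (s \<otimes> u) \<otimes> q1 = \<one>"
    by (simp add: s_def p_def u_def q1_def rules)
  moreover have "\<psi> (?x \<otimes> (s \<otimes> u) \<otimes> q1) = \<psi> ?x + \<psi> (s \<otimes> u) + \<psi> q1"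
    using mem by (simp only: m closed)
  moreover have "s \<otimes> s \<otimes> (p \<otimes> p) \<otimes> (u \<otimes> u) \<otimes> q2 = \<one>"
    by (simp add: s_def p_def u_def q2_def rules)
  moreover have "\<psi> (s \<otimes> s \<otimes> (p \<otimes> p) \<otimes> (u \<otimes> u) \<otimes> q2) = \<psi> (s \<otimes> s) + (\<psi> p + \<psi> p) + \<psi> (u \<otimes> u) + \<psi> q2"
    using mem by (simp only: m closed)
  moreover have "s \<otimes> s \<otimes> (?x \<otimes> ?x \<otimes> ?x) \<otimes> (s \<otimes> u) \<otimes> (u \<otimes> u) \<otimes> q3 = \<one>"
    by (simp add: s_def p_def u_def q3_def rules)
  moreover have "\<psi> (s \<otimes> s \<otimes> (?x \<otimes> ?x \<otimes> ?x) \<otimes> (s \<otimes> u) \<otimes> (u \<otimes> u) \<otimes> q3)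
      = \<psi> (s \<otimes> s) + (\<psi> ?x + \<psi> ?x + \<psi> ?x) + \<psi> (s \<otimes> u) + \<psi> (u \<otimes> u) + \<psi> q3"
    using mem by (simp only: m closed)
  ultimately have "\<psi> ?x = \<psi> p" using q one by simp
  moreover have "\<psi> (inv p) = - \<psi> p" "inv p \<in> H"
    using \<psi>.hom_inv[of p] mem(1) m_inv_consistent[OF H mem(1)] subgroup.m_inv_closed[OF H mem(1)] by simp_all
  ultimately show ?thesis using m[of ?x "inv p"] mem by simp
qed

text \<open>As \<open>w\<close> and \<open>w'\<close> commute, replacing \<open>w\<close> by
  \<open>w'\<close> multiplies the \<open>k\<close>-th quotient by the \<open>k\<close>-th power of
  \<open>w \<otimes> inv w'\<close>, on which \<open>\<psi>\<close> is additive. Repeated along an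
  arc of the cycle, this carries the linearity from one end to the other.\<close>

lemma (in group) path_step:
  assumes H: "subgroup H G" and \<psi>: "\<psi> \<in> hom (G\<lparr>carrier := H\<rparr>) integer_group"
    and car: "d \<in> carrier G" "w \<in> carrier G" "w' \<in> carrier G" and comm: "w \<otimes> w' = w' \<otimes> w"
    and mem: "w \<otimes> inv w' \<in> H" "d \<otimes> inv w \<in> H" "d \<otimes> (d \<otimes> (inv w \<otimes> inv w)) \<in> H"
      "d \<otimes> (d \<otimes> (d \<otimes> (inv w \<otimes> (inv w \<otimes> inv w)))) \<in> H"
    and IH: "\<psi> (d \<otimes> (d \<otimes> (inv w \<otimes> inv w))) = 2 * \<psi> (d \<otimes> inv w)"
      "\<psi> (d \<otimes> (d \<otimes> (d \<otimes> (inv w \<otimes> (inv w \<otimes> inv w))))) = 3 * \<psi> (d \<otimes> inv w)"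
  shows "\<psi> (d \<otimes> (d \<otimes> (inv w' \<otimes> inv w'))) = 2 * \<psi> (d \<otimes> inv w')"
    "\<psi> (d \<otimes> (d \<otimes> (d \<otimes> (inv w' \<otimes> (inv w' \<otimes> inv w'))))) = 3 * \<psi> (d \<otimes> inv w')"
proof -
  have m: "\<psi> (g \<otimes> h) = \<psi> g + \<psi> h" if "g \<in> H" "h \<in> H" for g h
    using hom_mult[OF \<psi>, of g h] that by simp
  note closed = subgroup.m_closed[OF H]
  note [simp] = car
  let ?t = "w \<otimes> inv w'"
  have inv_comm: "inv w' \<otimes> w = w \<otimes> inv w'" by (rule inv_commute) (simp_all add: comm)
  note rules = left_commute[OF _ _ inv_comm] m_assoc cancel_left
  have e1: "d \<otimes> inv w' = d \<otimes> inv w \<otimes> ?t" by (simp add: rules)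
  have e2: "d \<otimes> (d \<otimes> (inv w' \<otimes> inv w')) = d \<otimes> (d \<otimes> (inv w \<otimes> inv w)) \<otimes> (?t \<otimes> ?t)" by (simp add: rules)
  have e3: "d \<otimes> (d \<otimes> (d \<otimes> (inv w' \<otimes> (inv w' \<otimes> inv w')))) =
      d \<otimes> (d \<otimes> (d \<otimes> (inv w \<otimes> (inv w \<otimes> inv w)))) \<otimes> (?t \<otimes> ?t \<otimes> ?t)" by (simp add: rules)
  show "\<psi> (d \<otimes> (d \<otimes> (inv w' \<otimes> inv w'))) = 2 * \<psi> (d \<otimes> inv w')"
    unfolding e1 e2 using m[OF mem(2,1)] m[OF mem(3) closed[OF mem(1,1)]] m[OF mem(1,1)] IH by linarith
  show "\<psi> (d \<otimes> (d \<otimes> (d \<otimes> (inv w' \<otimes> (inv w' \<otimes> inv w'))))) = 3 * \<psi> (d \<otimes> inv w')"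
    unfolding e1 e3 using m[OF mem(2,1)] m[OF mem(4) closed[OF closed[OF mem(1,1)] mem(1)]]
      m[OF closed[OF mem(1,1)] mem(1)] m[OF mem(1,1)] IH by linarith
qed

lemma (in simplicial_raag) bb_cycle_not_raag:
  assumes n: "n \<ge> 4" and cyc: "has_induced \<Gamma> (cycle_graph n)"
  shows "\<exists>H. subgroup H (bestvina_brady \<Gamma>) \<and> \<not> is_raag ((bestvina_brady \<Gamma>)\<lparr>carrier := H\<rparr>)"
proof -
  interpret S: group signed_perms by (rule group_signed_perms)
  obtain f where inj: "inj_on f {0..<n}" and fV: "f ` {0..<n} \<subseteq> verts \<Gamma>"
    and edge: "\<And>i j. i \<in> {0..<n} \<Longrightarrow> j \<in> {0..<n} \<Longrightarrow> {f i, f j} \<in> edges \<Gamma> \<longleftrightarrow> {i, j} \<in> edges (cycle_graph n)"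
    using has_inducedE[OF cyc] by (auto simp: cycle_graph_def)
  have fiV: "f i \<in> verts \<Gamma>" if "i < n" for i using fV that by auto
  have edge_iff: "{f i, f j} \<in> edges \<Gamma> \<longleftrightarrow> j = i + 1 \<or> (i = 0 \<and> j = n - 1)" if "i < j" "j < n" for i j
    using edge[of i j] cycle_graph_edge[OF that] that by simp
  \<comment> \<open>All vertices from 3 on share \<open>cycle_d\<close>, which folds a cycle of any
    length onto a square; the closing edge only needs \<open>cycle_d\<close> and
    \<open>cycle_a\<close> to commute.\<close>
  define p where "p i = (if i = 0 then cycle_a else if i = 1 then cycle_b else if i = 2 then cycle_c else cycle_d)" for i :: nat
  have pc: "p i \<in> carrier signed_perms" for i using cycle_closed by (simp add: p_def)
  have p_comm: "p i \<otimes>\<^bsub>signed_perms\<^esub> p j = p j \<otimes>\<^bsub>signed_perms\<^esub> p i" if "i < j" "j = i + 1 \<or> (i = 0 \<and> j = n - 1)" for i j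
    using that n cycle_commute by (auto simp: p_def)
  obtain \<Theta> where \<Theta>: "\<Theta> \<in> hom G signed_perms" "\<And>i. i \<in> {0..<n} \<Longrightarrow> \<Theta> (gen (f i)) = p i"
  proof (rule induced_hom[OF group_signed_perms inj fV, of p])
    fix i j assume ij: "i \<in> {0..<n}" "j \<in> {0..<n}" "{f i, f j} \<in> edges \<Gamma>"
    consider "i < j" | "j < i" | "i = j" by linarith
    then show "p i \<otimes>\<^bsub>signed_perms\<^esub> p j = p j \<otimes>\<^bsub>signed_perms\<^esub> p i"
    proof cases
      case 1
      then show ?thesis using p_comm[of i j] edge_iff[of i j] ij by simp
    next
      case 2
      then show ?thesis using p_comm[of j i] edge_iff[of j i] ij by (simp add: insert_commute)
    qed simp
  qed (use pc in auto)
  interpret \<Theta>: group_hom G signed_perms \<Theta>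
    using \<Theta> group_signed_perms by (simp add: group_hom_def group_hom_axioms_def is_group)
  define w where "w i = gen (f i)" for i
  have wc: "w i \<in> carrier G" if "i < n" for i using gen_closed[OF fiV[OF that]] by (simp add: w_def)
  have w_comm: "w i \<otimes> w j = w j \<otimes> w i" if "i < j" "j < n" "j = i + 1 \<or> (i = 0 \<and> j = n - 1)" for i j
    using gen_commute[of "f i" "f j"] edge_iff[OF that(1,2)] that(3) by (simp add: w_def)
  have \<Theta>w: "\<Theta> (w i) = p i" if "i < n" for i using that \<Theta>(2) by (simp add: w_def)
  have p_inv: "p i \<otimes>\<^bsub>signed_perms\<^esub> p i = \<one>\<^bsub>signed_perms\<^esub>" for i using cycle_involution by (simp add: p_def)
  have \<Theta>w_inv: "\<Theta> (inv (w i)) = p i" if "i < n" for i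
    using involution_inv[OF is_group \<Theta>(1) wc[OF that]] p_inv that by (simp add: \<Theta>w)
  have chi_w: "chi (w i) = 1" if "i < n" for i using chi_gen[OF fiV[OF that]] by (simp add: w_def)
  note [simp del] = \<Theta>.hom_inv One_nat_def
  note [simp] = wc
  let ?x = "(False, False)"
  let ?B = "bestvina_brady \<Gamma>"
  let ?H = "{g \<in> carrier ?B. fst (\<Theta> g) ?x = ?x}"
  have B: "subgroup (carrier ?B) G" using bb_subgroup by (simp add: bb_eq)
  have H: "?H = {g \<in> carrier G. chi g = 0 \<and> fst (\<Theta> g) ?x = ?x}" by (auto simp: bb_eq)
  have \<Theta>B: "\<Theta> \<in> hom ?B signed_perms" unfolding bb_eq by (rule hom_subgroup[OF \<Theta>(1)]) auto
  have HB: "subgroup ?H ?B" by (rule wreath_stabilizer(1)[OF group_bestvina_brady group_sign_group \<Theta>B])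
  then have HG: "subgroup ?H G" using incl_subgroup[OF B, of ?H] by (simp add: bb_eq)
  have BH: "?B\<lparr>carrier := ?H\<rparr> = G\<lparr>carrier := ?H\<rparr>" by (simp add: bb_eq)
  have n': "0 < n" "1 < n" "2 < n" "3 < n" using n by auto
  have p_simps: "p 0 = cycle_a" "p 1 = cycle_b" "p 2 = cycle_c" "p 3 = cycle_d" by (simp_all add: p_def)
  note eval = \<Theta>w \<Theta>w_inv chi_w n' p_simps wreath_simps cycle_defs inv_mult_group
  define s q t where "s = w 0 \<otimes> inv (w 1)" and "q = w 1 \<otimes> inv (w 2)" and "t = w 2 \<otimes> inv (w 3)"
  note stq = s_def q_def t_def
  have mem: "q \<in> ?H" "s \<otimes> q \<otimes> inv s \<in> ?H" "s \<otimes> t \<in> ?H" "s \<otimes> s \<in> ?H" "t \<otimes> t \<in> ?H"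
    unfolding H by (simp_all add: stq eval)
  show ?thesis
  proof (rule not_raag_stabilizer[OF group_bestvina_brady \<Theta>B, of "s \<otimes> q \<otimes> inv s \<otimes> inv q" ?x])
    show "s \<otimes> q \<otimes> inv s \<otimes> inv q \<in> carrier ?B" by (simp add: bb_eq stq eval)
    show "fst (\<Theta> (s \<otimes> q \<otimes> inv s \<otimes> inv q)) ?x = ?x" "snd (\<Theta> (s \<otimes> q \<otimes> inv s \<otimes> inv q)) ?x = - 1"
      by (simp_all add: stq eval)
    fix \<psi> assume "\<psi> \<in> hom (?B\<lparr>carrier := ?H\<rparr>) integer_group"
    then have \<psi>: "\<psi> \<in> hom (G\<lparr>carrier := ?H\<rparr>) integer_group" by (simp only: BH)
    \<comment> \<open>On the arc from 3 back to 0 every vertex flips only the second coordinate, so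
      an even number of such factors fixes the base point.\<close>
    have fst_p: "fst (p i) = (\<lambda>(i, j). (i, \<not> j))" if "i = 0 \<or> 3 \<le> i" for i
      using that by (auto simp: p_def cycle_defs)
    have path_mem: "w i \<otimes> inv (w j) \<in> ?H"
      "w i \<otimes> (w i \<otimes> (inv (w j) \<otimes> inv (w j))) \<in> ?H"
      "w i \<otimes> (w i \<otimes> (w i \<otimes> (inv (w j) \<otimes> (inv (w j) \<otimes> inv (w j))))) \<in> ?H"
      if "i < n" "j < n" "i = 0 \<or> 3 \<le> i" "j = 0 \<or> 3 \<le> j" for i j
      unfolding H using that by (simp_all add: \<Theta>w \<Theta>w_inv chi_w wreath_simps fst_p)
    let ?q2 = "\<lambda>j. w 3 \<otimes> (w 3 \<otimes> (inv (w j) \<otimes> inv (w j)))"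
    let ?q3 = "\<lambda>j. w 3 \<otimes> (w 3 \<otimes> (w 3 \<otimes> (inv (w j) \<otimes> (inv (w j) \<otimes> inv (w j)))))"
    have path_next: "\<psi> (?q2 j) = 2 * \<psi> (w 3 \<otimes> inv (w j)) \<and> \<psi> (?q3 j) = 3 * \<psi> (w 3 \<otimes> inv (w j))"
      if "\<psi> (?q2 i) = 2 * \<psi> (w 3 \<otimes> inv (w i)) \<and> \<psi> (?q3 i) = 3 * \<psi> (w 3 \<otimes> inv (w i))"
        "i < n" "j < n" "i = 0 \<or> 3 \<le> i" "j = 0 \<or> 3 \<le> j" "w i \<otimes> w j = w j \<otimes> w i" for i j
      using path_step[OF HG \<psi> wc[OF n'(4)] wc[OF that(2)] wc[OF that(3)] that(6)]
        path_mem(1)[OF that(2-5)] path_mem[OF n'(4) that(2) _ that(4)] that(1) by auto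
    have \<psi>1: "\<psi> \<one> = 0"
      using hom_one[OF \<psi> subgroup.subgroup_is_group[OF HG is_group] group_integer_group] by simp
    \<comment> \<open>At the start \<open>j = 3\<close> all quotients are trivial.\<close>
    have "3 \<le> j \<Longrightarrow> j < n \<Longrightarrow> \<psi> (?q2 j) = 2 * \<psi> (w 3 \<otimes> inv (w j)) \<and> \<psi> (?q3 j) = 3 * \<psi> (w 3 \<otimes> inv (w j))" for j
    proof (induction j rule: dec_induct)
      case base
      then show ?case using n' by (simp add: cancel_left \<psi>1)
    next
      case (step k)
      then have "\<psi> (?q2 k) = 2 * \<psi> (w 3 \<otimes> inv (w k)) \<and> \<psi> (?q3 k) = 3 * \<psi> (w 3 \<otimes> inv (w k))" by simp
      then show ?case
        by (rule path_next) (use step.hyps step.prems w_comm[of k "Suc k"] in auto)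
    qed
    then have "\<psi> (?q2 (n - 1)) = 2 * \<psi> (w 3 \<otimes> inv (w (n - 1))) \<and> \<psi> (?q3 (n - 1)) = 3 * \<psi> (w 3 \<otimes> inv (w (n - 1)))"
      using n by simp
    \<comment> \<open>The closing edge from \<open>n - 1\<close> to 0 completes the arc and reaches
      the vertex \<open>a\<close> of the relations.\<close>
    from path_next[OF this, of 0] have q: "\<psi> (?q2 0) = 2 * \<psi> (w 3 \<otimes> inv (w 0))" "\<psi> (?q3 0) = 3 * \<psi> (w 3 \<otimes> inv (w 0))"
      using n w_comm[of 0 "n - 1"] by auto
    show "\<psi> (s \<otimes> q \<otimes> inv s \<otimes> inv q) = 0"
      unfolding s_def q_def
    proof (rule cycle_torsion[OF HG \<psi>, where d = "w 3"])
      show "w 0 \<otimes> w 1 = w 1 \<otimes> w 0" "w 1 \<otimes> w 2 = w 2 \<otimes> w 1" "w 2 \<otimes> w 3 = w 3 \<otimes> w 2"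
        using w_comm[of 0 1] w_comm[of 1 2] w_comm[of 2 3] n' by simp_all
    qed (use n' mem q path_mem[OF n'(4,1)] in \<open>simp_all add: stq\<close>)
  qed
qed

section \<open>Forbidden induced subgraphs as adjacency patterns, and the conclusion\<close>

lemma simplicial_gem_graph: "simplicial_graph gem_graph"
  by (simp add: simplicial_graph_def gem_graph_def)

lemma simplicial_overlapping_gems_graph: "simplicial_graph overlapping_gems_graph"
  by (simp add: simplicial_graph_def overlapping_gems_graph_def)

context simplicial
begin

lemma gem_freeI:
  assumes "\<not> has_induced \<Gamma> gem_graph"
  shows gem_free
  unfolding gem_free_def
proof (intro allI impI notI)
  fix a b d e c
  assume adj: "adj a b" "adj b d" "adj d e" "\<not> adj a d" "\<not> adj a e" "\<not> adj b e"
    "adj c a" "adj c b" "adj c d" "adj c e"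
  define f where "f x = (case x of Gem_a1 \<Rightarrow> a | Gem_a2 \<Rightarrow> b | Gem_a3 \<Rightarrow> d | Gem_a4 \<Rightarrow> e | Gem_c \<Rightarrow> c)" for x
  have nsym: "\<not> adj d a" "\<not> adj e a" "\<not> adj e b" using adj adj_sym by blast+
  have irrefl: "\<not> adj x x" for x using adj_neq by blast
  have "has_induced \<Gamma> gem_graph"
  proof (rule has_induced_adjI[OF simplicial_gem_graph, of f])
    show "f ` verts gem_graph \<subseteq> verts \<Gamma>" using adj adj_verts by (auto simp: gem_graph_def f_def)
    show "adj (f x) (f y) \<longleftrightarrow> {x, y} \<in> edges gem_graph" for x y
      by (cases x; cases y) (simp_all add: f_def gem_graph_def doubleton_eq_iff adj nsym irrefl adj(1-3,7-10)[THEN adj_sym])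
    show "inj_on f (verts gem_graph)"
      using adj nsym irrefl by (auto simp: inj_on_def gem_graph_def f_def)
  qed
  then show False using assms by simp
qed

end

lemma (in simplicial) overlapping_gems_freeI:
  assumes "\<not> has_induced \<Gamma> overlapping_gems_graph"
  shows overlapping_gems_free
  unfolding overlapping_gems_free_def
proof (intro allI impI, rule ccontr)
  fix a b c d e f
  assume adj: "adj b c" "adj b e" "adj b f" "adj c e" "adj c f" "adj e f"
    "adj a b" "adj a f" "adj d c" "adj d e" "\<not> adj a c" "\<not> adj a e" "\<not> adj a d" "\<not> adj d b" "\<not> adj d f"
  define h where "h x = (case x of OG_a \<Rightarrow> a | OG_b \<Rightarrow> b | OG_c \<Rightarrow> c | OG_d \<Rightarrow> d | OG_e \<Rightarrow> e | OG_f \<Rightarrow> f)" for x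
  have nsym: "\<not> adj c a" "\<not> adj e a" "\<not> adj d a" "\<not> adj b d" "\<not> adj f d" using adj adj_sym by blast+
  have irrefl: "\<not> adj x x" for x using adj_neq by blast
  have "has_induced \<Gamma> overlapping_gems_graph"
  proof (rule has_induced_adjI[OF simplicial_overlapping_gems_graph, of h])
    show "h ` verts overlapping_gems_graph \<subseteq> verts \<Gamma>"
      using adj adj_verts by (auto simp: overlapping_gems_graph_def h_def)
    show "adj (h x) (h y) \<longleftrightarrow> {x, y} \<in> edges overlapping_gems_graph" for x y
      by (cases x; cases y) (simp_all add: h_def overlapping_gems_graph_def doubleton_eq_iff adj nsym irrefl
          adj(1-10)[THEN adj_sym])
    show "inj_on h (verts overlapping_gems_graph)"
      using adj nsym irrefl by (auto simp: inj_on_def overlapping_gems_graph_def h_def)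
  qed
  then show False using assms by simp
qed

theorem theoremA:
  fixes \<Gamma> :: "'a sgraph"
  assumes "simplicial_graph \<Gamma>"
    and "finite (verts \<Gamma>)"
    and "connected_graph \<Gamma>"
  shows "(\<forall>H. subgroup H (bestvina_brady \<Gamma>) \<longrightarrow> is_raag ((bestvina_brady \<Gamma>)\<lparr>carrier := H\<rparr>)) \<longleftrightarrow>
         chordal \<Gamma> \<and> \<not> has_induced \<Gamma> gem_graph \<and> \<not> has_induced \<Gamma> overlapping_gems_graph"
proof
  interpret simplicial_raag \<Gamma> "raag \<Gamma>" using assms(1) by unfold_locales auto
  {
    assume "\<forall>H. subgroup H (bestvina_brady \<Gamma>) \<longrightarrow> is_raag ((bestvina_brady \<Gamma>)\<lparr>carrier := H\<rparr>)"
    then show "chordal \<Gamma> \<and> \<not> has_induced \<Gamma> gem_graph \<and> \<not> has_induced \<Gamma> overlapping_gems_graph"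
      using bb_cycle_not_raag bb_gem_not_raag bb_overlapping_gems_not_raag
      unfolding chordal_def by blast
  }
  assume free: "chordal \<Gamma> \<and> \<not> has_induced \<Gamma> gem_graph \<and> \<not> has_induced \<Gamma> overlapping_gems_graph"
  have raag: "hereditarily_raag (verts \<Gamma>)"
    using free assms(2) graph.conn_verts[OF assms(3)]
    by (intro hereditarily_raag_chordal graph.gem_freeI graph.overlapping_gems_freeI) auto
  show "\<forall>H. subgroup H (bestvina_brady \<Gamma>) \<longrightarrow> is_raag ((bestvina_brady \<Gamma>)\<lparr>carrier := H\<rparr>)"
  proof (intro allI impI)
    fix H assume "subgroup H (bestvina_brady \<Gamma>)"
    then have "subgroup H (raag \<Gamma>)" "H \<subseteq> bb_parabolic (verts \<Gamma>)"
      using incl_subgroup[OF bb_subgroup, of H] subgroup.subset[of H "bestvina_brady \<Gamma>"]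
      by (auto simp: bb_eq bb_parabolic_def parabolic_verts)
    then show "is_raag ((bestvina_brady \<Gamma>)\<lparr>carrier := H\<rparr>)"
      using raag by (simp add: hereditarily_raag_def bb_eq)
  qed
qed

end
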